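(* Let $\overline{G}=G\cup\partial G$ be a separable compactification of a countable group $G$, compatible with the group structure, satisfying conditions (CP) and (CS) (both recalled in the context), and let $\mu$ be a probability measure on $G$ such that the subgroup $\mathrm{gr}(\mu)$ generated by its support is nonelementary with respect to this compactification. Then $\mathbf{P}$-a.e. sample path $\boldsymbol{x}=\{x_n\}$ of the random walk $(G,\mu)$ converges in $\overline{G}$ to a limit $\Pi\boldsymbol{x}\in\partial G$. The limit measure $\lambda=\Pi\mathbf{P}$ is purely nonatomic, the measure space $(\partial G,\lambda)$ is a $\mu$-boundary, and $\lambda$ is the unique $\mu$-stationary probability measure on $\partial G$.
   Context: Random walks. For a countable group $G$ and a probability measure $\mu$ on $G$, the (right) random walk $(G,\mu)$ is the Markov chain on $G$ with transition probabilities $p(x,y)=\mu(x^{-1}y)$; thus $x_n=x_0h_1h_2\cdots h_n$ with independent $\mu$-distributed increments $h_i$. $G^{\mathbb{Z}_+}$ is the space of sample paths $\boldsymbol{x}=\{x_n\}_{n\ge 0}$, on which $G$ acts coordinatewise from the left. $\mathbf{P}_\theta$ is the Markov measure on $G^{\mathbb{Z}_+}$ with initial distribution $\theta$; $\mathbf{P}=\mathbf{P}_{\delta_e}$; $m$ is the counting measure on $G$; $T$ is the time shift $\{x_n\}\mapsto\{x_{n+1}\}$. The Poisson boundary $\Gamma$ is the space of ergodic components of $T$ in the Lebesgue space $(G^{\mathbb{Z}_+},\mathbf{P}_m)$: there is a projection $\mathrm{bnd}:G^{\mathbb{Z}_+}\to\Gamma$ such that the $\sigma$-algebra of $T$-invariant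 measurable sets coincides (mod 0) with the $\sigma$-algebra of $\mathrm{bnd}$-preimages of measurable subsets of $\Gamma$. The $G$-action descends to $\Gamma$, and $\Gamma$ is endowed with the harmonic measure $\nu=\mathrm{bnd}(\mathbf{P})$. A $\mu$-boundary is the quotient $(\Gamma_\xi,\nu_\xi)$ of $(\Gamma,\nu)$ by a $G$-invariant measurable partition $\xi$; in particular, if $\Pi$ is a $T$-invariant $G$-equivariant measurable map from $(G^{\mathbb{Z}_+},\mathbf{P})$ to a $G$-space $B$, then $(B,\Pi\mathbf{P})$ is a $\mu$-boundary. A measure $\lambda$ on a $G$-space is $\mu$-stationary if $\lambda=\sum_g\mu(g)\,g\lambda$. Compactifications. A compactification $\overline{G}=G\cup\partial G$ is compatible with the group structure if the action of $G$ on itself by left translations extends to an action on $\overline{G}$ by homeomorphisms. The conditions are: (CP) If a sequence $g_n\in G$ converges to a point of $\partial G$ in $\overline{G}$, then for every $x\in G$ the sequence $g_nx$ converges to the same limit. (CS) $\partial G$ consists of at least 3 points, and there is a $G$-equivariant Borel map $S$ assigning to pairs of distinct points $(b_1,b_2)$ of $\partial G$ nonempty subsets (strips) $S(b_1,b_2)\subset G$ such that for any 3 pairwise distinct points $\overline{b}_0,\overline{b}_1,\overline{b}_2\in\partial G$ there exist neighbourhoods $\overline{b}_0\in\mathcal{O}_0\subset\overline{G}$ and $\overline{b}_i\in\mathcal{O}_i\subset\partial G$, $i=1,2$, with $S(b_1,b_2)\cap\mathcal{O}_0=\varnothing$ for all $b_i\in\mathcal{O}_i$, $i=1,2$. A subgroup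 $G'\subset G$ is elementary with respect to $\overline{G}$ if $G'$ fixes (as a set) a nonempty finite subset of $\partial G$; otherwise it is nonelementary. *)

theory Defs
  imports "HOL-Probability.Probability" "HOL-Algebra.Algebra"
begin

section \<open>Compactifications of groups\<close>

text \<open>
  The compactification is a topological space \<^typ>\<open>'b\<close>, into which the discrete group \<^term>\<open>G\<close>
  is embedded by \<^term>\<open>\<iota>\<close>.  ``Separable'' means second countable and is expressed, together with
  the Hausdorff property, by the sort of \<^typ>\<open>'b\<close>; these compactifications are
  exactly the metrizable ones.
\<close>

definition compactification ::
  "('a, 'm) monoid_scheme \<Rightarrow> ('a \<Rightarrow> 'b::{second_countable_topology, t2_space}) \<Rightarrow> bool" where
  "compactification G \<iota> \<longleftrightarrow>
     compact (UNIV :: 'b set) \<and>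
     embedding_map (discrete_topology (carrier G)) euclidean \<iota> \<and>
     closure (\<iota> ` carrier G) = UNIV"

definition boundary :: "('a, 'm) monoid_scheme \<Rightarrow> ('a \<Rightarrow> 'b) \<Rightarrow> 'b set" where
  "boundary G \<iota> = UNIV - \<iota> ` carrier G"

text \<open>
  The extended action \<^term>\<open>\<alpha>\<close> is a parameter: the image of \<^term>\<open>G\<close> is dense, so there is
  at most one extension.
\<close>

definition compatible_action ::
  "('a, 'm) monoid_scheme \<Rightarrow> ('a \<Rightarrow> 'b::topological_space) \<Rightarrow> ('a \<Rightarrow> 'b \<Rightarrow> 'b) \<Rightarrow> bool" where
  "compatible_action G \<iota> \<alpha> \<longleftrightarrow>
     group_action G UNIV \<alpha> \<and>
     (\<forall>g\<in>carrier G. homeomorphic_map euclidean euclidean (\<alpha> g)) \<and>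
     (\<forall>g\<in>carrier G. \<forall>x\<in>carrier G. \<alpha> g (\<iota> x) = \<iota> (g \<otimes>\<^bsub>G\<^esub> x))"

definition condition_CP ::
  "('a, 'm) monoid_scheme \<Rightarrow> ('a \<Rightarrow> 'b::topological_space) \<Rightarrow> bool" where
  "condition_CP G \<iota> \<longleftrightarrow>
     (\<forall>g :: nat \<Rightarrow> 'a. \<forall>b\<in>boundary G \<iota>.
        range g \<subseteq> carrier G \<longrightarrow> (\<lambda>n. \<iota> (g n)) \<longlonglongrightarrow> b \<longrightarrow>
        (\<forall>x\<in>carrier G. (\<lambda>n. \<iota> (g n \<otimes>\<^bsub>G\<^esub> x)) \<longlonglongrightarrow> b))"

text \<open>
  Strips form a map into the subsets of \<^term>\<open>G\<close>, that is into the product of countably many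
  copies of a two-point space; such a map is Borel iff all its coordinates, the predicates
  \<open>g \<in> S b\<^sub>1 b\<^sub>2\<close>, are Borel.  The values \<open>S b\<^sub>1 b\<^sub>2\<close> are irrelevant when
  \<open>b\<^sub>1 = b\<^sub>2\<close> or one of the points is not in the boundary.
\<close>

definition condition_CS ::
  "('a, 'm) monoid_scheme \<Rightarrow> ('a \<Rightarrow> 'b::topological_space) \<Rightarrow> ('a \<Rightarrow> 'b \<Rightarrow> 'b) \<Rightarrow> bool" where
  "condition_CS G \<iota> \<alpha> \<longleftrightarrow>
     (\<exists>F\<subseteq>boundary G \<iota>. card F = 3) \<and>
     (\<exists>S :: 'b \<Rightarrow> 'b \<Rightarrow> 'a set.
        (\<forall>b1\<in>boundary G \<iota>. \<forall>b2\<in>boundary G \<iota>. b1 \<noteq> b2 \<longrightarrow>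
           S b1 b2 \<noteq> {} \<and> S b1 b2 \<subseteq> carrier G \<and>
           (\<forall>g\<in>carrier G. S (\<alpha> g b1) (\<alpha> g b2) = (\<lambda>s. g \<otimes>\<^bsub>G\<^esub> s) ` S b1 b2)) \<and>
        (\<forall>g\<in>carrier G.
           Measurable.pred
             (restrict_space borel {(b1, b2). b1 \<in> boundary G \<iota> \<and> b2 \<in> boundary G \<iota> \<and> b1 \<noteq> b2})
             (\<lambda>(b1, b2). g \<in> S b1 b2)) \<and>
        (\<forall>c0\<in>boundary G \<iota>. \<forall>c1\<in>boundary G \<iota>. \<forall>c2\<in>boundary G \<iota>.
           c0 \<noteq> c1 \<longrightarrow> c0 \<noteq> c2 \<longrightarrow> c1 \<noteq> c2 \<longrightarrow>
           (\<exists>O0 O1 O2.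
              open O0 \<and> c0 \<in> O0 \<and>
              openin (top_of_set (boundary G \<iota>)) O1 \<and> c1 \<in> O1 \<and>
              openin (top_of_set (boundary G \<iota>)) O2 \<and> c2 \<in> O2 \<and>
              (\<forall>b1\<in>O1. \<forall>b2\<in>O2. b1 \<noteq> b2 \<longrightarrow> \<iota> ` S b1 b2 \<inter> O0 = {}))))"

definition elementary ::
  "('a, 'm) monoid_scheme \<Rightarrow> ('a \<Rightarrow> 'b) \<Rightarrow> ('a \<Rightarrow> 'b \<Rightarrow> 'b) \<Rightarrow> 'a set \<Rightarrow> bool" where
  "elementary G \<iota> \<alpha> H \<longleftrightarrow>
     (\<exists>F. finite F \<and> F \<noteq> {} \<and> F \<subseteq> boundary G \<iota> \<and> (\<forall>g\<in>H. \<alpha> g ` F = F))"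

definition boundary_borel ::
  "('a, 'm) monoid_scheme \<Rightarrow> ('a \<Rightarrow> 'b::topological_space) \<Rightarrow> 'b measure" where
  "boundary_borel G \<iota> = restrict_space borel (boundary G \<iota>)"


section \<open>Random walks\<close>

definition probability_on_group :: "('a, 'm) monoid_scheme \<Rightarrow> 'a measure \<Rightarrow> bool" where
  "probability_on_group G \<mu> \<longleftrightarrow> prob_space \<mu> \<and> sets \<mu> = Pow (carrier G)"

definition gr :: "('a, 'm) monoid_scheme \<Rightarrow> 'a measure \<Rightarrow> 'a set" where
  "gr G \<mu> = generate G {g \<in> carrier G. emeasure \<mu> {g} \<noteq> 0}"

definition path_space :: "('a, 'm) monoid_scheme \<Rightarrow> (nat \<Rightarrow> 'a) measure" where
  "path_space G = PiM UNIV (\<lambda>_. count_space (carrier G))"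

text \<open>The increment \<open>h\<^sub>n\<^sub>+\<^sub>1\<close> of the random walk is \<^term>\<open>h n\<close>.\<close>

primrec walk :: "('a, 'm) monoid_scheme \<Rightarrow> 'a \<Rightarrow> (nat \<Rightarrow> 'a) \<Rightarrow> nat \<Rightarrow> 'a" where
  "walk G x h 0 = x"
| "walk G x h (Suc n) = walk G x h n \<otimes>\<^bsub>G\<^esub> h n"

definition markov_measure ::
  "('a, 'm) monoid_scheme \<Rightarrow> 'a measure \<Rightarrow> 'a measure \<Rightarrow> (nat \<Rightarrow> 'a) measure" where
  "markov_measure G \<mu> \<theta> =
     distr (\<theta> \<Otimes>\<^sub>M PiM UNIV (\<lambda>_::nat. \<mu>)) (path_space G) (\<lambda>(x, h). walk G x h)"

abbreviation path_measure :: "('a, 'm) monoid_scheme \<Rightarrow> 'a measure \<Rightarrow> (nat \<Rightarrow> 'a) measure" where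
  "path_measure G \<mu> \<equiv> markov_measure G \<mu> (return (count_space (carrier G)) \<one>\<^bsub>G\<^esub>)"

abbreviation counting_path_measure ::
  "('a, 'm) monoid_scheme \<Rightarrow> 'a measure \<Rightarrow> (nat \<Rightarrow> 'a) measure" where
  "counting_path_measure G \<mu> \<equiv> markov_measure G \<mu> (count_space (carrier G))"

definition invariant_sets :: "('a, 'm) monoid_scheme \<Rightarrow> (nat \<Rightarrow> 'a) set set" where
  "invariant_sets G =
     {A \<in> sets (path_space G). (\<lambda>x n. x (Suc n)) -` A \<inter> space (path_space G) = A}"

definition stationary ::
  "('a, 'm) monoid_scheme \<Rightarrow> 'a measure \<Rightarrow> ('a \<Rightarrow> 'b \<Rightarrow> 'b) \<Rightarrow> 'b measure \<Rightarrow> bool" where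
  "stationary G \<mu> \<alpha> \<eta> \<longleftrightarrow>
     (\<forall>A\<in>sets \<eta>. emeasure \<eta> A =
        (\<integral>\<^sup>+ g. emeasure \<mu> {g} * emeasure (distr \<eta> \<eta> (\<alpha> g)) A \<partial>count_space (carrier G)))"

definition nonatomic :: "'b measure \<Rightarrow> bool" where
  "nonatomic M \<longleftrightarrow>
     (\<forall>A\<in>sets M. emeasure M A > 0 \<longrightarrow>
        (\<exists>B\<in>sets M. B \<subseteq> A \<and> 0 < emeasure M B \<and> emeasure M B < emeasure M A))"


section \<open>The Poisson boundary and its quotients\<close>

definition standard_borel_space :: "'c measure \<Rightarrow> bool" where
  "standard_borel_space M \<longleftrightarrow>
     (\<exists>R\<in>sets (borel :: real measure).
        \<exists>f\<in>measurable M (restrict_space borel R). \<exists>h\<in>measurable (restrict_space borel R) M.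
          (\<forall>p\<in>space M. h (f p) = p) \<and> (\<forall>r\<in>R. f (h r) = r))"

text \<open>
  The Poisson boundary is determined up to isomorphism mod 0; the predicate says that
  \<^term>\<open>\<Gamma>\<close> with the action \<^term>\<open>\<beta>\<close> and the projection \<^term>\<open>bnd\<close> realizes it.  Every
  Lebesgue space has a standard Borel model, and only the measurable structure of \<^term>\<open>\<Gamma>\<close>
  is used: its null sets are determined by the image of the Markov measure
  started from the counting measure, which need not be \<open>\<sigma>\<close>-finite.
\<close>

definition poisson_boundary ::
  "('a, 'm) monoid_scheme \<Rightarrow> 'a measure \<Rightarrow> 'c measure \<Rightarrow> ('a \<Rightarrow> 'c \<Rightarrow> 'c) \<Rightarrow>
   ((nat \<Rightarrow> 'a) \<Rightarrow> 'c) \<Rightarrow> bool" where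
  "poisson_boundary G \<mu> \<Gamma> \<beta> bnd \<longleftrightarrow>
     standard_borel_space \<Gamma> \<and>
     group_action G (space \<Gamma>) \<beta> \<and> (\<forall>g\<in>carrier G. \<beta> g \<in> measurable \<Gamma> \<Gamma>) \<and>
     bnd \<in> measurable (path_space G) \<Gamma> \<and>
     (\<forall>g\<in>carrier G. AE x in counting_path_measure G \<mu>.
        bnd (\<lambda>n. g \<otimes>\<^bsub>G\<^esub> x n) = \<beta> g (bnd x)) \<and>
     (\<forall>A\<in>invariant_sets G. \<exists>C\<in>sets \<Gamma>. AE x in counting_path_measure G \<mu>.
        x \<in> A \<longleftrightarrow> bnd x \<in> C) \<and>
     (\<forall>C\<in>sets \<Gamma>. \<exists>A\<in>invariant_sets G. AE x in counting_path_measure G \<mu>.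
        x \<in> A \<longleftrightarrow> bnd x \<in> C)"

definition harmonic_measure ::
  "('a, 'm) monoid_scheme \<Rightarrow> 'a measure \<Rightarrow> 'c measure \<Rightarrow> ((nat \<Rightarrow> 'a) \<Rightarrow> 'c) \<Rightarrow> 'c measure" where
  "harmonic_measure G \<mu> \<Gamma> bnd = distr (path_measure G \<mu>) \<Gamma> bnd"

text \<open>A partition is measurable (Rokhlin) if countably many measurable unions of its elements
  separate its elements.\<close>

definition measurable_partition :: "'c measure \<Rightarrow> 'c set set \<Rightarrow> bool" where
  "measurable_partition M \<xi> \<longleftrightarrow>
     partition_on (space M) \<xi> \<and>
     (\<exists>A :: nat \<Rightarrow> 'c set.
        (\<forall>n. A n \<in> sets M \<and> (\<exists>\<eta>\<subseteq>\<xi>. A n = \<Union>\<eta>)) \<and>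
        (\<forall>C\<in>\<xi>. \<forall>D\<in>\<xi>. C \<noteq> D \<longrightarrow>
           (\<exists>n. C \<subseteq> A n \<and> D \<inter> A n = {} \<or> D \<subseteq> A n \<and> C \<inter> A n = {})))"

definition quotient_measure :: "'c measure \<Rightarrow> 'c set set \<Rightarrow> 'c set measure" where
  "quotient_measure M \<xi> =
     distr M (sigma \<xi> {\<eta>. \<eta> \<subseteq> \<xi> \<and> \<Union>\<eta> \<in> sets M}) (\<lambda>p. THE C. C \<in> \<xi> \<and> p \<in> C)"

text \<open>
  The conull sets are required to be invariant because a measure on a \<^term>\<open>G\<close>-space (such as
  the harmonic measure) need not be quasi-invariant under elements outside the subgroup
  generated by the support of \<^term>\<open>\<mu>\<close>.
\<close>

definition isomorphic_mod0 ::
  "('a, 'm) monoid_scheme \<Rightarrow> 'c measure \<Rightarrow> ('a \<Rightarrow> 'c \<Rightarrow> 'c) \<Rightarrow> 'd measure \<Rightarrow> ('a \<Rightarrow> 'd \<Rightarrow> 'd) \<Rightarrow> bool"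
  where
  "isomorphic_mod0 G M a N b \<longleftrightarrow>
     (\<exists>M0\<in>sets M. \<exists>N0\<in>sets N. \<exists>f.
        emeasure M (space M - M0) = 0 \<and> emeasure N (space N - N0) = 0 \<and>
        (\<forall>g\<in>carrier G. a g ` M0 = M0 \<and> b g ` N0 = N0) \<and>
        bij_betw f M0 N0 \<and>
        f \<in> measurable (restrict_space M M0) (restrict_space N N0) \<and>
        the_inv_into M0 f \<in> measurable (restrict_space N N0) (restrict_space M M0) \<and>
        distr (restrict_space M M0) (restrict_space N N0) f = restrict_space N N0 \<and>
        (\<forall>g\<in>carrier G. \<forall>p\<in>M0. f (a g p) = b g (f p)))"

text \<open>
  A measure space with a \<^term>\<open>G\<close>-action is a \<open>\<mu>\<close>-boundary if it is a quotient of the Poisson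
  boundary by an invariant measurable partition.  Lebesgue spaces are complete, hence the
  completions.
\<close>

definition mu_boundary ::
  "('a, 'm) monoid_scheme \<Rightarrow> 'a measure \<Rightarrow> 'c measure \<Rightarrow> ('a \<Rightarrow> 'c \<Rightarrow> 'c) \<Rightarrow>
   ((nat \<Rightarrow> 'a) \<Rightarrow> 'c) \<Rightarrow> 'b measure \<Rightarrow> ('a \<Rightarrow> 'b \<Rightarrow> 'b) \<Rightarrow> bool" where
  "mu_boundary G \<mu> \<Gamma> \<beta> bnd M \<alpha> \<longleftrightarrow>
     (\<exists>\<xi>. measurable_partition \<Gamma> \<xi> \<and> (\<forall>g\<in>carrier G. \<forall>C\<in>\<xi>. \<beta> g ` C \<in> \<xi>) \<and>
        isomorphic_mod0 G
          (quotient_measure (completion (harmonic_measure G \<mu> \<Gamma> bnd)) \<xi>) (\<lambda>g C. \<beta> g ` C)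
          (completion M) \<alpha>)"

end

theory Submission
  imports Defs
begin

text \<open>
  The idea of the proof is to let a stationary measure on the boundary detect the limit of the random
  walk.  A stationary measure \<open>L\<close> exists by compactness (\<open>stat_exists\<close>) and has no atoms, because its
  atoms of maximal mass would form a finite set invariant under \<open>gr(\<mu>)\<close> (\<open>stat_no_atoms\<close>).
  For a bounded function \<open>\<phi>\<close> on the compactification the function \<open>y \<mapsto> \<integral> \<phi> d(yL)\<close> is harmonic and
  therefore converges along almost every path (\<open>harmonic_convergent\<close>).

  The strips force the measures \<open>x\<^sub>n L\<close> to converge to point masses.  Let \<open>M\<close> be a stationary measure of
  the reflected walk.  The probability that the strip between an \<open>M\<close>-random and an \<open>x\<^sub>n L\<close>-random
  point meets \<open>x\<^sub>n K\<close>, for a finite set \<open>K\<close>, has a mean which does not depend on \<open>n\<close> (\<open>nn_expect_meets\<close>),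
  and which is close to one if \<open>K\<close> is large (\<open>meets_most\<close>).  Thus almost every path has
  infinitely many times at which this probability is almost one.  The walk is transient (\<open>transient\<close>), so such
  times have a subsequence along which \<open>x\<^sub>n\<close> tends to a boundary point \<open>b0\<close>.  By (CP) the sets \<open>x\<^sub>n K\<close> then tend
  to \<open>b0\<close>, and by (CS) they meet a strip in the limit only if one of its end points is close to
  \<open>b0\<close>, or both are close to each other; as \<open>M\<close> has no atoms, \<open>x\<^sub>n L\<close> must have most of its mass near
  \<open>b0\<close> (\<open>meets_estimate\<close>).  Since the mean distances to a given point converge along the whole path, this
  gives a point \<open>z\<close> such that \<open>x\<^sub>n L\<close> tends to the point mass at \<open>z\<close> (\<open>AE_concentrates\<close>).

  It remains to see that \<open>x\<^sub>n\<close> itself tends to \<open>z\<close>.  Along a further subsequence of one with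
  \<open>x\<^sub>n \<rightarrow> b0\<close>, almost every point \<open>b\<close> satisfies \<open>x\<^sub>n k b \<rightarrow> z\<close> for all \<open>k\<close> in a semigroup that contains the
  support of \<open>\<mu>\<close>.  If \<open>z\<close> and \<open>b0\<close> were different, suitable products of elements \<open>x\<^sub>n\<close> would tend to
  \<open>b0\<close> and would carry \<open>b\<close> towards \<open>z\<close> and some other point towards a third point, contrary to (CS)
  (\<open>limit_of_generic_orbit\<close>).

  Hence \<open>\<integral> \<phi> d(x\<^sub>n L)\<close> tends to the value of \<open>\<phi>\<close> at the limit of the path, while its mean is the
  integral of \<open>\<phi>\<close> with respect to \<open>L\<close>.  So every stationary measure is the law of the limit, which gives
  stationarity and uniqueness (\<open>stat_eq_hitting\<close>), and nonatomicity by the absence of atoms.  Finally, the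
  limit is invariant under the shift and therefore is a function \<open>f\<close> on the Poisson boundary
  (\<open>path_limit_factors\<close>), and the level sets of an equivariant function form a partition whose
  quotient is the image measure (\<open>equivariant_map_quotient\<close>).
\<close>

section \<open>Compact metrizable spaces\<close>

text \<open>The distance is a function and not a class operation, because the type of a compactification carries
  only its topology.  The bound \<open>1\<close> makes the distance integrable for all probability measures.\<close>

locale compact_metrizable =
  fixes d :: "'b::{second_countable_topology,t2_space} \<Rightarrow> 'b \<Rightarrow> real"
  assumes compact_UNIV: "compact (UNIV :: 'b set)"
    and continuous_d: "continuous_on UNIV (\<lambda>(x, y). d x y)"
    and d_commute: "d x y = d y x"
    and d_triangle: "d x z \<le> d x y + d y z"
    and d_nonneg: "0 \<le> d x y" and d_le_1: "d x y \<le> 1"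
    and d_eq_0_iff [simp]: "d x y = 0 \<longleftrightarrow> x = y"
begin

lemma convergent_subsequence:
  fixes u :: "nat \<Rightarrow> 'b"
  obtains l r where "strict_mono r" "(u \<circ> r) \<longlonglongrightarrow> l"
  using compact_imp_seq_compact[OF compact_UNIV] that
  by (auto simp: seq_compact_def)

lemma tendsto_d [tendsto_intros]:
  assumes "(u \<longlongrightarrow> x) F" "(v \<longlongrightarrow> y) F"
  shows "((\<lambda>i. d (u i) (v i)) \<longlongrightarrow> d x y) F"
proof -
  have "((\<lambda>i. (\<lambda>(x, y). d x y) (u i, v i)) \<longlongrightarrow> (\<lambda>(x, y). d x y) (x, y)) F"
    using continuous_d
    by (intro continuous_on_tendsto_compose[OF continuous_d] tendsto_Pair assms) auto
  then show ?thesis by simp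
qed

lemma continuous_on_d [continuous_intros]:
  assumes "continuous_on S f" "continuous_on S g"
  shows "continuous_on S (\<lambda>x. d (f x) (g x))"
  using assms unfolding continuous_on_def by (auto intro!: tendsto_d)

lemma measurable_d [measurable]:
  assumes [measurable]: "f \<in> borel_measurable M" "g \<in> borel_measurable M"
  shows "(\<lambda>x. d (f x) (g x)) \<in> borel_measurable M"
proof -
  have "(\<lambda>(x, y). d x y) \<in> borel_measurable borel"
    using continuous_d by (rule borel_measurable_continuous_onI)
  then have [measurable]: "(\<lambda>(x, y). d x y) \<in> borel_measurable (borel \<Otimes>\<^sub>M borel)"
    by (simp add: borel_prod)
  have "(\<lambda>x. (\<lambda>(x, y). d x y) (f x, g x)) \<in> borel_measurable M" by measurable
  then show ?thesis by simp
qed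

lemma d_self [simp]: "d x x = 0"
  by simp

lemma d_pos: "x \<noteq> y \<Longrightarrow> 0 < d x y"
  using d_nonneg[of x y] d_eq_0_iff[of x y] by linarith

lemma open_ball_d: "open {y. d y x < r}"
proof -
  have "continuous_on UNIV (\<lambda>y. d y x)" by (intro continuous_intros)
  then show ?thesis using open_Collect_less[of "\<lambda>y. d y x" "\<lambda>_. r"] by auto
qed

lemma d_Lipschitz: "\<bar>d x y - d x z\<bar> \<le> d y z"
  using d_triangle[of x y z] d_triangle[of x z y] d_commute[of y z] by linarith

lemma open_contains_ball_d:
  assumes "open U" "x \<in> U"
  obtains r where "0 < r" "{y. d y x < r} \<subseteq> U"
proof (cases "U = UNIV")
  case False
  have "compact (- U)"
    using compact_UNIV \<open>open U\<close> by (metis compact_Int_closed closed_Compl inf_top_left)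
  moreover have "continuous_on (- U) (\<lambda>y. d y x)" by (intro continuous_intros)
  ultimately obtain y where y: "y \<in> - U" "\<And>z. z \<in> - U \<Longrightarrow> d y x \<le> d z x"
    using continuous_attains_inf[of "- U" "\<lambda>y. d y x"] False by auto
  show ?thesis
  proof (rule that)
    show "0 < d y x" using y assms d_pos[of y x] by auto
    show "{z. d z x < d y x} \<subseteq> U" using y(2) by (force simp: not_less[symmetric])
  qed
qed (use that[of 1] in auto)

lemma tendsto_iff_d: "(u \<longlongrightarrow> l) F \<longleftrightarrow> ((\<lambda>i. d (u i) l) \<longlongrightarrow> 0) F"
proof
  assume "(u \<longlongrightarrow> l) F"
  then have "((\<lambda>i. d (u i) l) \<longlongrightarrow> d l l) F" by (intro tendsto_intros)
  then show "((\<lambda>i. d (u i) l) \<longlongrightarrow> 0) F" by simp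
next
  assume *: "((\<lambda>i. d (u i) l) \<longlongrightarrow> 0) F"
  show "(u \<longlongrightarrow> l) F"
  proof (rule topological_tendstoI)
    fix U assume "open U" "l \<in> U"
    then obtain r where r: "0 < r" "{y. d y l < r} \<subseteq> U" by (rule open_contains_ball_d)
    from order_tendstoD(2)[OF * r(1)] show "eventually (\<lambda>i. u i \<in> U) F"
      by eventually_elim (use r in auto)
  qed
qed

lemma tendsto_iff_d_inverse:
  "u \<longlonglongrightarrow> l \<longleftrightarrow> (\<forall>k. \<exists>N. \<forall>n\<ge>N. d (u n) l < 1 / real (Suc k))"
proof
  assume "u \<longlonglongrightarrow> l"
  then have lim: "(\<lambda>n. d (u n) l) \<longlonglongrightarrow> 0" by (simp add: tendsto_iff_d[of u])
  have "eventually (\<lambda>n. d (u n) l < 1 / real (Suc k)) sequentially" for k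
    by (rule order_tendstoD(2)[OF lim]) simp
  then show "\<forall>k. \<exists>N. \<forall>n\<ge>N. d (u n) l < 1 / real (Suc k)" by (simp add: eventually_sequentially)
next
  assume *: "\<forall>k. \<exists>N. \<forall>n\<ge>N. d (u n) l < 1 / real (Suc k)"
  have "(\<lambda>n. d (u n) l) \<longlonglongrightarrow> 0"
  proof (rule LIMSEQ_I)
    fix e :: real assume "0 < e"
    then obtain k where k: "inverse (real (Suc k)) < e" using reals_Archimedean by blast
    obtain N where N: "\<forall>n\<ge>N. d (u n) l < 1 / real (Suc k)" using * by blast
    have "norm (d (u n) l - 0) < e" if "N \<le> n" for n
    proof -
      have "d (u n) l < 1 / real (Suc k)" using N that by blast
      then show ?thesis using k d_nonneg[of "u n" l] by (simp add: inverse_eq_divide)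
    qed
    then show "\<exists>N. \<forall>n\<ge>N. norm (d (u n) l - 0) < e" by blast
  qed
  then show "u \<longlonglongrightarrow> l" by (simp add: tendsto_iff_d[of u])
qed

lemma countable_dense_subset:
  obtains D :: "'b set" where "countable D" "\<And>x r. 0 < r \<Longrightarrow> \<exists>z\<in>D. d z x < r"
proof -
  obtain D :: "'b set" where D: "countable D" "\<And>U. open U \<Longrightarrow> U \<noteq> {} \<Longrightarrow> \<exists>z\<in>D. z \<in> U"
    using countable_dense_exists by blast
  show ?thesis
  proof (rule that[OF D(1)])
    fix x :: 'b and r :: real assume "0 < r"
    then show "\<exists>z\<in>D. d z x < r"
      using D(2)[OF open_ball_d[of x r]] d_self[of x] by (metis (mono_tags, lifting) empty_iff mem_Collect_eq)
  qed
qed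

text \<open>If \<open>\<delta>\<close> is the distance to a closed set, then the continuous functions \<open>max 0 (1 - k * \<delta>)\<close> decrease to the
  indicator of the set, so the integrals of continuous functions determine the measures of the closed sets.\<close>

lemma measure_eqI_continuous:
  fixes M N :: "'b measure"
  assumes M: "finite_measure M" "sets M = sets borel"
    and N: "finite_measure N" "sets N = sets borel"
    and eq: "\<And>f :: 'b \<Rightarrow> real. continuous_on UNIV f \<Longrightarrow> integral\<^sup>L M f = integral\<^sup>L N f"
  shows "M = N"
proof -
  interpret M: finite_measure M by fact
  interpret N: finite_measure N by fact
  note [measurable_cong] = M(2) N(2)
  have closed_eq: "emeasure M F = emeasure N F" if F: "closed F" for F
  proof (cases "F = {}")
    case False
    define \<delta> where "\<delta> x = (INF y\<in>F. d x y)" for x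
    have bdd: "bdd_below (d x ` F)" for x using d_nonneg by (auto intro!: bdd_belowI[of _ 0])
    have \<delta>_le: "\<delta> x \<le> d x z + \<delta> z" for x z
    proof -
      have "\<delta> x - d x z \<le> \<delta> z" unfolding \<delta>_def[of z]
      proof (rule cINF_greatest[OF False])
        fix y assume "y \<in> F"
        then have "\<delta> x \<le> d x y" unfolding \<delta>_def by (intro cINF_lower bdd)
        then show "\<delta> x - d x z \<le> d z y" using d_triangle[of x y z] by linarith
      qed
      then show ?thesis by linarith
    qed
    have "continuous_on UNIV \<delta>" unfolding continuous_on_def
    proof (intro ballI)
      fix x :: 'b
      have "((\<lambda>z. d x z) \<longlongrightarrow> d x x) (at x)" by (intro tendsto_intros)
      then have "((\<lambda>z. d x z) \<longlongrightarrow> 0) (at x)" by simp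
      moreover have "norm (\<delta> z - \<delta> x) \<le> d x z" for z
        using \<delta>_le[of x z] \<delta>_le[of z x] d_commute[of x z] by (auto simp: abs_le_iff)
      ultimately have "((\<lambda>z. \<delta> z - \<delta> x) \<longlongrightarrow> 0) (at x)"
        by (intro Lim_null_comparison[of "\<lambda>z. \<delta> z - \<delta> x" "\<lambda>z. d x z"]) auto
      then show "(\<delta> \<longlongrightarrow> \<delta> x) (at x within UNIV)" by (simp add: Lim_null[symmetric])
    qed
    then have cont: "continuous_on UNIV (\<lambda>x. max 0 (1 - real k * \<delta> x))" for k
      by (intro continuous_intros)
    have \<delta>_nonneg: "0 \<le> \<delta> x" for x
      unfolding \<delta>_def using d_nonneg False by (intro cINF_greatest) auto
    have \<delta>_0: "\<delta> x = 0 \<longleftrightarrow> x \<in> F" for x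
    proof
      assume "x \<in> F"
      then show "\<delta> x = 0" using cINF_lower[OF bdd, of x x] \<delta>_nonneg[of x] by (simp add: \<delta>_def)
    next
      assume 0: "\<delta> x = 0"
      show "x \<in> F"
      proof (rule ccontr)
        assume "x \<notin> F"
        then obtain r where r: "0 < r" "{y. d y x < r} \<subseteq> - F"
          using open_contains_ball_d[of "- F" x] F by auto
        then have "r \<le> \<delta> x" unfolding \<delta>_def using False
          by (intro cINF_greatest) (auto simp: d_commute[of x] not_less[symmetric])
        then show False using 0 r by simp
      qed
    qed
    have lim: "(\<lambda>k. max 0 (1 - real k * \<delta> x)) \<longlonglongrightarrow> indicator F x" for x
    proof (cases "x \<in> F")
      case True
      then show ?thesis using \<delta>_0[of x] by simp
    next
      case False
      then have "0 < \<delta> x" using \<delta>_0[of x] \<delta>_nonneg[of x] by linarith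
      then obtain K where K: "1 < real K * \<delta> x" using reals_Archimedean3 by blast
      have "eventually (\<lambda>k. max 0 (1 - real k * \<delta> x) = 0) sequentially"
        using eventually_ge_at_top[of K]
      proof eventually_elim
        case (elim k)
        then have "real K * \<delta> x \<le> real k * \<delta> x" using \<open>0 < \<delta> x\<close> by (intro mult_right_mono) auto
        then show ?case using K by linarith
      qed
      then show ?thesis using False by (simp add: tendsto_eventually)
    qed
    have int_lim: "(\<lambda>k. integral\<^sup>L L (\<lambda>x. max 0 (1 - real k * \<delta> x))) \<longlonglongrightarrow> measure L F"
      if "finite_measure L" and [measurable_cong]: "sets L = sets borel" for L :: "'b measure"
    proof -
      interpret finite_measure L by fact
      have [measurable]: "F \<in> sets L" "(\<lambda>x. max 0 (1 - real k * \<delta> x)) \<in> borel_measurable L" for k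
        using F borel_measurable_continuous_onI[OF cont] by (auto cong: measurable_cong_sets)
      have "(\<lambda>k. integral\<^sup>L L (\<lambda>x. max 0 (1 - real k * \<delta> x))) \<longlonglongrightarrow> integral\<^sup>L L (indicator F)"
        using lim \<delta>_nonneg
        by (intro integral_dominated_convergence[where w = "\<lambda>_. 1"]) (auto intro!: AE_I2)
      also have "space L = UNIV" using sets_eq_imp_space_eq[OF that(2)] by simp
      then have "integral\<^sup>L L (indicator F) = measure L F" by simp
      finally show ?thesis .
    qed
    have "measure M F = measure N F"
      using LIMSEQ_unique[OF int_lim[OF M]] int_lim[OF N] eq[OF cont] by simp
    then show ?thesis by (simp add: M.emeasure_eq_measure N.emeasure_eq_measure)
  qed simp
  show ?thesis
  proof (rule measure_eqI_generator_eq[where E = "Collect closed" and \<Omega> = UNIV and A = "\<lambda>_. UNIV"])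
    show "Int_stable (Collect closed :: 'b set set)" by (auto simp: Int_stable_def)
    show "sets M = sigma_sets UNIV (Collect closed)"
      by (simp add: M(2) borel_eq_closed)
    show "sets N = sigma_sets UNIV (Collect closed)"
      by (simp add: N(2) borel_eq_closed)
  qed (use closed_eq M.emeasure_finite in auto)
qed

end

text \<open>Urysohn functions for the countably many pairs of basic open sets with disjoint closures
  embed the space into a countable power of the real line.\<close>

lemma compact_metrizable_exists:
  assumes compact: "compact (UNIV :: 'b::{second_countable_topology,t2_space} set)"
  shows "\<exists>d :: 'b \<Rightarrow> 'b \<Rightarrow> real. compact_metrizable d"
proof -
  have normal: "normal_space (euclidean :: 'b topology)"
    using compact by (intro compact_Hausdorff_or_regular_imp_normal_space)
      (auto simp: compact_space_def Hausdorff_space_def disjnt_def separation_t2)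
  obtain B :: "'b set set" where B: "countable B" "topological_basis B"
    using ex_countable_basis by blast
  have "\<exists>f :: 'b \<Rightarrow> real. continuous_on UNIV f \<and>
      (closure U \<inter> closure V = {} \<longrightarrow> f ` closure U \<subseteq> {0} \<and> f ` closure V \<subseteq> {1})" for U V :: "'b set"
  proof (cases "closure U \<inter> closure V = {}")
    case True
    then obtain f :: "'b \<Rightarrow> real" where "continuous_map euclidean euclideanreal f"
        "f ` closure U \<subseteq> {0}" "f ` closure V \<subseteq> {1}"
      using Urysohn_lemma_alt[OF normal, of "closure U" "closure V" 0 1]
      by (auto simp: disjnt_def)
    then show ?thesis by auto
  qed (auto intro: exI[of _ "\<lambda>_. 0"])
  then obtain f :: "'b set \<Rightarrow> 'b set \<Rightarrow> 'b \<Rightarrow> real" where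
    cont: "\<And>U V. continuous_on UNIV (f U V)" and
    f: "\<And>U V. closure U \<inter> closure V = {} \<Longrightarrow>
          f U V ` closure U \<subseteq> {0} \<and> f U V ` closure V \<subseteq> {1}"
    by metis
  define e :: "'b \<Rightarrow> nat \<Rightarrow> real"
    where "e x n = f (fst (from_nat_into (B \<times> B) n)) (snd (from_nat_into (B \<times> B) n)) x" for x n
  have cont_e: "continuous_on UNIV e"
    by (intro continuous_on_coordinatewise_then_product)
      (auto simp: e_def cont)
  have inj_e: "x = y" if "e x = e y" for x y
  proof (rule ccontr)
    assume "x \<noteq> y"
    then obtain U V where UV: "open U" "open V" "x \<in> U" "y \<in> V" "U \<inter> V = {}"
      using hausdorff by metis
    have reg: "\<exists>W\<in>B. z \<in> W \<and> closure W \<subseteq> S" if "open S" "z \<in> S" for z and S :: "'b set"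
    proof -
      have "closedin euclidean {z}" "closedin euclidean (- S)" "disjnt {z} (- S)"
        using that by (auto simp: disjnt_def)
      then have "\<exists>U' V'. openin euclidean U' \<and> openin euclidean V' \<and> {z} \<subseteq> U' \<and> - S \<subseteq> V' \<and> disjnt U' V'"
        using normal unfolding normal_space_def by blast
      then obtain U' V' where *: "open U'" "open V'" "z \<in> U'" "- S \<subseteq> V'" "U' \<inter> V' = {}"
        by (auto simp: disjnt_def)
      obtain W where W: "W \<in> B" "z \<in> W" "W \<subseteq> U'"
        using topological_basisE[OF B(2) *(1) *(3)] .
      have "closure W \<subseteq> - V'" using W * by (intro closure_minimal) auto
      then show ?thesis using W * by auto
    qed
    obtain U' V' where UV': "U' \<in> B" "V' \<in> B" "x \<in> U'" "y \<in> V'" "closure U' \<subseteq> U" "closure V' \<subseteq> V"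
      using reg[OF UV(1,3)] reg[OF UV(2,4)] by blast
    then have 1: "f U' V' x = 0" "f U' V' y = 1"
      using f[of U' V'] UV closure_subset[of U'] closure_subset[of V'] by blast+
    obtain n where "from_nat_into (B \<times> B) n = (U', V')"
      using from_nat_into_surj[of "B \<times> B" "(U', V')"] UV' B by auto
    then show False using fun_cong[OF that, of n] 1 by (simp add: e_def)
  qed
  define d where "d x y = min 1 (dist (e x) (e y))" for x y
  have "compact_metrizable d"
  proof
    have "continuous_on UNIV (\<lambda>p. e (fst p))" "continuous_on UNIV (\<lambda>p. e (snd p))"
      by (rule continuous_on_compose2[OF cont_e continuous_on_fst[OF continuous_on_id] subset_UNIV],
          rule continuous_on_compose2[OF cont_e continuous_on_snd[OF continuous_on_id] subset_UNIV])
    then show "continuous_on UNIV (\<lambda>(x, y). d x y)"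
      unfolding d_def case_prod_beta by (intro continuous_on_min continuous_on_const continuous_on_dist)
    show "d x z \<le> d x y + d y z" for x y z
      using dist_triangle[of "e x" "e z" "e y"] zero_le_dist[of "e x" "e y"]
        zero_le_dist[of "e y" "e z"] unfolding d_def by linarith
  qed (use compact inj_e in \<open>auto simp: d_def dist_commute min_def\<close>)
  then show ?thesis by (intro exI[of compact_metrizable d])
qed


section \<open>A Borel retraction of the line onto a compact metrizable space\<close>

text \<open>Binary digits are read in base three, so that different sequences of digits have different values.\<close>

definition ternary :: "(nat \<Rightarrow> bool) \<Rightarrow> real" where
  "ternary u = suminf (\<lambda>n. of_bool (u n) * (1/3)^n)"

lemma summable_ternary: "summable (\<lambda>n. of_bool (u n) * (1/3::real)^n)"
  by (rule summable_comparison_test[of _ "\<lambda>n. (1/3)^n"]) (auto intro!: exI[of _ 0])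

text \<open>The first digit that differs outweighs all the later ones together.\<close>

lemma ternary_separated:
  assumes "\<bar>ternary u - ternary v\<bar> < (1/3)^n / 2" "i \<le> n"
  shows "u i = v i"
proof (rule ccontr)
  assume neq: "u i \<noteq> v i"
  define j where "j = (LEAST j. u j \<noteq> v j)"
  have j: "u j \<noteq> v j" "\<And>k. k < j \<Longrightarrow> u k = v k"
    unfolding j_def using LeastI[of "\<lambda>j. u j \<noteq> v j", OF neq] not_less_Least by blast+
  have "j \<le> n" unfolding j_def using Least_le[of "\<lambda>j. u j \<noteq> v j", OF neq] assms(2) by linarith
  define a where "a k = (of_bool (u k) - of_bool (v k)) * (1/3::real)^k" for k
  have suma: "summable a" "ternary u - ternary v = suminf a"
    unfolding a_def ternary_def
    using summable_diff[OF summable_ternary[of u] summable_ternary[of v]]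
      suminf_diff[OF summable_ternary[of u] summable_ternary[of v]]
    by (auto simp: algebra_simps)
  have "suminf a = suminf (\<lambda>k. a (k + Suc j)) + (\<Sum>k<Suc j. a k)"
    by (rule suminf_split_initial_segment[OF suma(1)])
  also have "(\<Sum>k<Suc j. a k) = a j" using j(2) by (simp add: a_def)
  finally have split: "suminf a = suminf (\<lambda>k. a (k + Suc j)) + a j" .
  have geo: "summable (\<lambda>k. (1/3::real)^(k + Suc j))" "suminf (\<lambda>k. (1/3::real)^(k + Suc j)) = (1/3)^j / 2"
    using suminf_mult[of "\<lambda>k. (1/3::real)^k" "(1/3)^Suc j"] suminf_geometric[of "1/3::real"]
    by (auto simp: power_add algebra_simps intro!: summable_mult summable_mult2)
  have "\<bar>suminf (\<lambda>k. a (k + Suc j))\<bar> \<le> suminf (\<lambda>k. (1/3::real)^(k + Suc j))"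
  proof -
    have le: "\<bar>a (k + Suc j)\<bar> \<le> (1/3::real)^(k + Suc j)" for k by (auto simp: a_def)
    then have "summable (\<lambda>k. \<bar>a (k + Suc j)\<bar>)"
      by (intro summable_comparison_test[OF _ geo(1)]) auto
    then show ?thesis
      using summable_rabs[of "\<lambda>k. a (k + Suc j)"] suminf_le[OF le _ geo(1)] by linarith
  qed
  moreover have "\<bar>a j\<bar> = (1/3)^j" using j(1) by (auto simp: a_def)
  ultimately have "(1/3)^j / 2 \<le> \<bar>ternary u - ternary v\<bar>"
    using split geo(2) suma(2) by linarith
  moreover have "(1/3::real)^n \<le> (1/3)^j" using \<open>j \<le> n\<close> by (intro power_decreasing) auto
  ultimately show False using assms(1) by linarith
qed

lemma measurable_ternary [measurable]:
  assumes [measurable]: "\<And>n. Measurable.pred M (P n)"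
  shows "(\<lambda>x. ternary (\<lambda>n. P n x)) \<in> borel_measurable M"
  unfolding ternary_def of_bool_def by measurable

lemma ternary_bounds: "0 \<le> ternary u" "ternary u \<le> 2"
proof -
  show "0 \<le> ternary u" unfolding ternary_def by (intro suminf_nonneg summable_ternary) auto
  have "ternary u \<le> suminf (\<lambda>n. (1/3::real)^n)" unfolding ternary_def
    by (intro suminf_le summable_ternary) auto
  also have "\<dots> \<le> 2" using suminf_geometric[of "1/3::real"] by simp
  finally show "ternary u \<le> 2" .
qed

context compact_metrizable
begin

lemma tendsto_if_subsequences:
  fixes u :: "nat \<Rightarrow> 'b"
  assumes "\<And>r l. strict_mono r \<Longrightarrow> (u \<circ> r) \<longlonglongrightarrow> l \<Longrightarrow> l = x"
  shows "u \<longlonglongrightarrow> x"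
proof (rule topological_tendstoI, rule ccontr)
  fix U :: "'b set" assume U: "open U" "x \<in> U" "\<not> eventually (\<lambda>n. u n \<in> U) sequentially"
  obtain r :: "nat \<Rightarrow> nat" where r: "strict_mono r" "\<And>n. u (r n) \<notin> U"
    using not_eventually_sequentiallyD[OF U(3)] by blast
  obtain s l where s: "strict_mono s" "((u \<circ> r) \<circ> s) \<longlonglongrightarrow> l"
    by (rule convergent_subsequence)
  have "l = x" using s r by (intro assms[of "r \<circ> s"]) (simp_all add: o_assoc strict_mono_o)
  then have "eventually (\<lambda>n. ((u \<circ> r) \<circ> s) n \<in> U) sequentially"
    using topological_tendstoD[OF s(2) U(1)] U(2) by simp
  then show False using r by (auto dest: eventually_happens)
qed

definition basis :: "nat \<Rightarrow> 'b set" where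
  "basis = (SOME B. topological_basis (range B))"

lemma basis: "topological_basis (range basis)"
proof -
  obtain B :: "'b set set" where B: "countable B" "topological_basis B"
    using ex_countable_basis by blast
  have "B \<noteq> {}" using topological_basisE[OF B(2) open_UNIV UNIV_I] by auto
  then have "range (from_nat_into B) = B" using B by simp
  then have "topological_basis (range (from_nat_into B))" using B by simp
  then have "\<exists>B :: nat \<Rightarrow> 'b set. topological_basis (range B)" by blast
  then show ?thesis unfolding basis_def by (rule someI_ex)
qed

lemma open_basis: "open (basis n)"
  using topological_basis_open[OF basis] by auto

text \<open>The code of a point lists the basic open sets that contain it.  The set of codes need not be closed, but its
  closure is still mapped continuously to the space: a sequence of points whose codes converge is convergent.\<close>

definition code :: "'b \<Rightarrow> real" where
  "code x = ternary (\<lambda>n. x \<in> basis n)"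

definition codes :: "real set" where
  "codes = closure (range code)"

definition decode :: "real \<Rightarrow> 'b" where
  "decode y = (if y \<in> codes then SOME x. \<exists>u. (\<lambda>n. code (u n)) \<longlonglongrightarrow> y \<and> u \<longlonglongrightarrow> x else undefined)"

lemma measurable_code [measurable]: "code \<in> borel_measurable borel"
proof -
  have [measurable]: "basis n \<in> sets borel" for n using open_basis by auto
  show ?thesis unfolding code_def[abs_def] by measurable
qed

text \<open>The code of a point determines the basic open sets containing it, so points with nearby codes
  cannot be separated by one of the first few basic open sets.\<close>

lemma code_limits_unique:
  assumes u: "(\<lambda>n. code (u n)) \<longlonglongrightarrow> y" "u \<longlonglongrightarrow> x"
    and v: "(\<lambda>n. code (v n)) \<longlonglongrightarrow> y" "v \<longlonglongrightarrow> x'"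
  shows "x = x'"
proof (rule ccontr)
  assume "x \<noteq> x'"
  define r where "r = d x x' / 2"
  have r: "0 < r" "d x x' = 2 * r" using d_pos[OF \<open>x \<noteq> x'\<close>] by (auto simp: r_def)
  obtain B where "B \<in> range basis" "x \<in> B" "B \<subseteq> {z. d z x < r}"
    using topological_basisE[OF basis open_ball_d, of x x r] r by auto
  then obtain j where j: "x \<in> basis j" "basis j \<subseteq> {z. d z x < r}" by auto
  have "eventually (\<lambda>n. u n \<in> basis j) sequentially"
    using topological_tendstoD[OF u(2) open_basis j(1)] .
  moreover have "(\<lambda>n. d (v n) x) \<longlonglongrightarrow> d x' x" by (intro tendsto_intros v)
  then have "eventually (\<lambda>n. r < d (v n) x) sequentially"
    using r d_commute[of x x'] by (intro order_tendstoD) auto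
  moreover have "(\<lambda>n. \<bar>code (u n) - code (v n)\<bar>) \<longlonglongrightarrow> \<bar>y - y\<bar>" by (intro tendsto_intros u v)
  then have "eventually (\<lambda>n. \<bar>code (u n) - code (v n)\<bar> < (1/3)^j / 2) sequentially"
    by (intro order_tendstoD) auto
  ultimately have "eventually (\<lambda>n. False) sequentially"
  proof eventually_elim
    case (elim n)
    then have "u n \<in> basis j \<longleftrightarrow> v n \<in> basis j"
      using ternary_separated[of "\<lambda>i. u n \<in> basis i" "\<lambda>i. v n \<in> basis i" j j]
      by (simp add: code_def)
    then show ?case using elim j by auto
  qed
  then show False by simp
qed

lemma decode_limit:
  assumes u: "(\<lambda>n. code (u n)) \<longlonglongrightarrow> y"
  shows "u \<longlonglongrightarrow> decode y"
proof -
  have y: "y \<in> codes" unfolding codes_def closure_sequential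
    using u by (intro exI[of _ "\<lambda>n. code (u n)"]) auto
  have sub: "(\<lambda>n. code ((u \<circ> r) n)) \<longlonglongrightarrow> y" if "strict_mono r" for r
    using LIMSEQ_subseq_LIMSEQ[OF u that] by (simp add: o_def)
  obtain r l where "strict_mono r" "(u \<circ> r) \<longlonglongrightarrow> l"
    by (rule convergent_subsequence)
  then have ex: "\<exists>x u. (\<lambda>n. code (u n)) \<longlonglongrightarrow> y \<and> u \<longlonglongrightarrow> x"
    using sub by (intro exI[of _ l] exI[of _ "u \<circ> r"]) auto
  then obtain v where v: "(\<lambda>n. code (v n)) \<longlonglongrightarrow> y" "v \<longlonglongrightarrow> decode y"
    using someI_ex[OF ex] y by (auto simp: decode_def)
  show ?thesis
    using sub v by (intro tendsto_if_subsequences) (rule code_limits_unique)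
qed

lemma decode_code [simp]: "decode (code x) = x"
  using decode_limit[of "\<lambda>_. x" "code x"] LIMSEQ_unique[of "\<lambda>_. x" x "decode (code x)"] by simp

lemma closed_codes: "closed codes" and code_in_codes: "code x \<in> codes"
  unfolding codes_def using closure_subset[of "range code"] by auto

lemma continuous_on_decode: "continuous_on codes decode"
proof (rule continuous_on_sequentiallyI)
  fix y :: "nat \<Rightarrow> real" and a
  assume y: "\<forall>n. y n \<in> codes" "a \<in> codes" "y \<longlonglongrightarrow> a"
  have "\<exists>x. \<bar>code x - y n\<bar> < 1 / real (Suc n) \<and> d x (decode (y n)) < 1 / real (Suc n)" for n
  proof -
    have "\<exists>w. (\<forall>k. w k \<in> range code) \<and> w \<longlonglongrightarrow> y n"
      using spec[OF y(1), of n] by (simp add: codes_def closure_sequential)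
    then obtain w where w: "\<forall>k. w k \<in> range code" "w \<longlonglongrightarrow> y n"
      by (elim exE conjE)
    from w(1) have "\<forall>k. \<exists>x. w k = code x" by auto
    from choice[OF this] obtain u' where "\<forall>k. w k = code (u' k)" ..
    then have "w = (\<lambda>k. code (u' k))" by (simp add: fun_eq_iff)
    with w(2) have u: "(\<lambda>k. code (u' k)) \<longlonglongrightarrow> y n" by simp
    then have "(\<lambda>k. d (u' k) (decode (y n))) \<longlonglongrightarrow> 0"
      using decode_limit[OF u] by (simp add: tendsto_iff_d[symmetric])
    then have "eventually (\<lambda>k. d (u' k) (decode (y n)) < 1 / real (Suc n)) sequentially"
      by (intro order_tendstoD) auto
    moreover have "eventually (\<lambda>k. \<bar>code (u' k) - y n\<bar> < 1 / real (Suc n)) sequentially"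
      using tendstoD[OF u, of "1 / real (Suc n)"] by (simp add: dist_real_def)
    ultimately have "eventually (\<lambda>k. d (u' k) (decode (y n)) < 1 / real (Suc n) \<and>
        \<bar>code (u' k) - y n\<bar> < 1 / real (Suc n)) sequentially"
      by eventually_elim simp
    then show ?thesis by (auto dest: eventually_happens)
  qed
  then obtain u where u: "\<And>n. \<bar>code (u n) - y n\<bar> < 1 / real (Suc n)"
      "\<And>n. d (u n) (decode (y n)) < 1 / real (Suc n)"
    by metis
  have lim0: "(\<lambda>n. 1 / real (Suc n)) \<longlonglongrightarrow> 0"
    using LIMSEQ_Suc[OF lim_1_over_n] by (simp add: add.commute)
  have "(\<lambda>n. code (u n) - y n) \<longlonglongrightarrow> 0"
    by (rule Lim_null_comparison[OF _ lim0]) (use u(1) in \<open>auto intro!: always_eventually less_imp_le\<close>)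
  from tendsto_add[OF this y(3)] have "(\<lambda>n. code (u n)) \<longlonglongrightarrow> a" by simp
  then have "u \<longlonglongrightarrow> decode a" by (rule decode_limit)
  then have "(\<lambda>n. d (u n) (decode a) + 1 / real (Suc n)) \<longlonglongrightarrow> d (decode a) (decode a) + 0"
    by (intro tendsto_intros lim0)
  then have lim1: "(\<lambda>n. d (u n) (decode a) + 1 / real (Suc n)) \<longlonglongrightarrow> 0" by simp
  have "(\<lambda>n. d (decode (y n)) (decode a)) \<longlonglongrightarrow> 0"
  proof (rule Lim_null_comparison[OF _ lim1], intro always_eventually allI)
    fix n
    show "norm (d (decode (y n)) (decode a)) \<le> d (u n) (decode a) + 1 / real (Suc n)"
      using d_triangle[of "decode (y n)" "decode a" "u n"] u(2)[of n] d_nonneg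
        d_commute[of "u n" "decode (y n)"] by simp
  qed
  then show "(\<lambda>n. decode (y n)) \<longlonglongrightarrow> decode a" by (simp add: tendsto_iff_d)
qed

lemma measurable_decode [measurable]: "decode \<in> borel_measurable borel"
proof (rule borel_measurableI)
  fix U :: "'b set" assume U: "open U"
  from continuous_on_decode[unfolded continuous_on_open_invariant, rule_format, OF U]
  obtain A where A: "open A" "A \<inter> codes = decode -` U \<inter> codes"
    by (elim exE conjE)
  have "decode -` U = (A \<inter> codes) \<union> (if undefined \<in> U then - codes else {})"
  proof (intro Set.set_eqI)
    fix y
    show "y \<in> decode -` U \<longleftrightarrow> y \<in> (A \<inter> codes) \<union> (if undefined \<in> U then - codes else {})"
    proof (cases "y \<in> codes")
      case True
      then show ?thesis using arg_cong[OF A(2), of "\<lambda>S. y \<in> S"] by simp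
    next
      case False
      then have "decode y = undefined" by (simp add: decode_def)
      then show ?thesis using False by simp
    qed
  qed
  moreover have "A \<in> sets borel" "codes \<in> sets borel" using A(1) closed_codes by auto
  ultimately show "decode -` U \<inter> space borel \<in> sets borel" by auto
qed

text \<open>Helly's theorem for the images on the line: the codes are bounded, so the images are tight, and
  a weak limit still lives on the closed set of codes, where decoding is continuous.\<close>

lemma weakly_convergent_subsequence:
  fixes m :: "nat \<Rightarrow> 'b measure"
  assumes m: "\<And>n. prob_space (m n)" "\<And>n. sets (m n) = sets borel"
  obtains r L where "strict_mono (r :: nat \<Rightarrow> nat)" "prob_space L" "sets L = sets borel"
    "\<And>f :: 'b \<Rightarrow> real. continuous_on UNIV f \<Longrightarrow>
       (\<lambda>n. integral\<^sup>L (m (r n)) f) \<longlonglongrightarrow> integral\<^sup>L L f"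
proof -
  note [measurable_cong] = m(2)
  define k where "k n = distr (m n) borel code" for n
  have real_k: "real_distribution (k n)" for n
    unfolding k_def
    by (intro real_distribution.intro prob_space.prob_space_distr m real_distribution_axioms.intro)
       (auto simp: measurable_cong_sets[OF m(2) refl])
  have code_bounds: "-1 < code x" "code x \<le> 3" for x
    using ternary_bounds[of "\<lambda>n. x \<in> basis n"] by (auto simp: code_def)
  have "tight k" unfolding tight_def
  proof (intro conjI allI impI real_k)
    fix \<epsilon> :: real assume "0 < \<epsilon>"
    have "measure (k n) {-1<..3} = 1" for n
    proof -
      interpret real_distribution "k n" by (rule real_k)
      have "AE x in k n. x \<in> {-1<..3}"
        unfolding k_def using code_bounds
        by (subst AE_distr_iff) auto
      then show ?thesis by (intro prob_eq_1[THEN iffD2]) auto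
    qed
    then show "\<exists>a b. a < b \<and> (\<forall>n. 1 - \<epsilon> < measure (k n) {a<..b})"
      using \<open>0 < \<epsilon>\<close> by (intro exI[of _ "-1"] exI[of _ 3]) auto
  qed
  from tight_imp_convergent_subsubsequence[OF this strict_mono_id]
  obtain r M where r: "strict_mono r" "real_distribution M" "weak_conv_m (k \<circ> r) M"
    by (auto simp: o_def)
  interpret M: real_distribution M by fact
  have lim: "(\<lambda>n. integral\<^sup>L (k (r n)) g) \<longlonglongrightarrow> integral\<^sup>L M g"
    if "continuous_on UNIV g" "\<And>x. norm (g x) \<le> B" for g :: "real \<Rightarrow> real" and B
    using weak_conv_imp_integral_bdd_continuous_conv[of "k \<circ> r" M g B] real_k r that
    by (auto simp: continuous_on_eq_continuous_at o_def)
  have int_k: "integral\<^sup>L (k n) g = integral\<^sup>L (m n) (\<lambda>x. g (code x))"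
    if "g \<in> borel_measurable borel" for n and g :: "real \<Rightarrow> real"
    unfolding k_def using that by (intro integral_distr) auto
  define h where "h y = min 1 (infdist y codes)" for y
  have cont_h: "continuous_on UNIV h" unfolding h_def by (intro continuous_intros)
  have [measurable]: "h \<in> borel_measurable borel" using cont_h by (rule borel_measurable_continuous_onI)
  have h: "0 \<le> h y" "h y \<le> 1" "h (code x) = 0" for x y
    using code_in_codes by (auto simp: h_def infdist_nonneg)
  have "(\<lambda>n. integral\<^sup>L (k (r n)) h) \<longlonglongrightarrow> integral\<^sup>L M h"
    using h by (intro lim[OF cont_h, of 1]) auto
  then have "integral\<^sup>L M h = 0"
    using int_k[of h] h(3) LIMSEQ_unique[OF _ tendsto_const] by simp
  then have "AE y in M. h y = 0"
    using h by (subst (asm) integral_nonneg_eq_0_iff_AE)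
      (auto intro!: M.integrable_const_bound[of _ 1])
  then have AE_codes: "AE y in M. y \<in> codes"
  proof eventually_elim
    case (elim y)
    then have "infdist y codes = 0" by (auto simp: h_def min_def split: if_splits)
    then show ?case using in_closed_iff_infdist_zero[OF closed_codes, of y] code_in_codes by auto
  qed
  show ?thesis
  proof (rule that[OF r(1), of "distr M borel decode"])
    show "prob_space (distr M borel decode)" by (rule M.prob_space_distr) simp
    fix f :: "'b \<Rightarrow> real" assume f: "continuous_on UNIV f"
    have [measurable]: "f \<in> borel_measurable borel" using f by (rule borel_measurable_continuous_onI)
    have "compact (range f)" using compact_continuous_image[OF f compact_UNIV] .
    then obtain B where B: "\<And>x. \<bar>f x\<bar> \<le> B" "0 \<le> B"
      using compact_imp_bounded[of "range f"] unfolding bounded_iff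
      by (metis abs_ge_zero order_trans rangeI real_norm_def)
    have "continuous_on codes (\<lambda>y. f (decode y))"
      using continuous_on_compose2[OF f continuous_on_decode] by auto
    moreover have "closedin (top_of_set UNIV) codes" using closed_codes by simp
    ultimately obtain g where g: "continuous_on UNIV g" "\<And>y. y \<in> codes \<Longrightarrow> g y = f (decode y)"
        "\<And>y. norm (g y) \<le> B"
      using Tietze[of codes "\<lambda>y. f (decode y)" UNIV B] B by auto
    have [measurable]: "g \<in> borel_measurable borel" using g(1) by (rule borel_measurable_continuous_onI)
    have "integral\<^sup>L (distr M borel decode) f = integral\<^sup>L M (\<lambda>y. f (decode y))"
      by (intro integral_distr) auto
    also have "\<dots> = integral\<^sup>L M g"
      using AE_codes by (intro integral_cong_AE) (auto simp: g(2) elim: eventually_mono)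
    finally have "integral\<^sup>L (distr M borel decode) f = integral\<^sup>L M g" .
    moreover have "integral\<^sup>L (k n) g = integral\<^sup>L (m n) f" for n
      using int_k[of g] g(2) code_in_codes by simp
    ultimately show "(\<lambda>n. integral\<^sup>L (m (r n)) f) \<longlonglongrightarrow> integral\<^sup>L (distr M borel decode) f"
      using lim[OF g(1,3)] by simp
  qed simp
qed

end

section \<open>Random walks and bounded harmonic functions\<close>

locale random_walk = group G for G (structure) +
  fixes \<mu> :: "'a measure"
  assumes countable_carrier: "countable (carrier G)"
    and prob_\<mu>: "prob_space \<mu>" and sets_\<mu>: "sets \<mu> = Pow (carrier G)"
begin

sublocale \<mu>: prob_space \<mu> by (rule prob_\<mu>)

sublocale inc: sequence_space \<mu>
  by (intro sequence_space.intro product_prob_spaceI prob_\<mu>)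

abbreviation increments :: "(nat \<Rightarrow> 'a) measure" where
  "increments \<equiv> PiM UNIV (\<lambda>_. \<mu>)"

lemma sets_\<mu>_count [measurable_cong]: "sets \<mu> = sets (count_space (carrier G))"
  by (simp add: sets_\<mu>)

lemma space_\<mu>: "space \<mu> = carrier G"
  using sets_eq_imp_space_eq[OF sets_\<mu>_count] by simp

lemma borel_measurable_\<mu> [simp, measurable]: "f \<in> borel_measurable \<mu>"
  by (simp add: measurable_def sets_\<mu> space_\<mu>)

lemma space_increments: "h \<in> space increments \<longleftrightarrow> (\<forall>n. h n \<in> carrier G)"
  by (simp add: space_PiM space_\<mu> PiE_iff)

lemma case_nat_increments:
  "s \<in> carrier G \<Longrightarrow> h \<in> space increments \<Longrightarrow> case_nat s h \<in> space increments"
  by (auto simp: space_increments split: nat.split)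

lemma walk_closed:
  "y \<in> carrier G \<Longrightarrow> h \<in> space increments \<Longrightarrow> walk G y h n \<in> carrier G"
  by (induction n) (auto simp: space_increments)

lemma walk_left:
  "g \<in> carrier G \<Longrightarrow> y \<in> carrier G \<Longrightarrow> h \<in> space increments \<Longrightarrow>
    walk G (g \<otimes> y) h n = g \<otimes> walk G y h n"
proof (induction n)
  case (Suc n)
  then show ?case using walk_closed[of y h n] by (simp add: space_increments m_assoc)
qed simp

lemma walk_Suc_first: "walk G y (case_nat s h) (Suc n) = walk G (y \<otimes> s) h n"
  by (induction n) auto

lemma measurable_walk [measurable]:
  assumes "y \<in> carrier G"
  shows "(\<lambda>h. walk G y h n) \<in> measurable increments (count_space (carrier G))"
proof (induction n)
  case 0
  then show ?case using assms by simp
next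
  case (Suc n)
  have *: "(\<lambda>h. g \<otimes> h n) \<in> measurable increments (count_space (carrier G))" if "g \<in> carrier G" for g
  proof (rule measurable_compose[of "\<lambda>h. h n" _ \<mu>])
    show "(\<otimes>) g \<in> measurable \<mu> (count_space (carrier G))"
      using that by (auto simp: measurable_def space_\<mu> sets_\<mu>)
  qed simp
  have "(\<lambda>h. (\<lambda>g h. g \<otimes> h n) (walk G y h n) h) \<in> measurable increments (count_space (carrier G))"
    by (rule measurable_compose_countable'[OF * Suc countable_carrier])
  then show ?case by simp
qed

declare walk.simps(2) [simp del]

lemma measurable_walk_path [measurable]:
  "y \<in> carrier G \<Longrightarrow> walk G y \<in> measurable increments (path_space G)"
  unfolding path_space_def
  by (rule measurable_PiM_single'[of UNIV "\<lambda>n h. walk G y h n", simplified])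
    (auto simp: walk_closed measurable_walk)

lemma borel_measurable_walk [measurable]:
  fixes f :: "'a \<Rightarrow> 'c::topological_space"
  assumes "y \<in> carrier G"
  shows "(\<lambda>h. f (walk G y h n)) \<in> borel_measurable increments"
  by (rule measurable_compose[OF measurable_walk[OF assms]]) simp

lemma measurable_case_nat_increments [measurable]:
  "s \<in> carrier G \<Longrightarrow> case_nat s \<in> measurable increments increments"
  by (rule measurable_PiM_single') (auto simp: space_\<mu> space_increments split: nat.split
    intro!: measurable_component_singleton)

lemma nn_integral_first_step:
  assumes F [measurable]: "F \<in> borel_measurable increments"
  shows "(\<integral>\<^sup>+h. F h \<partial>increments) = (\<integral>\<^sup>+s. \<integral>\<^sup>+h. F (case_nat s h) \<partial>increments \<partial>\<mu>)"
proof -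
  have "(\<integral>\<^sup>+h. F h \<partial>increments) =
      (\<integral>\<^sup>+h. F h \<partial>distr (\<mu> \<Otimes>\<^sub>M increments) increments (\<lambda>(s, h). case_nat s h))"
    by (simp add: inc.PiM_iter)
  also have "\<dots> = (\<integral>\<^sup>+p. F (case_nat (fst p) (snd p)) \<partial>(\<mu> \<Otimes>\<^sub>M increments))"
    by (subst nn_integral_distr) (auto simp: case_prod_beta)
  also have "\<dots> = (\<integral>\<^sup>+s. \<integral>\<^sup>+h. F (case_nat s h) \<partial>increments \<partial>\<mu>)"
    by (subst inc.P.nn_integral_fst[symmetric]) (auto simp: case_prod_beta)
  finally show ?thesis .
qed

lemma integral_first_step:
  fixes F :: "(nat \<Rightarrow> 'a) \<Rightarrow> real"
  assumes F [measurable]: "F \<in> borel_measurable increments" and B: "\<And>h. \<bar>F h\<bar> \<le> B"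
  shows "(\<integral>h. F h \<partial>increments) = (\<integral>s. \<integral>h. F (case_nat s h) \<partial>increments \<partial>\<mu>)"
proof -
  interpret pair_prob_space \<mu> increments ..
  have "(\<integral>h. F h \<partial>increments) =
      (\<integral>h. F h \<partial>distr (\<mu> \<Otimes>\<^sub>M increments) increments (\<lambda>(s, h). case_nat s h))"
    by (simp add: inc.PiM_iter)
  also have "\<dots> = (\<integral>p. F (case_nat (fst p) (snd p)) \<partial>(\<mu> \<Otimes>\<^sub>M increments))"
    by (subst integral_distr) (auto simp: case_prod_beta)
  also have "\<dots> = (\<integral>s. \<integral>h. F (case_nat s h) \<partial>increments \<partial>\<mu>)"
    using B by (subst integral_fst'[symmetric]) (auto intro!: integrable_const_bound[of _ B])
  finally show ?thesis .
qed

lemma prob_first_step: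
  assumes "{h \<in> space increments. Q h} \<in> sets increments"
  shows "measure increments {h \<in> space increments. Q h} =
    (\<integral>s. measure increments {h \<in> space increments. Q (case_nat s h)} \<partial>\<mu>)"
proof -
  let ?A = "{h \<in> space increments. Q h}"
  have "measure increments ?A = (\<integral>h. indicator ?A h \<partial>increments)"
    using assms by simp
  also have "\<dots> = (\<integral>s. \<integral>h. indicator ?A (case_nat s h) \<partial>increments \<partial>\<mu>)"
    using assms by (intro integral_first_step[of _ 1]) (auto simp: indicator_def)
  also have "\<dots> = (\<integral>s. measure increments {h \<in> space increments. Q (case_nat s h)} \<partial>\<mu>)"
  proof (intro Bochner_Integration.integral_cong refl)
    fix s assume "s \<in> space \<mu>"
    then have s: "s \<in> carrier G" by (simp add: space_\<mu>)
    have "(\<integral>h. indicator ?A (case_nat s h) \<partial>increments) =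
        (\<integral>h. indicator {h \<in> space increments. Q (case_nat s h)} h \<partial>increments)"
      using case_nat_increments[OF s]
      by (intro Bochner_Integration.integral_cong refl) (auto simp: indicator_def)
    also have "\<dots> = measure increments {h \<in> space increments. Q (case_nat s h)}"
      by (simp add: Int_def conj_commute cong: conj_cong)
    finally show "(\<integral>h. indicator ?A (case_nat s h) \<partial>increments) = \<dots>" .
  qed
  finally show ?thesis .
qed

lemma AE_increments_carrier: "AE h in increments. \<forall>n. h n \<in> carrier G"
  using AE_space by eventually_elim (simp add: space_increments)

definition step :: "('a \<Rightarrow> real) \<Rightarrow> 'a \<Rightarrow> real" where
  "step f y = (\<integral>s. f (y \<otimes> s) \<partial>\<mu>)"

definition expect :: "('a \<Rightarrow> real) \<Rightarrow> nat \<Rightarrow> 'a \<Rightarrow> real" where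
  "expect f n y = (\<integral>h. f (walk G y h n) \<partial>increments)"

definition bounded_by :: "real \<Rightarrow> ('a \<Rightarrow> real) \<Rightarrow> bool" where
  "bounded_by B f \<longleftrightarrow> (\<forall>y\<in>carrier G. \<bar>f y\<bar> \<le> B)"

lemma integrable_\<mu>:
  assumes "bounded_by B f"
  shows "integrable \<mu> f"
  using assms by (intro \<mu>.integrable_const_bound[of _ B]) (auto simp: bounded_by_def space_\<mu> intro!: AE_I2)

lemma bounded_by_translate: "bounded_by B f \<Longrightarrow> y \<in> carrier G \<Longrightarrow> bounded_by B (\<lambda>s. f (y \<otimes> s))"
  by (auto simp: bounded_by_def)

lemma integrable_walk:
  assumes "bounded_by B f" "y \<in> carrier G"
  shows "integrable increments (\<lambda>h. f (walk G y h n))"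
  using assms walk_closed by (intro inc.P.integrable_const_bound[of _ B] AE_I2) (auto simp: bounded_by_def)

lemma expect_0 [simp]: "expect f 0 y = f y"
  by (simp add: expect_def inc.P.prob_space)

lemma expect_Suc_first:
  assumes f: "bounded_by B f" and y: "y \<in> carrier G"
  shows "expect f (Suc n) y = (\<integral>s. expect f n (y \<otimes> s) \<partial>\<mu>)"
proof -
  define F where "F h = (if h \<in> space increments then f (walk G y h (Suc n)) else 0)" for h
  have "0 \<le> B" using f y by (force simp: bounded_by_def)
  have [measurable]: "F \<in> borel_measurable increments"
    unfolding F_def using y by (intro measurable_If_set) auto
  have "expect f (Suc n) y = (\<integral>h. F h \<partial>increments)"
    unfolding expect_def F_def by (intro Bochner_Integration.integral_cong) auto
  also have "\<dots> = (\<integral>s. \<integral>h. F (case_nat s h) \<partial>increments \<partial>\<mu>)"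
    using f y walk_closed \<open>0 \<le> B\<close>
    by (intro integral_first_step[of _ B]) (auto simp: F_def bounded_by_def)
  also have "\<dots> = (\<integral>s. expect f n (y \<otimes> s) \<partial>\<mu>)"
    unfolding expect_def F_def
    by (intro Bochner_Integration.integral_cong refl)
      (auto simp: walk_Suc_first case_nat_increments space_\<mu>
        intro!: Bochner_Integration.integral_cong)
  finally show ?thesis .
qed

lemma expect_bounded:
  assumes f: "bounded_by B f"
  shows "bounded_by B (expect f n)"
proof -
  have "\<bar>expect f n y\<bar> \<le> B" if y: "y \<in> carrier G" for y
  proof -
    have "\<bar>expect f n y\<bar> \<le> (\<integral>h. \<bar>f (walk G y h n)\<bar> \<partial>increments)"
      unfolding expect_def by (rule integral_abs_bound)
    also have "\<dots> \<le> (\<integral>h. B \<partial>increments)"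
      using f y walk_closed integrable_walk[OF f y]
      by (intro integral_mono) (auto simp: bounded_by_def)
    finally show ?thesis by (simp add: inc.P.prob_space)
  qed
  then show ?thesis by (simp add: bounded_by_def)
qed

lemma step_bounded:
  assumes f: "bounded_by B f"
  shows "bounded_by B (step f)"
proof -
  have "\<bar>step f y\<bar> \<le> B" if y: "y \<in> carrier G" for y
  proof -
    have "\<bar>step f y\<bar> \<le> (\<integral>s. \<bar>f (y \<otimes> s)\<bar> \<partial>\<mu>)"
      unfolding step_def by (rule integral_abs_bound)
    also have "\<dots> \<le> (\<integral>h. B \<partial>\<mu>)"
      using f y integrable_\<mu>[OF bounded_by_translate[OF f y]]
      by (intro integral_mono) (auto simp: bounded_by_def space_\<mu>)
    finally show ?thesis by (simp add: \<mu>.prob_space)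
  qed
  then show ?thesis by (simp add: bounded_by_def)
qed

lemma expect_Suc_last:
  assumes f: "bounded_by B f"
  shows "y \<in> carrier G \<Longrightarrow> expect f (Suc n) y = expect (step f) n y"
proof (induction n arbitrary: y)
  case 0
  then show ?case by (simp add: expect_Suc_first[OF f] step_def)
next
  case (Suc n)
  have "expect f (Suc (Suc n)) y = (\<integral>s. expect f (Suc n) (y \<otimes> s) \<partial>\<mu>)"
    using Suc.prems by (rule expect_Suc_first[OF f])
  also have "\<dots> = (\<integral>s. expect (step f) n (y \<otimes> s) \<partial>\<mu>)"
    using Suc by (intro Bochner_Integration.integral_cong refl) (auto simp: space_\<mu>)
  also have "\<dots> = expect (step f) (Suc n) y"
    using Suc.prems by (rule expect_Suc_first[OF step_bounded[OF f], symmetric])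
  finally show ?case .
qed

text \<open>Induction on the time horizon: either the bound is exceeded at the starting point, or the first
  step reduces the statement to a shorter horizon.\<close>

lemma maximal_inequality:
  assumes u: "bounded_by B u" "\<And>y. y \<in> carrier G \<Longrightarrow> 0 \<le> u y"
    and sub: "\<And>y. y \<in> carrier G \<Longrightarrow> u y \<le> step u y"
    and a: "0 < a"
  shows "y \<in> carrier G \<Longrightarrow>
    a * measure increments {h \<in> space increments. \<exists>n\<le>m. a < u (walk G y h n)} \<le> expect u m y"
proof (induction m arbitrary: y)
  case 0
  show ?case
  proof (cases "a < u y")
    case True
    then show ?thesis by (simp add: inc.P.prob_space)
  qed (use u 0 in simp)
next
  case (Suc m)
  have mono: "u y \<le> expect u n y" if "y \<in> carrier G" for n y
    using that
  proof (induction n arbitrary: y)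
    case (Suc n)
    have "u y \<le> step u y" using sub Suc by simp
    also have "\<dots> \<le> (\<integral>s. expect u n (y \<otimes> s) \<partial>\<mu>)"
      unfolding step_def using Suc u
      by (intro integral_mono integrable_\<mu>[OF bounded_by_translate] expect_bounded)
        (auto simp: space_\<mu>)
    finally show ?case using expect_Suc_first[OF u(1)] Suc by simp
  qed simp
  show ?case
  proof (cases "a < u y")
    case True
    have "a * measure increments {h \<in> space increments. \<exists>n\<le>Suc m. a < u (walk G y h n)} \<le> a * 1"
      using a by (intro mult_left_mono inc.P.prob_le_1) auto
    then show ?thesis using True mono[OF Suc.prems, of "Suc m"] by linarith
  next
    case False
    have *: "(\<exists>n\<le>Suc m. a < u (walk G y (case_nat s h) n)) \<longleftrightarrow>
        (\<exists>n\<le>m. a < u (walk G (y \<otimes> s) h n))" for s h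
    proof -
      have "(\<exists>n\<le>Suc m. a < u (walk G y (case_nat s h) n)) \<longleftrightarrow>
          (\<exists>n\<le>m. a < u (walk G y (case_nat s h) (Suc n)))"
        using False by (metis Suc_le_mono not0_implies_Suc walk.simps(1))
      then show ?thesis by (simp only: walk_Suc_first)
    qed
    have "{h \<in> space increments. \<exists>n\<le>Suc m. a < u (walk G y h n)} \<in> sets increments"
      using Suc.prems by measurable
    from prob_first_step[OF this]
    have "a * measure increments {h \<in> space increments. \<exists>n\<le>Suc m. a < u (walk G y h n)} =
        (\<integral>s. a * measure increments {h \<in> space increments. \<exists>n\<le>m. a < u (walk G (y \<otimes> s) h n)} \<partial>\<mu>)"
      by (simp only: * integral_mult_right_zero)
    also have "\<dots> \<le> (\<integral>s. expect u m (y \<otimes> s) \<partial>\<mu>)"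
    proof (intro integral_mono)
      show "integrable \<mu> (\<lambda>s. a * measure increments {h \<in> space increments. \<exists>n\<le>m. a < u (walk G (y \<otimes> s) h n)})"
        using a by (intro integrable_\<mu>[of a]) (auto simp: bounded_by_def abs_mult intro!: mult_left_le)
      show "integrable \<mu> (\<lambda>s. expect u m (y \<otimes> s))"
        using u Suc.prems by (intro integrable_\<mu>[OF bounded_by_translate] expect_bounded) auto
    qed (use Suc in \<open>auto simp: space_\<mu>\<close>)
    also have "\<dots> = expect u (Suc m) y" using Suc.prems by (simp add: expect_Suc_first[OF u(1)])
    finally show ?thesis .
  qed
qed

definition harmonic :: "('a \<Rightarrow> real) \<Rightarrow> bool" where
  "harmonic f \<longleftrightarrow> (\<forall>y\<in>carrier G. step f y = f y)"

text \<open>The conditional variance of the next value of a harmonic function, that is, the rate at which its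
  mean square grows.\<close>

definition energy :: "('a \<Rightarrow> real) \<Rightarrow> 'a \<Rightarrow> real" where
  "energy f y = (\<integral>s. (f (y \<otimes> s) - f y)\<^sup>2 \<partial>\<mu>)"

lemma bounded_by_square: "bounded_by B f \<Longrightarrow> bounded_by (B\<^sup>2) (\<lambda>y. (f y)\<^sup>2)"
  unfolding bounded_by_def by (metis abs_ge_zero power2_abs power_mono abs_power2)

lemma bounded_by_diff:
  assumes "bounded_by B f" "y \<in> carrier G"
  shows "bounded_by (2 * B) (\<lambda>x. f x - f y)"
  unfolding bounded_by_def
proof
  fix x assume "x \<in> carrier G"
  then have "\<bar>f x\<bar> \<le> B" "\<bar>f y\<bar> \<le> B" using assms by (auto simp: bounded_by_def)
  then show "\<bar>f x - f y\<bar> \<le> 2 * B" by linarith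
qed

lemma expect_harmonic:
  assumes f: "bounded_by B f" "harmonic f"
  shows "y \<in> carrier G \<Longrightarrow> expect f n y = f y"
proof (induction n arbitrary: y)
  case (Suc n)
  have "expect f (Suc n) y = (\<integral>s. f (y \<otimes> s) \<partial>\<mu>)"
    unfolding expect_Suc_first[OF f(1) Suc.prems]
    using Suc by (intro Bochner_Integration.integral_cong refl) (auto simp: space_\<mu>)
  then show ?case using f(2) Suc.prems by (simp add: harmonic_def step_def)
qed simp

lemma step_square:
  assumes f: "bounded_by B f" "harmonic f" and y: "y \<in> carrier G"
  shows "step (\<lambda>x. (f x - c)\<^sup>2) y = energy f y + (f y - c)\<^sup>2"
proof -
  note fy = bounded_by_translate[OF f(1) y]
  note int = integrable_\<mu>[OF fy] integrable_\<mu>[OF bounded_by_square[OF fy]]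
  have 1: "(\<integral>s. f (y \<otimes> s) \<partial>\<mu>) = f y" using f y by (simp add: harmonic_def step_def)
  have 2: "(\<integral>s. (f (y \<otimes> s) - b)\<^sup>2 \<partial>\<mu>) = (\<integral>s. (f (y \<otimes> s))\<^sup>2 \<partial>\<mu>) - 2 * b * f y + b\<^sup>2" for b
  proof -
    have "(\<integral>s. (f (y \<otimes> s) - b)\<^sup>2 \<partial>\<mu>) = (\<integral>s. (f (y \<otimes> s))\<^sup>2 - 2 * b * f (y \<otimes> s) + b\<^sup>2 \<partial>\<mu>)"
      by (intro Bochner_Integration.integral_cong) (auto simp: power2_eq_square algebra_simps)
    also have "\<dots> = (\<integral>s. (f (y \<otimes> s))\<^sup>2 \<partial>\<mu>) - 2 * b * f y + b\<^sup>2"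
      using int 1 by (simp add: \<mu>.prob_space)
    finally show ?thesis .
  qed
  show ?thesis unfolding step_def energy_def 2 by (simp add: power2_eq_square algebra_simps)
qed

lemma energy_nonneg: "0 \<le> energy f y"
  unfolding energy_def by simp

lemma energy_bounded:
  assumes f: "bounded_by B f"
  shows "bounded_by ((2 * B)\<^sup>2) (energy f)"
proof -
  have "\<bar>energy f y\<bar> \<le> (2 * B)\<^sup>2" if y: "y \<in> carrier G" for y
  proof -
    have "bounded_by (2 * B) (\<lambda>s. f (y \<otimes> s) - f y)"
      using bounded_by_translate[OF bounded_by_diff[OF f y] y] .
    then have b: "bounded_by ((2 * B)\<^sup>2) (\<lambda>s. (f (y \<otimes> s) - f y)\<^sup>2)" by (rule bounded_by_square)
    have "energy f y \<le> (\<integral>s. (2 * B)\<^sup>2 \<partial>\<mu>)"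
      unfolding energy_def using b
      by (intro integral_mono integrable_\<mu>[OF b]) (auto simp: bounded_by_def space_\<mu>)
    then show ?thesis using energy_nonneg[of f y] by (simp add: \<mu>.prob_space)
  qed
  then show ?thesis by (simp add: bounded_by_def)
qed

lemma expect_square_Suc:
  assumes f: "bounded_by B f" "harmonic f" and y: "y \<in> carrier G"
  shows "expect (\<lambda>x. (f x)\<^sup>2) (Suc n) y = expect (\<lambda>x. (f x)\<^sup>2) n y + expect (energy f) n y"
proof -
  have "expect (\<lambda>x. (f x)\<^sup>2) (Suc n) y = expect (step (\<lambda>x. (f x)\<^sup>2)) n y"
    using expect_Suc_last[OF bounded_by_square[OF f(1)] y] .
  also have "\<dots> = (\<integral>h. (f (walk G y h n))\<^sup>2 + energy f (walk G y h n) \<partial>increments)"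
    unfolding expect_def using step_square[OF f, of _ 0] walk_closed[OF y]
    by (intro Bochner_Integration.integral_cong refl) auto
  also have "\<dots> = expect (\<lambda>x. (f x)\<^sup>2) n y + expect (energy f) n y"
    unfolding expect_def
    using integrable_walk[OF bounded_by_square[OF f(1)] y] integrable_walk[OF energy_bounded[OF f(1)] y]
    by (rule Bochner_Integration.integral_add)
  finally show ?thesis .
qed

text \<open>Kolmogorov's inequality: the squared deviation of a harmonic function from its initial value is
  subharmonic, and its mean is the growth of the mean square.\<close>

lemma fluctuation_from_start:
  assumes f: "bounded_by B f" "harmonic f" and y: "y \<in> carrier G" and \<epsilon>: "0 < \<epsilon>"
  shows "measure increments {h \<in> space increments. \<exists>n\<le>m. \<epsilon> < \<bar>f (walk G y h n) - f y\<bar>}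
    \<le> (expect (\<lambda>x. (f x)\<^sup>2) m y - (f y)\<^sup>2) / \<epsilon>\<^sup>2"
proof -
  define u where "u x = (f x - f y)\<^sup>2" for x
  have u: "bounded_by ((2 * B)\<^sup>2) u"
    unfolding u_def by (intro bounded_by_square bounded_by_diff f y)
  have "u x \<le> step u x" if "x \<in> carrier G" for x
    using step_square[OF f that, of "f y"] energy_nonneg[of f x] by (simp add: u_def[abs_def])
  then have max: "\<epsilon>\<^sup>2 * measure increments {h \<in> space increments. \<exists>n\<le>m. \<epsilon>\<^sup>2 < u (walk G y h n)} \<le> expect u m y"
    using \<epsilon> y by (intro maximal_inequality[OF u]) (auto simp: u_def)
  have iff: "\<epsilon>\<^sup>2 < u x \<longleftrightarrow> \<epsilon> < \<bar>f x - f y\<bar>" for x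
    using \<epsilon> abs_le_square_iff[of "f x - f y" \<epsilon>] by (auto simp: u_def not_le[symmetric])
  have "expect u m y = expect (\<lambda>x. (f x)\<^sup>2) m y - (f y)\<^sup>2"
  proof -
    note int = integrable_walk[OF bounded_by_square[OF f(1)] y, of m] integrable_walk[OF f(1) y, of m]
    have "expect u m y = (\<integral>h. (f (walk G y h m))\<^sup>2 - 2 * f y * f (walk G y h m) + (f y)\<^sup>2 \<partial>increments)"
      unfolding expect_def u_def
      by (intro Bochner_Integration.integral_cong) (auto simp: power2_eq_square algebra_simps)
    also have "\<dots> = expect (\<lambda>x. (f x)\<^sup>2) m y - 2 * f y * expect f m y + (f y)\<^sup>2"
      unfolding expect_def using int by (simp add: inc.P.prob_space)
    finally show ?thesis using expect_harmonic[OF f y] by (simp add: power2_eq_square)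
  qed
  with max show ?thesis unfolding iff using \<epsilon> by (simp add: field_simps)
qed

lemma fluctuation:
  assumes f: "bounded_by B f" "harmonic f" and \<epsilon>: "0 < \<epsilon>"
  shows "y \<in> carrier G \<Longrightarrow>
    measure increments {h \<in> space increments. \<exists>n\<le>m. \<epsilon> < \<bar>f (walk G y h (N + n)) - f (walk G y h N)\<bar>}
    \<le> (expect (\<lambda>x. (f x)\<^sup>2) (N + m) y - expect (\<lambda>x. (f x)\<^sup>2) N y) / \<epsilon>\<^sup>2"
proof (induction N arbitrary: y)
  case 0
  then show ?case using fluctuation_from_start[OF f _ \<epsilon>] by simp
next
  case (Suc N)
  let ?E = "expect (\<lambda>x. (f x)\<^sup>2)"
  note b = bounded_by_square[OF f(1)]
  have int: "integrable \<mu> (\<lambda>s. ?E k (y \<otimes> s))" for k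
    by (rule integrable_\<mu>[OF bounded_by_translate[OF expect_bounded[OF b] Suc.prems]])
  have "{h \<in> space increments. \<exists>n\<le>m. \<epsilon> < \<bar>f (walk G y h (Suc N + n)) - f (walk G y h (Suc N))\<bar>}
      \<in> sets increments"
    using Suc.prems by measurable
  from prob_first_step[OF this]
  have "measure increments {h \<in> space increments. \<exists>n\<le>m. \<epsilon> < \<bar>f (walk G y h (Suc N + n)) - f (walk G y h (Suc N))\<bar>} =
      (\<integral>s. measure increments {h \<in> space increments. \<exists>n\<le>m. \<epsilon> < \<bar>f (walk G (y \<otimes> s) h (N + n)) - f (walk G (y \<otimes> s) h N)\<bar>} \<partial>\<mu>)"
    by (simp only: walk_Suc_first add_Suc)
  also have "\<dots> \<le> (\<integral>s. (?E (N + m) (y \<otimes> s) - ?E N (y \<otimes> s)) / \<epsilon>\<^sup>2 \<partial>\<mu>)"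
  proof (intro integral_mono)
    show "integrable \<mu> (\<lambda>s. measure increments {h \<in> space increments. \<exists>n\<le>m. \<epsilon> < \<bar>f (walk G (y \<otimes> s) h (N + n)) - f (walk G (y \<otimes> s) h N)\<bar>})"
      by (intro integrable_\<mu>[of 1]) (auto simp: bounded_by_def)
    show "integrable \<mu> (\<lambda>s. (?E (N + m) (y \<otimes> s) - ?E N (y \<otimes> s)) / \<epsilon>\<^sup>2)"
      using int by simp
  qed (use Suc in \<open>auto simp: space_\<mu>\<close>)
  also have "\<dots> = (?E (Suc N + m) y - ?E (Suc N) y) / \<epsilon>\<^sup>2"
    using int Suc.prems by (simp add: expect_Suc_first[OF b])
  finally show ?case .
qed

text \<open>The mean squares increase to a finite limit, and by the previous inequality the distance to that limit bounds the
  probability of a later oscillation.\<close>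

theorem harmonic_convergent:
  assumes f: "bounded_by B f" "harmonic f" and y: "y \<in> carrier G"
  shows "AE h in increments. convergent (\<lambda>n. f (walk G y h n))"
proof -
  let ?E = "\<lambda>n. expect (\<lambda>x. (f x)\<^sup>2) n y"
  have inc_E: "?E n \<le> ?E (Suc n)" for n
    using expect_square_Suc[OF f y] expect_def[of "energy f"] energy_nonneg by simp
  then have "incseq ?E" by (rule incseq_SucI)
  moreover have "?E n \<le> B\<^sup>2" for n
    using expect_bounded[OF bounded_by_square[OF f(1)], of n] y by (auto simp: bounded_by_def)
  ultimately obtain L where L: "?E \<longlonglongrightarrow> L" "\<forall>n. ?E n \<le> L"
    using incseq_convergent[of ?E "B\<^sup>2"] by auto
  have AE_osc: "AE h in increments. \<exists>N. \<forall>n. \<bar>f (walk G y h (N + n)) - f (walk G y h N)\<bar> \<le> \<epsilon>"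
    if \<epsilon>: "0 < \<epsilon>" for \<epsilon>
  proof -
    define A where "A N m = {h \<in> space increments. \<exists>n\<le>m. \<epsilon> < \<bar>f (walk G y h (N + n)) - f (walk G y h N)\<bar>}" for N m
    define A' where "A' = {h \<in> space increments. \<forall>N. \<exists>n. \<epsilon> < \<bar>f (walk G y h (N + n)) - f (walk G y h N)\<bar>}"
    have [measurable]: "A N m \<in> sets increments" for N m
      unfolding A_def using y by measurable
    have A': "A' \<in> sets increments"
      unfolding A'_def using y by measurable
    have "measure increments A' \<le> (L - ?E N) / \<epsilon>\<^sup>2" for N
    proof -
      have "(\<lambda>m. measure increments (A N m)) \<longlonglongrightarrow> measure increments (\<Union>m. A N m)"
      proof (rule inc.P.finite_Lim_measure_incseq)
        show "range (A N) \<subseteq> sets increments" by auto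
        show "incseq (A N)" by (rule incseq_SucI) (auto simp: A_def le_Suc_eq)
      qed
      moreover have "measure increments (A N m) \<le> (L - ?E N) / \<epsilon>\<^sup>2" for m
      proof -
        have "measure increments (A N m) \<le> (?E (N + m) - ?E N) / \<epsilon>\<^sup>2"
          unfolding A_def by (rule fluctuation[OF f \<epsilon> y])
        also have "\<dots> \<le> (L - ?E N) / \<epsilon>\<^sup>2" using L(2) by (intro divide_right_mono) auto
        finally show ?thesis .
      qed
      ultimately have "measure increments (\<Union>m. A N m) \<le> (L - ?E N) / \<epsilon>\<^sup>2"
        by (intro LIMSEQ_le_const2) auto
      moreover have "measure increments A' \<le> measure increments (\<Union>m. A N m)"
      proof (rule inc.P.finite_measure_mono)
        show "A' \<subseteq> (\<Union>m. A N m)"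
        proof
          fix h assume "h \<in> A'"
          then have h: "h \<in> space increments"
            "\<exists>n. \<epsilon> < \<bar>f (walk G y h (N + n)) - f (walk G y h N)\<bar>"
            by (simp_all add: A'_def)
          from h(2) obtain n where "\<epsilon> < \<bar>f (walk G y h (N + n)) - f (walk G y h N)\<bar>" ..
          with h(1) have "h \<in> A N n" by (auto simp: A_def)
          then show "h \<in> (\<Union>m. A N m)" by blast
        qed
      qed simp
      ultimately show ?thesis by linarith
    qed
    moreover have "(\<lambda>N. (L - ?E N) / \<epsilon>\<^sup>2) \<longlonglongrightarrow> (L - L) / \<epsilon>\<^sup>2"
      using \<epsilon> by (intro tendsto_intros L) auto
    ultimately have "measure increments A' \<le> 0"
      by (intro LIMSEQ_le_const[of "\<lambda>N. (L - ?E N) / \<epsilon>\<^sup>2"]) auto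
    then have "emeasure increments A' = 0"
      by (simp add: inc.P.emeasure_eq_measure measure_le_0_iff)
    then have "AE h in increments. h \<notin> A'"
      using A' by (intro AE_not_in) (auto simp: null_sets_def)
    with AE_space show ?thesis
      by eventually_elim (auto simp: A'_def not_less)
  qed
  have "AE h in increments. \<forall>k. \<exists>N. \<forall>n. \<bar>f (walk G y h (N + n)) - f (walk G y h N)\<bar> \<le> 1 / real (Suc k)"
    unfolding AE_all_countable by (intro allI AE_osc) simp
  then show ?thesis
  proof eventually_elim
    case (elim h)
    have "Cauchy (\<lambda>n. f (walk G y h n))"
    proof (rule metric_CauchyI)
      fix e :: real assume "0 < e"
      then obtain k where k: "1 / real (Suc k) < e / 2"
        using nat_approx_posE[of "e / 2"] by auto
      from spec[OF elim, of k]
      obtain N where N: "\<And>n. \<bar>f (walk G y h (N + n)) - f (walk G y h N)\<bar> \<le> 1 / real (Suc k)"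
        by auto
      have "dist (f (walk G y h m)) (f (walk G y h n)) < e" if "N \<le> m" "N \<le> n" for m n
        using N[of "m - N"] N[of "n - N"] that k by (simp add: dist_real_def)
      then show "\<exists>N. \<forall>m\<ge>N. \<forall>n\<ge>N. dist (f (walk G y h m)) (f (walk G y h n)) < e" by blast
    qed
    then show ?case by (rule real_Cauchy_convergent)
  qed
qed

text \<open>The mean squares along the walk are bounded and grow by the mean energies, so a point where the
  energy does not vanish is visited finitely often on average.\<close>

lemma finitely_many_visits:
  assumes f: "bounded_by B f" "harmonic f" and y: "y \<in> carrier G" and g: "g \<in> carrier G"
    and pos: "energy f g \<noteq> 0"
  shows "AE h in increments. eventually (\<lambda>n. walk G y h n \<noteq> g) sequentially"
proof -
  let ?E = "\<lambda>n. expect (\<lambda>x. (f x)\<^sup>2) n y"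
  let ?p = "\<lambda>n. measure increments {h \<in> space increments. walk G y h n = g}"
  have [measurable]: "{h \<in> space increments. walk G y h n = g} \<in> sets increments" for n
  proof -
    have "(\<lambda>h. walk G y h n) -` {g} \<inter> space increments \<in> sets increments"
      by (rule measurable_sets[OF measurable_walk[OF y]]) (use g in auto)
    then show ?thesis by (simp add: vimage_def Int_def conj_commute)
  qed
  have p: "?p n * energy f g \<le> ?E (Suc n) - ?E n" for n
  proof -
    have "?p n * energy f g = (\<integral>h. energy f g * indicator {h \<in> space increments. walk G y h n = g} h \<partial>increments)"
      by simp
    also have "\<dots> \<le> expect (energy f) n y"
      unfolding expect_def
    proof (rule integral_mono)
      show "integrable increments (\<lambda>h. energy f g * indicator {h \<in> space increments. walk G y h n = g} h)"
        by (intro Bochner_Integration.integrable_mult_right integrable_real_indicator)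
          (auto simp: less_top[symmetric])
    qed (use integrable_walk[OF energy_bounded[OF f(1)] y] energy_nonneg in \<open>auto split: split_indicator\<close>)
    finally show ?thesis using expect_square_Suc[OF f y] by simp
  qed
  have "summable ?p"
  proof (rule bounded_imp_summable)
    fix n
    have "(\<Sum>k\<le>n. ?p k) * energy f g \<le> (\<Sum>k<Suc n. ?E (Suc k) - ?E k)"
      unfolding sum_distrib_right lessThan_Suc_atMost by (intro sum_mono p)
    also have "\<dots> = ?E (Suc n) - ?E 0" by (rule sum_lessThan_telescope)
    also have "\<dots> \<le> B\<^sup>2 - 0"
      using expect_bounded[OF bounded_by_square[OF f(1)], of "Suc n"] y
      by (intro diff_mono) (auto simp: bounded_by_def)
    finally show "(\<Sum>k\<le>n. ?p k) \<le> B\<^sup>2 / energy f g"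
      using pos energy_nonneg[of f g] by (simp add: field_simps)
  qed simp
  from borel_cantelli_AE1[OF _ _ this]
  have "AE h in increments. eventually (\<lambda>n. h \<in> space increments - {h \<in> space increments. walk G y h n = g}) sequentially"
    by (auto simp: less_top[symmetric])
  then show ?thesis
    by eventually_elim (auto elim: eventually_mono)
qed

end

section \<open>Dynamics on a boundary with strips\<close>

context compact_metrizable
begin

text \<open>A diagonal sequence, by compactness.\<close>

lemma common_convergent_subsequence:
  fixes u :: "nat \<Rightarrow> 'c \<Rightarrow> 'b"
  assumes D: "countable D"
  obtains r L where "strict_mono (r :: nat \<Rightarrow> nat)" "\<forall>x\<in>D. (\<lambda>n. u (r n) x) \<longlonglongrightarrow> L x"
proof (cases "D = {}")
  case True
  then show ?thesis using that[OF strict_mono_id] by simp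
next
  case False
  let ?P = "\<lambda>k (s :: nat \<Rightarrow> nat). \<exists>l. (\<lambda>n. u (s n) (from_nat_into D k)) \<longlonglongrightarrow> l"
  interpret subseqs ?P
  proof
    fix n :: nat and s :: "nat \<Rightarrow> nat"
    obtain l r where "strict_mono r" "((\<lambda>i. u (s i) (from_nat_into D n)) \<circ> r) \<longlonglongrightarrow> l"
      by (rule convergent_subsequence)
    then show "\<exists>r'. strict_mono r' \<and> ?P n (s \<circ> r')"
      by (intro exI[of _ r]) (auto simp: o_def)
  qed
  have "?P k diagseq" for k
  proof -
    have "?P k (diagseq \<circ> (+) (Suc k))"
    proof (rule diagseq_holds)
      fix r s :: "nat \<Rightarrow> nat" and n assume r: "strict_mono r" and "?P n s"
      then obtain l where "(\<lambda>i. u (s i) (from_nat_into D n)) \<longlonglongrightarrow> l" by auto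
      from LIMSEQ_subseq_LIMSEQ[OF this r] show "?P n (s \<circ> r)"
        by (intro exI[of _ l]) (simp add: o_def)
    qed
    then obtain l where "(\<lambda>n. u (diagseq (n + Suc k)) (from_nat_into D k)) \<longlonglongrightarrow> l"
      by (auto simp: o_def add.commute)
    then have "(\<lambda>n. u (diagseq n) (from_nat_into D k)) \<longlonglongrightarrow> l"
      by (rule LIMSEQ_offset)
    then show ?thesis by (rule exI)
  qed
  then have lim: "\<exists>l. (\<lambda>n. u (diagseq n) (from_nat_into D k)) \<longlonglongrightarrow> l" for k .
  have "\<forall>x\<in>D. \<exists>l. (\<lambda>n. u (diagseq n) x) \<longlonglongrightarrow> l"
  proof
    fix x assume "x \<in> D"
    then show "\<exists>l. (\<lambda>n. u (diagseq n) x) \<longlonglongrightarrow> l"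
      using lim[of "to_nat_on D x"] D by simp
  qed
  from bchoice[OF this] obtain L where "\<forall>x\<in>D. (\<lambda>n. u (diagseq n) x) \<longlonglongrightarrow> L x" ..
  then show ?thesis using that[OF subseq_diagseq, of L] by simp
qed

end

text \<open>A compactification with a strip map \<open>S\<close> as in (CS), and an auxiliary distance.\<close>

locale boundary_action = group G + compact_metrizable d
  for G :: "('a, 'm) monoid_scheme" (structure)
    and d :: "'b::{second_countable_topology,t2_space} \<Rightarrow> 'b \<Rightarrow> real" +
  fixes \<iota> :: "'a \<Rightarrow> 'b" and \<alpha> :: "'a \<Rightarrow> 'b \<Rightarrow> 'b" and S :: "'b \<Rightarrow> 'b \<Rightarrow> 'a set"
  assumes countable_G: "countable (carrier G)"
    and \<alpha>_mult: "g \<in> carrier G \<Longrightarrow> h \<in> carrier G \<Longrightarrow> \<alpha> (g \<otimes> h) b = \<alpha> g (\<alpha> h b)"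
    and \<alpha>_one [simp]: "\<alpha> \<one> b = b"
    and continuous_\<alpha>: "g \<in> carrier G \<Longrightarrow> continuous_on UNIV (\<alpha> g)"
    and \<alpha>_\<iota>: "g \<in> carrier G \<Longrightarrow> x \<in> carrier G \<Longrightarrow> \<alpha> g (\<iota> x) = \<iota> (g \<otimes> x)"
    and inj_\<iota>: "inj_on \<iota> (carrier G)"
    and open_\<iota>: "g \<in> carrier G \<Longrightarrow> open {\<iota> g}"
    and CP: "range u \<subseteq> carrier G \<Longrightarrow> (\<lambda>n. \<iota> (u n)) \<longlonglongrightarrow> b \<Longrightarrow> b \<in> boundary G \<iota> \<Longrightarrow>
      x \<in> carrier G \<Longrightarrow> (\<lambda>n. \<iota> (u n \<otimes> x)) \<longlonglongrightarrow> b"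
    and S_nonempty: "b1 \<in> boundary G \<iota> \<Longrightarrow> b2 \<in> boundary G \<iota> \<Longrightarrow> b1 \<noteq> b2 \<Longrightarrow> S b1 b2 \<noteq> {}"
    and S_subset: "b1 \<in> boundary G \<iota> \<Longrightarrow> b2 \<in> boundary G \<iota> \<Longrightarrow> b1 \<noteq> b2 \<Longrightarrow> S b1 b2 \<subseteq> carrier G"
    and S_equivariant: "b1 \<in> boundary G \<iota> \<Longrightarrow> b2 \<in> boundary G \<iota> \<Longrightarrow> b1 \<noteq> b2 \<Longrightarrow> g \<in> carrier G \<Longrightarrow>
      S (\<alpha> g b1) (\<alpha> g b2) = (\<lambda>s. g \<otimes> s) ` S b1 b2"
    and S_borel: "s \<in> carrier G \<Longrightarrow>
      {(b1, b2). b1 \<in> boundary G \<iota> \<and> b2 \<in> boundary G \<iota> \<and> b1 \<noteq> b2 \<and> s \<in> S b1 b2} \<in> sets (borel \<Otimes>\<^sub>M borel)"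
    and S_separated: "c0 \<in> boundary G \<iota> \<Longrightarrow> c1 \<in> boundary G \<iota> \<Longrightarrow> c2 \<in> boundary G \<iota> \<Longrightarrow>
      c0 \<noteq> c1 \<Longrightarrow> c0 \<noteq> c2 \<Longrightarrow> c1 \<noteq> c2 \<Longrightarrow>
      \<exists>O0 O1 O2. open O0 \<and> c0 \<in> O0 \<and> open O1 \<and> c1 \<in> O1 \<and> open O2 \<and> c2 \<in> O2 \<and>
        (\<forall>b1\<in>O1 \<inter> boundary G \<iota>. \<forall>b2\<in>O2 \<inter> boundary G \<iota>. b1 \<noteq> b2 \<longrightarrow> \<iota> ` S b1 b2 \<inter> O0 = {})"
begin

abbreviation bdry :: "'b set" where "bdry \<equiv> boundary G \<iota>"

lemma closed_bdry: "closed bdry"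
proof -
  have "open (\<Union>g\<in>carrier G. {\<iota> g})" using open_\<iota> by (intro open_UN) auto
  then show ?thesis unfolding boundary_def closed_def
    by (simp add: UNION_singleton_eq_range Compl_eq_Diff_UNIV[symmetric])
qed

lemma \<alpha>_inv [simp]:
  assumes "g \<in> carrier G"
  shows "\<alpha> (inv g) (\<alpha> g b) = b" "\<alpha> g (\<alpha> (inv g) b) = b"
  using assms by (simp_all add: \<alpha>_mult[symmetric])

lemma \<alpha>_eq_iff [simp]: "g \<in> carrier G \<Longrightarrow> \<alpha> g b = \<alpha> g c \<longleftrightarrow> b = c"
  using \<alpha>_inv(1) by metis

lemma \<alpha>_bdry [simp]:
  assumes "g \<in> carrier G"
  shows "\<alpha> g b \<in> bdry \<longleftrightarrow> b \<in> bdry"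
proof -
  have *: "\<alpha> h b \<in> \<iota> ` carrier G" if "b \<in> \<iota> ` carrier G" "h \<in> carrier G" for h b
    using that \<alpha>_\<iota> by auto
  show ?thesis
    using *[of b g] *[of "\<alpha> g b" "inv g"] assms by (auto simp: boundary_def)
qed

lemma tendsto_\<alpha>: "g \<in> carrier G \<Longrightarrow> (u \<longlongrightarrow> l) F \<Longrightarrow> ((\<lambda>i. \<alpha> g (u i)) \<longlongrightarrow> \<alpha> g l) F"
  by (rule continuous_on_tendsto_compose[OF continuous_\<alpha>]) auto

lemma measurable_\<alpha> [measurable]: "g \<in> carrier G \<Longrightarrow> \<alpha> g \<in> borel_measurable borel"
  by (intro borel_measurable_continuous_onI continuous_\<alpha>)

lemma bdry_borel [measurable]: "bdry \<in> sets borel"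
  using closed_bdry by auto

lemma bdry_limit: "(\<And>n. u n \<in> bdry) \<Longrightarrow> u \<longlonglongrightarrow> l \<Longrightarrow> l \<in> bdry"
  using closed_sequentially[OF closed_bdry] by blast

lemma limit_in_bdry:
  assumes "(\<lambda>n. \<iota> (g n)) \<longlonglongrightarrow> b" "\<And>x. x \<in> carrier G \<Longrightarrow> eventually (\<lambda>n. g n \<noteq> x) sequentially"
    and "range g \<subseteq> carrier G"
  shows "b \<in> bdry"
proof (rule ccontr)
  assume "b \<notin> bdry"
  then obtain x where x: "x \<in> carrier G" "b = \<iota> x" by (auto simp: boundary_def)
  have "eventually (\<lambda>n. \<iota> (g n) \<in> {\<iota> x}) sequentially"
    using assms(1) open_\<iota>[OF x(1)] x by (intro topological_tendstoD) auto
  with assms(2)[OF x(1)] have "eventually (\<lambda>n. False) sequentially"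
  proof eventually_elim
    case (elim n)
    then show ?case using inj_onD[OF inj_\<iota>, of "g n" x] x assms(3) by auto
  qed
  then show False by simp
qed

lemma leaves_finite_sets:
  assumes "(\<lambda>n. \<iota> (g n)) \<longlonglongrightarrow> b" "b \<in> bdry" "x \<in> carrier G"
  shows "eventually (\<lambda>n. g n \<noteq> x) sequentially"
proof -
  have "open (- {\<iota> x})" by (simp add: open_Compl)
  then have "eventually (\<lambda>n. \<iota> (g n) \<in> - {\<iota> x}) sequentially"
    using assms by (intro topological_tendstoD[OF assms(1)]) (auto simp: boundary_def)
  then show ?thesis by eventually_elim auto
qed

text \<open>A fixed element \<open>s\<close> of the strip of \<open>b1\<close> and \<open>b2\<close> is carried to the strip of the two image
  points, while (CP) forces its images to converge to the same point as the sequence itself.\<close>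

lemma limits_not_distinct:
  assumes g: "range g \<subseteq> carrier G" "(\<lambda>n. \<iota> (g n)) \<longlonglongrightarrow> c0" and bdry: "c0 \<in> bdry" "b1 \<in> bdry" "b2 \<in> bdry" "b1 \<noteq> b2"
    and lim: "(\<lambda>n. \<alpha> (g n) b1) \<longlonglongrightarrow> c1" "(\<lambda>n. \<alpha> (g n) b2) \<longlonglongrightarrow> c2"
  shows "c1 = c0 \<or> c2 = c0 \<or> c1 = c2"
proof (rule ccontr)
  assume neq: "\<not> (c1 = c0 \<or> c2 = c0 \<or> c1 = c2)"
  have gn: "g n \<in> carrier G" for n using g by auto
  have cX: "c1 \<in> bdry" "c2 \<in> bdry"
    by (rule bdry_limit[OF _ lim(1)], use gn bdry in simp, rule bdry_limit[OF _ lim(2)], use gn bdry in simp)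
  from neq obtain O0 O1 O2 where O: "open O0" "c0 \<in> O0" "open O1" "c1 \<in> O1" "open O2" "c2 \<in> O2"
    and sep: "\<forall>b1\<in>O1 \<inter> bdry. \<forall>b2\<in>O2 \<inter> bdry. b1 \<noteq> b2 \<longrightarrow> \<iota> ` S b1 b2 \<inter> O0 = {}"
    using S_separated[OF bdry(1) cX] by auto
  obtain s where s: "s \<in> S b1 b2" using S_nonempty[OF bdry(2-4)] by auto
  then have "s \<in> carrier G" using S_subset[OF bdry(2-4)] by auto
  then have "(\<lambda>n. \<iota> (g n \<otimes> s)) \<longlonglongrightarrow> c0" by (intro CP g bdry)
  from topological_tendstoD[OF this O(1,2)] topological_tendstoD[OF lim(1) O(3,4)]
    topological_tendstoD[OF lim(2) O(5,6)]
  have "eventually (\<lambda>n. False) sequentially"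
  proof eventually_elim
    case (elim n)
    have "g n \<otimes> s \<in> S (\<alpha> (g n) b1) (\<alpha> (g n) b2)"
      using S_equivariant[OF bdry(2-4) gn] s by auto
    moreover have "\<iota> ` S (\<alpha> (g n) b1) (\<alpha> (g n) b2) \<inter> O0 = {}"
      using sep[rule_format, of "\<alpha> (g n) b1" "\<alpha> (g n) b2"] elim bdry gn[of n] by simp
    ultimately show ?case using elim by blast
  qed
  then show False by simp
qed

text \<open>After passing to a subsequence, the limits of all \<open>\<alpha> (h n) (\<alpha> k p)\<close> lie in \<open>{p, q}\<close> for one
  further point \<open>q\<close>, since two different limits that differ from \<open>p\<close> are impossible.\<close>

lemma two_point_limit_set:
  assumes h: "range h \<subseteq> carrier G" "(\<lambda>n. \<iota> (h n)) \<longlonglongrightarrow> p" and p: "p \<in> bdry"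
  obtains r q where "strict_mono (r :: nat \<Rightarrow> nat)" "q \<in> bdry"
    "\<And>y k. y \<in> {p, q} \<Longrightarrow> k \<in> carrier G \<Longrightarrow> \<exists>l\<in>{p, q}. (\<lambda>n. \<alpha> (h (r n)) (\<alpha> k y)) \<longlonglongrightarrow> l"
proof -
  have hn: "h n \<in> carrier G" for n using h by auto
  obtain r0 L0 where r0: "strict_mono r0"
    and L0: "\<forall>x\<in>(\<lambda>k. \<alpha> k p) ` carrier G. (\<lambda>n. \<alpha> (h (r0 n)) x) \<longlonglongrightarrow> L0 x"
    by (rule common_convergent_subsequence[OF countable_image[OF countable_G, of "\<lambda>k. \<alpha> k p"],
          where u = "\<lambda>n. \<alpha> (h n)"])
  have lim_p: "(\<lambda>n. \<alpha> (h (r0 n)) (\<alpha> k p)) \<longlonglongrightarrow> L0 (\<alpha> k p)" if "k \<in> carrier G" for k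
    using L0 that by simp
  show ?thesis
  proof (cases "\<forall>k\<in>carrier G. L0 (\<alpha> k p) = p")
    case True
    show ?thesis
    proof (rule that[OF r0 p])
      fix y k assume "y \<in> {p, p}" "k \<in> carrier G"
      then show "\<exists>l\<in>{p, p}. (\<lambda>n. \<alpha> (h (r0 n)) (\<alpha> k y)) \<longlonglongrightarrow> l"
        using lim_p[of k] True by simp
    qed
  next
    case False
    then obtain k1 where k1: "k1 \<in> carrier G" "L0 (\<alpha> k1 p) \<noteq> p" by auto
    define q where "q = L0 (\<alpha> k1 p)"
    have qX: "q \<in> bdry"
      unfolding q_def by (rule bdry_limit[OF _ lim_p[OF k1(1)]]) (use k1 hn p in simp)
    obtain r1 L1 where r1: "strict_mono r1"
      and L1: "\<forall>x\<in>(\<lambda>k. \<alpha> k q) ` carrier G. (\<lambda>n. \<alpha> (h (r0 (r1 n))) x) \<longlonglongrightarrow> L1 x"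
      by (rule common_convergent_subsequence[OF countable_image[OF countable_G, of "\<lambda>k. \<alpha> k q"],
            where u = "\<lambda>n. \<alpha> (h (r0 n))"])
    define r where "r = r0 \<circ> r1"
    have r: "strict_mono r" unfolding r_def by (rule strict_mono_o[OF r0 r1])
    have lim_p': "(\<lambda>n. \<alpha> (h (r n)) (\<alpha> k p)) \<longlonglongrightarrow> L0 (\<alpha> k p)" if "k \<in> carrier G" for k
      using LIMSEQ_subseq_LIMSEQ[OF lim_p[OF that] r1] by (simp add: o_def r_def)
    have lim_q': "(\<lambda>n. \<alpha> (h (r n)) (\<alpha> k q)) \<longlonglongrightarrow> L1 (\<alpha> k q)" if "k \<in> carrier G" for k
      using L1 that by (simp add: r_def)
    have two: "l \<in> {p, q}" if y: "y \<in> bdry" and l: "(\<lambda>n. \<alpha> (h (r n)) y) \<longlonglongrightarrow> l" for y l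
    proof (cases "y = \<alpha> k1 p")
      case True
      then show ?thesis using LIMSEQ_unique[OF l] lim_p'[OF k1(1)] by (simp add: q_def)
    next
      case False
      have "(\<lambda>n. \<iota> (h (r n))) \<longlonglongrightarrow> p"
        using LIMSEQ_subseq_LIMSEQ[OF h(2) r] by (simp add: o_def)
      then have "q = p \<or> l = p \<or> q = l"
        using lim_p'[OF k1(1)] l y False p k1 hn
        by (intro limits_not_distinct[of "\<lambda>n. h (r n)" p "\<alpha> k1 p" y]) (auto simp: q_def)
      then show ?thesis using k1 by (auto simp: q_def)
    qed
    show ?thesis
    proof (rule that[OF r qX])
      fix y k assume yk: "y \<in> {p, q}" "k \<in> carrier G"
      then have "\<exists>l. (\<lambda>n. \<alpha> (h (r n)) (\<alpha> k y)) \<longlonglongrightarrow> l"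
        using lim_p'[of k] lim_q'[of k] by auto
      then obtain l where l: "(\<lambda>n. \<alpha> (h (r n)) (\<alpha> k y)) \<longlonglongrightarrow> l" ..
      moreover have "\<alpha> k y \<in> bdry" using yk p qX by auto
      ultimately show "\<exists>l\<in>{p, q}. (\<lambda>n. \<alpha> (h (r n)) (\<alpha> k y)) \<longlonglongrightarrow> l" using two by auto
    qed
  qed
qed

text \<open>One element of a semigroup with infinite orbits moves both of two points out of a finite set.\<close>

lemma avoid_finite_set:
  assumes \<Sigma>: "\<Sigma> \<subseteq> carrier G" "\<And>k l. k \<in> \<Sigma> \<Longrightarrow> l \<in> \<Sigma> \<Longrightarrow> k \<otimes> l \<in> \<Sigma>"
    and inf: "\<And>b. b \<in> bdry \<Longrightarrow> infinite ((\<lambda>k. \<alpha> k b) ` \<Sigma>)"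
    and p: "p1 \<in> bdry" "p2 \<in> bdry" and Q: "finite Q"
  obtains k where "k \<in> \<Sigma>" "\<alpha> k p1 \<notin> Q" "\<alpha> k p2 \<notin> Q"
proof -
  have ex: "\<exists>k\<in>\<Sigma>. \<alpha> k b \<notin> F" if "b \<in> bdry" "finite F" for b F
  proof (rule ccontr)
    assume "\<not> (\<exists>k\<in>\<Sigma>. \<alpha> k b \<notin> F)"
    then have "(\<lambda>k. \<alpha> k b) ` \<Sigma> \<subseteq> F" by auto
    then show False using inf[OF that(1)] that(2) finite_subset by auto
  qed
  have "\<forall>q\<in>Q \<inter> bdry. \<exists>l. l \<in> \<Sigma> \<and> \<alpha> l q \<notin> Q" using ex Q by blast
  from bchoice[OF this] obtain l where l: "\<forall>q\<in>Q \<inter> bdry. l q \<in> \<Sigma> \<and> \<alpha> (l q) q \<notin> Q" ..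
  define F where "F = Q \<union> (\<Union>q\<in>Q \<inter> bdry. \<alpha> (inv (l q)) ` Q)"
  have "finite F" unfolding F_def using Q by auto
  then obtain k where k: "k \<in> \<Sigma>" "\<alpha> k p1 \<notin> F" using ex[OF p(1)] by blast
  then have 1: "\<alpha> k p1 \<notin> Q" by (simp add: F_def)
  show ?thesis
  proof (cases "\<alpha> k p2 \<in> Q")
    case False
    then show ?thesis using that k 1 by blast
  next
    case True
    \<comment> \<open>Then one of the finitely many \<open>l q\<close> moves both points out of \<open>Q\<close>.\<close>
    define q where "q = \<alpha> k p2"
    have kG: "k \<in> carrier G" using k \<Sigma> by auto
    have q: "q \<in> Q \<inter> bdry" using True p(2) kG by (simp add: q_def)
    then have lq: "l q \<in> \<Sigma>" "\<alpha> (l q) q \<notin> Q" using l by auto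
    then have lG: "l q \<in> carrier G" using \<Sigma> by auto
    have "\<alpha> (l q) (\<alpha> k p1) \<notin> Q"
    proof
      assume *: "\<alpha> (l q) (\<alpha> k p1) \<in> Q"
      have "\<alpha> k p1 = \<alpha> (inv (l q)) (\<alpha> (l q) (\<alpha> k p1))" using lG by simp
      then have "\<alpha> k p1 \<in> \<alpha> (inv (l q)) ` Q" using * by blast
      then show False using k(2) q by (auto simp: F_def)
    qed
    then show ?thesis
      using that[of "l q \<otimes> k"] lq k \<Sigma> lG kG by (simp add: \<alpha>_mult q_def)
  qed
qed

text \<open>Suppose that \<open>g n\<close> tends to \<open>b0\<close> while the images of a generic point \<open>b\<close> tend to some \<open>c \<noteq> b0\<close>.
  By (CP) the products \<open>w (Suc n) = g m \<otimes> k \<otimes> w n\<close> with \<open>m\<close> large depending on \<open>n\<close> still tend to \<open>b0\<close>,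
  and their images of \<open>b\<close> still tend to \<open>c\<close>.  The inverses of the \<open>g m\<close> attract suitable points to a
  set of two points \<open>p\<close> and \<open>q\<close>, which allows the choice of a limit point \<open>x\<close> of preimages whose
  images under all \<open>w n\<close> stay near the translates of \<open>p\<close> and \<open>q\<close> by the inverse of \<open>k\<close>; and \<open>k\<close> is chosen such that
  these differ from \<open>b0\<close> and \<open>c\<close>.  So the images of the two points \<open>x\<close> and \<open>b\<close> contradict
  the fact that limits are not distinct.\<close>

lemma limit_of_generic_orbit:
  assumes \<Sigma>: "\<Sigma> \<subseteq> carrier G" "\<one> \<in> \<Sigma>" "\<And>k l. k \<in> \<Sigma> \<Longrightarrow> l \<in> \<Sigma> \<Longrightarrow> k \<otimes> l \<in> \<Sigma>"
    and inf: "\<And>b. b \<in> bdry \<Longrightarrow> infinite ((\<lambda>k. \<alpha> k b) ` \<Sigma>)"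
    and g: "range g \<subseteq> \<Sigma>" "(\<lambda>n. \<iota> (g n)) \<longlonglongrightarrow> b0" and b0: "b0 \<in> bdry"
    and b: "b \<in> bdry" "\<And>k. k \<in> \<Sigma> \<Longrightarrow> (\<lambda>n. \<alpha> (g n) (\<alpha> k b)) \<longlonglongrightarrow> c"
  shows "c = b0"
proof (rule ccontr)
  assume "c \<noteq> b0"
  have gn: "g n \<in> \<Sigma>" "g n \<in> carrier G" for n using g \<Sigma> by auto
  have c: "c \<in> bdry"
    by (rule bdry_limit[OF _ b(2)[OF \<Sigma>(2)]]) (use gn b \<Sigma> in simp)
  obtain p s where s: "strict_mono s" "((\<lambda>n. \<iota> (inv (g n))) \<circ> s) \<longlonglongrightarrow> p"
    by (rule convergent_subsequence)
  then have p_lim: "(\<lambda>n. \<iota> (inv (g (s n)))) \<longlonglongrightarrow> p" by (simp add: o_def)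
  have p: "p \<in> bdry"
  proof (rule limit_in_bdry[OF p_lim])
    fix x assume x: "x \<in> carrier G"
    from leaves_finite_sets[OF g(2) b0, of "inv x"] x
    have "eventually (\<lambda>n. g n \<noteq> inv x) sequentially" by simp
    then have "eventually (\<lambda>n. g (s n) \<noteq> inv x) sequentially"
      by (rule eventually_subseq[OF s(1)])
    then show "eventually (\<lambda>n. inv (g (s n)) \<noteq> x) sequentially"
      by eventually_elim (use gn x in auto)
  qed (use gn in auto)
  have "range (\<lambda>n. inv (g (s n))) \<subseteq> carrier G" using gn by auto
  then obtain t q where t: "strict_mono t" and q: "q \<in> bdry"
    and pq: "\<And>y k. y \<in> {p, q} \<Longrightarrow> k \<in> carrier G \<Longrightarrow>
      \<exists>l\<in>{p, q}. (\<lambda>n. \<alpha> (inv (g (s (t n)))) (\<alpha> k y)) \<longlonglongrightarrow> l"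
    using two_point_limit_set[OF _ p_lim p] by metis
  define g' where "g' n = g (s (t n))" for n
  have g': "g' n \<in> \<Sigma>" "g' n \<in> carrier G" for n using gn by (auto simp: g'_def)
  have st: "strict_mono (s \<circ> t)" using s(1) t by (rule strict_mono_o)
  have g'_lim: "(\<lambda>n. \<iota> (g' n)) \<longlonglongrightarrow> b0"
    using LIMSEQ_subseq_LIMSEQ[OF g(2) st] by (simp add: o_def g'_def)
  have g'_b: "(\<lambda>n. \<alpha> (g' n) (\<alpha> k b)) \<longlonglongrightarrow> c" if "k \<in> \<Sigma>" for k
    using LIMSEQ_subseq_LIMSEQ[OF b(2)[OF that] st] by (simp add: o_def g'_def)
  obtain k where k: "k \<in> \<Sigma>" "\<alpha> k b0 \<notin> {p, q}" "\<alpha> k c \<notin> {p, q}"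
    by (rule avoid_finite_set[OF \<Sigma>(1,3) inf b0 c, of "{p, q}"]) auto
  then have kG: "k \<in> carrier G" using \<Sigma> by auto
  \<comment> \<open>The limit map sends the two-point set to itself, so it has infinite backward orbits there.\<close>
  obtain f where f: "\<And>y. y \<in> {p, q} \<Longrightarrow> f y \<in> {p, q}"
      "\<And>y. y \<in> {p, q} \<Longrightarrow> (\<lambda>n. \<alpha> (inv (g' n)) (\<alpha> (inv k) y)) \<longlonglongrightarrow> f y"
  proof -
    have "\<forall>y\<in>{p, q}. \<exists>l. l \<in> {p, q} \<and> (\<lambda>n. \<alpha> (inv (g' n)) (\<alpha> (inv k) y)) \<longlonglongrightarrow> l"
      using pq[of _ "inv k"] kG by (auto simp: g'_def)
    from bchoice[OF this] show thesis using that by auto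
  qed
  obtain u :: "nat \<Rightarrow> 'b" where u: "\<And>n. u n \<in> {p, q}" "\<And>n. f (u (Suc n)) = u n"
  proof (cases "f p = p \<or> f q = q")
    case True
    then show ?thesis using that[of "\<lambda>_. p"] that[of "\<lambda>_. q"] by auto
  next
    case False
    then have "f p = q" "f q = p" using f(1) by auto
    then show ?thesis using that[of "\<lambda>n. if even n then p else q"] by simp
  qed
  \<comment> \<open>A state of the construction consists of the current product and the finite set of all products so far.
    The new product is close to its limit \<open>b0\<close> and carries \<open>b\<close> close to \<open>c\<close>, and pulling back \<open>e (Suc n)\<close> by it
    instead of \<open>e n\<close> by the old one hardly changes the images under the earlier products.\<close>
  define e where "e n = \<alpha> (inv k) (u n)" for n
  define Q where "Q n W W' \<longleftrightarrow>
      snd W' = insert (fst W') (snd W) \<and> d (\<iota> (fst W')) b0 < (1/2)^n \<and> d (\<alpha> (fst W') b) c < (1/2)^n \<and>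
      (\<forall>v\<in>snd W. d (\<alpha> v (\<alpha> (inv (fst W')) (e (Suc n)))) (\<alpha> v (\<alpha> (inv (fst W)) (e n))) < (1/2)^n)"
    for n :: nat and W W' :: "'a \<times> 'a set"
  define P where "P n W \<longleftrightarrow> fst W \<in> \<Sigma> \<and> finite (snd W) \<and> snd W \<subseteq> carrier G \<and> fst W \<in> snd W"
    for n :: nat and W :: "'a \<times> 'a set"
  have "\<exists>W. \<forall>n. P n (W n) \<and> Q n (W n) (W (Suc n))"
  proof (rule dependent_nat_choice)
    show "\<exists>W. P 0 W" by (rule exI[of _ "(\<one>, {\<one>})"]) (use \<Sigma> in \<open>auto simp: P_def\<close>)
    fix W n assume "P n W"
    then obtain w F where W: "W = (w, F)" "w \<in> \<Sigma>" "finite F" "F \<subseteq> carrier G" "w \<in> F"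
      by (cases W) (auto simp: P_def)
    then have w: "w \<in> carrier G" "k \<otimes> w \<in> \<Sigma>" "k \<otimes> w \<in> carrier G" using \<Sigma> k by auto
    have pos: "0 < (1/2::real)^n" by simp
    have "(\<lambda>m. \<iota> (g' m \<otimes> (k \<otimes> w))) \<longlonglongrightarrow> b0"
      using g' w g'_lim b0 by (intro CP) auto
    then have "(\<lambda>m. d (\<iota> (g' m \<otimes> (k \<otimes> w))) b0) \<longlonglongrightarrow> 0" by (simp add: tendsto_iff_d[symmetric])
    then have 1: "eventually (\<lambda>m. d (\<iota> (g' m \<otimes> (k \<otimes> w))) b0 < (1/2)^n) sequentially"
      by (rule order_tendstoD) (rule pos)
    have "(\<lambda>m. d (\<alpha> (g' m) (\<alpha> (k \<otimes> w) b)) c) \<longlonglongrightarrow> 0"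
      using g'_b[OF w(2)] by (simp add: tendsto_iff_d[symmetric])
    then have "eventually (\<lambda>m. d (\<alpha> (g' m) (\<alpha> (k \<otimes> w) b)) c < (1/2)^n) sequentially"
      by (rule order_tendstoD) (rule pos)
    then have 2: "eventually (\<lambda>m. d (\<alpha> (g' m \<otimes> (k \<otimes> w)) b) c < (1/2)^n) sequentially"
      using g' w by (simp add: \<alpha>_mult)
    have "eventually (\<lambda>m. \<forall>v\<in>F. d (\<alpha> v (\<alpha> (inv (g' m \<otimes> (k \<otimes> w))) (e (Suc n))))
        (\<alpha> v (\<alpha> (inv w) (e n))) < (1/2)^n) sequentially"
    proof (intro eventually_ball_finite[OF W(3)] ballI)
      fix v assume "v \<in> F"
      then have v: "v \<in> carrier G" using W by auto
      have "(\<lambda>m. \<alpha> (inv (g' m)) (e (Suc n))) \<longlonglongrightarrow> u n"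
        using f(2)[OF u(1)[of "Suc n"]] u(2)[of n] by (simp add: e_def)
      then have "(\<lambda>m. \<alpha> v (\<alpha> (inv (k \<otimes> w)) (\<alpha> (inv (g' m)) (e (Suc n))))) \<longlonglongrightarrow> \<alpha> v (\<alpha> (inv (k \<otimes> w)) (u n))"
        using v w by (intro tendsto_\<alpha>) auto
      moreover have "\<alpha> (inv (k \<otimes> w)) (u n) = \<alpha> (inv w) (e n)"
        using w(1) kG by (simp add: inv_mult_group \<alpha>_mult e_def)
      moreover have "\<alpha> (inv (g' m \<otimes> (k \<otimes> w))) x = \<alpha> (inv (k \<otimes> w)) (\<alpha> (inv (g' m)) x)" for m x
        using w g' by (subst inv_mult_group) (simp_all add: \<alpha>_mult[of "inv (k \<otimes> w)"])
      ultimately have "(\<lambda>m. d (\<alpha> v (\<alpha> (inv (g' m \<otimes> (k \<otimes> w))) (e (Suc n)))) (\<alpha> v (\<alpha> (inv w) (e n)))) \<longlonglongrightarrow> 0"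
        by (simp add: tendsto_iff_d[symmetric])
      then show "eventually (\<lambda>m. d (\<alpha> v (\<alpha> (inv (g' m \<otimes> (k \<otimes> w))) (e (Suc n))))
        (\<alpha> v (\<alpha> (inv w) (e n))) < (1/2)^n) sequentially"
        by (rule order_tendstoD) (rule pos)
    qed
    with 1 2 have "eventually (\<lambda>m. Q n W (g' m \<otimes> (k \<otimes> w), insert (g' m \<otimes> (k \<otimes> w)) F)) sequentially"
      by eventually_elim (simp add: Q_def W)
    then obtain m where "Q n W (g' m \<otimes> (k \<otimes> w), insert (g' m \<otimes> (k \<otimes> w)) F)"
      by (auto dest: eventually_happens)
    moreover have "P (Suc n) (g' m \<otimes> (k \<otimes> w), insert (g' m \<otimes> (k \<otimes> w)) F)"
      using W w g' \<Sigma> by (simp add: P_def)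
    ultimately show "\<exists>W'. P (Suc n) W' \<and> Q n W W'" by blast
  qed
  then obtain W where W: "\<And>n. P n (W n)" "\<And>n. Q n (W n) (W (Suc n))" by blast
  define w where "w n = fst (W n)" for n
  have w: "w n \<in> \<Sigma>" "w n \<in> carrier G" for n using W(1)[of n] \<Sigma> by (auto simp: P_def w_def)
  have mem: "w i \<in> snd (W n)" if "i \<le> n" for i n
    using that
  proof (induction n rule: dec_induct)
    case base
    then show ?case using W(1)[of i] by (simp add: P_def w_def)
  next
    case (step n)
    then show ?case using W(2)[of n] by (simp add: Q_def)
  qed
  define \<beta> where "\<beta> n = \<alpha> (inv (w n)) (e n)" for n
  have close: "d (\<alpha> (w i) (\<beta> (Suc n))) (\<alpha> (w i) (\<beta> n)) < (1/2)^n" if "i \<le> n" for i n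
    using W(2)[of n] mem[OF that] by (auto simp: Q_def \<beta>_def w_def[symmetric])
  have dist: "d (\<alpha> (w i) (\<beta> n)) (e i) \<le> 2 * (1/2)^i - 2 * (1/2)^n" if "i \<le> n" for i n
    using that
  proof (induction n rule: dec_induct)
    case base
    then show ?case using w by (simp add: \<beta>_def)
  next
    case (step n)
    have "d (\<alpha> (w i) (\<beta> (Suc n))) (e i) \<le> d (\<alpha> (w i) (\<beta> (Suc n))) (\<alpha> (w i) (\<beta> n)) + d (\<alpha> (w i) (\<beta> n)) (e i)"
      by (rule d_triangle)
    also have "\<dots> \<le> (1/2)^n + (2 * (1/2)^i - 2 * (1/2)^n)"
      using close[of i n] step by (intro add_mono) auto
    finally show ?case by simp
  qed
  obtain x r where r: "strict_mono r" "(\<beta> \<circ> r) \<longlonglongrightarrow> x" by (rule convergent_subsequence)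
  have \<beta>_bdry: "\<beta> n \<in> bdry" for n
    using w u(1)[of n] p q kG by (auto simp: \<beta>_def e_def)
  have x: "x \<in> bdry" by (rule bdry_limit[OF _ r(2)]) (simp add: \<beta>_bdry)
  have dist_x: "d (\<alpha> (w i) x) (e i) \<le> 2 * (1/2)^i" for i
  proof (rule LIMSEQ_le_const2)
    show "(\<lambda>n. d (\<alpha> (w i) ((\<beta> \<circ> r) n)) (e i)) \<longlonglongrightarrow> d (\<alpha> (w i) x) (e i)"
      by (intro tendsto_d tendsto_\<alpha> r w tendsto_const)
    show "\<exists>N. \<forall>n\<ge>N. d (\<alpha> (w i) ((\<beta> \<circ> r) n)) (e i) \<le> 2 * (1/2)^i"
    proof (intro exI allI impI)
      fix n assume "i \<le> n"
      then have "i \<le> r n" using seq_suble[OF r(1), of n] by simp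
      from dist[OF this] show "d (\<alpha> (w i) ((\<beta> \<circ> r) n)) (e i) \<le> 2 * (1/2)^i"
        using zero_le_power[of "1/2::real" "r n"] unfolding o_def by linarith
    qed
  qed
  \<comment> \<open>A subsequence along which the points \<open>e n\<close> are all equal to one point \<open>z\<close>.\<close>
  obtain y and v :: "nat \<Rightarrow> nat" where v: "strict_mono v" "\<And>n. u (v n) = y" and y: "y \<in> {p, q}"
  proof (cases "eventually (\<lambda>n. u n \<noteq> p) sequentially")
    case True
    then obtain N where "\<And>n. N \<le> n \<Longrightarrow> u n \<noteq> p" by (auto simp: eventually_sequentially)
    then have "u (n + N) = q" for n using u(1)[of "n + N"] by auto
    then show ?thesis using that[of "\<lambda>n. n + N" q] by (auto simp: strict_mono_def)
  next
    case False
    from not_eventually_sequentiallyD[OF this] show ?thesis using that[of _ p] by auto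
  qed
  define z where "z = \<alpha> (inv k) y"
  have z: "z \<noteq> b0" "z \<noteq> c"
  proof -
    have "\<alpha> k z = y" using kG by (simp add: z_def)
    then show "z \<noteq> b0" "z \<noteq> c" using k y by auto
  qed
  have pow0: "(\<lambda>n. (1/2::real)^n) \<longlonglongrightarrow> 0" by (intro LIMSEQ_power_zero) auto
  have "(\<lambda>n. d (\<alpha> (w (v n)) x) z) \<longlonglongrightarrow> 0"
  proof (rule Lim_null_comparison)
    show "eventually (\<lambda>n. norm (d (\<alpha> (w (v n)) x) z) \<le> 2 * (1/2)^(v n)) sequentially"
    proof (intro always_eventually allI)
      fix n
      show "norm (d (\<alpha> (w (v n)) x) z) \<le> 2 * (1/2)^(v n)"
        using dist_x[of "v n"] v(2)[of n] d_nonneg by (simp add: e_def z_def)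
    qed
    have "(\<lambda>n. 2 * (1/2::real)^(v n)) \<longlonglongrightarrow> 2 * 0"
      using LIMSEQ_subseq_LIMSEQ[OF pow0 v(1)] by (intro tendsto_intros) (simp add: o_def)
    then show "(\<lambda>n. 2 * (1/2::real)^(v n)) \<longlonglongrightarrow> 0" by simp
  qed
  then have 1: "(\<lambda>n. \<alpha> (w (v n)) x) \<longlonglongrightarrow> z" by (simp add: tendsto_iff_d[symmetric])
  have "(\<lambda>n. d (\<iota> (w (Suc n))) b0) \<longlonglongrightarrow> 0"
    by (rule Lim_null_comparison[OF _ pow0])
      (use W(2) d_nonneg in \<open>auto simp: Q_def w_def intro!: always_eventually less_imp_le\<close>)
  then have "(\<lambda>n. \<iota> (w n)) \<longlonglongrightarrow> b0"
    unfolding tendsto_iff_d[of _ b0] by (rule LIMSEQ_imp_Suc)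
  from LIMSEQ_subseq_LIMSEQ[OF this v(1)] have 2: "(\<lambda>n. \<iota> (w (v n))) \<longlonglongrightarrow> b0" by (simp add: o_def)
  have "(\<lambda>n. d (\<alpha> (w (Suc n)) b) c) \<longlonglongrightarrow> 0"
    by (rule Lim_null_comparison[OF _ pow0])
      (use W(2) d_nonneg in \<open>auto simp: Q_def w_def intro!: always_eventually less_imp_le\<close>)
  then have "(\<lambda>n. \<alpha> (w n) b) \<longlonglongrightarrow> c"
    unfolding tendsto_iff_d[of _ c] by (rule LIMSEQ_imp_Suc)
  from LIMSEQ_subseq_LIMSEQ[OF this v(1)] have 3: "(\<lambda>n. \<alpha> (w (v n)) b) \<longlonglongrightarrow> c" by (simp add: o_def)
  have "x \<noteq> b" using LIMSEQ_unique[OF 1] 3 z by auto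
  then have "z = b0 \<or> c = b0 \<or> z = c"
    using limits_not_distinct[of "\<lambda>n. w (v n)", OF _ 2 b0 x b(1) _ 1 3] w by auto
  then show False using z \<open>c \<noteq> b0\<close> by auto
qed

end

section \<open>Stationary measures\<close>

text \<open>Otherwise balls with radii tending to zero and mass more than \<open>\<epsilon>\<close> would accumulate at a point, which would
  then be an atom.\<close>

lemma (in compact_metrizable) uniformly_small_balls:
  assumes L: "prob_space L" "sets L = sets borel" "\<And>b. measure L {b} = 0" and \<epsilon>: "0 < \<epsilon>"
  obtains \<delta> where "0 < \<delta>" "\<And>y. measure L {x. d x y < \<delta>} \<le> \<epsilon>"
proof (rule ccontr)
  interpret L: prob_space L by fact
  note [measurable_cong] = L(2)
  have sets_ball [measurable]: "{x. d x y < \<rho>} \<in> sets L" for y \<rho>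
    using open_ball_d[of y \<rho>] by (simp add: L(2))
  assume "\<not> thesis"
  then have "\<exists>y. \<epsilon> < measure L {x. d x y < \<delta>}" if "0 < \<delta>" for \<delta>
    using that \<open>\<And>\<delta>. 0 < \<delta> \<Longrightarrow> (\<And>y. measure L {x. d x y < \<delta>} \<le> \<epsilon>) \<Longrightarrow> thesis\<close> not_less by blast
  then have "\<forall>n. \<exists>y. \<epsilon> < measure L {x. d x y < 1 / real (Suc n)}" by simp
  from choice[OF this] obtain y where y: "\<And>n. \<epsilon> < measure L {x. d x (y n) < 1 / real (Suc n)}" by auto
  obtain r l where r: "strict_mono r" "(y \<circ> r) \<longlonglongrightarrow> l" by (rule convergent_subsequence)
  have lower: "\<epsilon> \<le> measure L {x. d x l < \<rho>}" if "0 < \<rho>" for \<rho>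
  proof -
    have "(\<lambda>n. d ((y \<circ> r) n) l) \<longlonglongrightarrow> 0" using r(2) by (simp only: tendsto_iff_d[symmetric])
    then have "(\<lambda>n. d ((y \<circ> r) n) l + 1 / real (Suc (r n))) \<longlonglongrightarrow> 0 + 0"
      using LIMSEQ_subseq_LIMSEQ[OF LIMSEQ_Suc[OF lim_1_over_n] r(1)]
      by (intro tendsto_add) (simp_all add: o_def add.commute)
    then have "eventually (\<lambda>n. d ((y \<circ> r) n) l + 1 / real (Suc (r n)) < \<rho>) sequentially"
      using that by (intro order_tendstoD) auto
    then obtain n where n: "d (y (r n)) l + 1 / real (Suc (r n)) < \<rho>"
      by (auto dest: eventually_happens)
    have "{x. d x (y (r n)) < 1 / real (Suc (r n))} \<subseteq> {x. d x l < \<rho>}"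
    proof
      fix x assume "x \<in> {x. d x (y (r n)) < 1 / real (Suc (r n))}"
      then show "x \<in> {x. d x l < \<rho>}" using n d_triangle[of x l "y (r n)"] by simp
    qed
    then have "measure L {x. d x (y (r n)) < 1 / real (Suc (r n))} \<le> measure L {x. d x l < \<rho>}"
      by (intro L.finite_measure_mono) auto
    then show ?thesis using y[of "r n"] by linarith
  qed
  have "(\<lambda>n. measure L {x. d x l < 1 / real (Suc n)}) \<longlonglongrightarrow> measure L (\<Inter>n. {x. d x l < 1 / real (Suc n)})"
  proof (rule L.finite_Lim_measure_decseq)
    show "decseq (\<lambda>n. {x. d x l < 1 / real (Suc n)})"
      by (rule decseq_SucI) (auto simp: frac_le intro: less_le_trans)
  qed auto
  moreover have "(\<Inter>n. {x. d x l < 1 / real (Suc n)}) = {l}"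
  proof (intro equalityI subsetI)
    fix x assume x: "x \<in> (\<Inter>n. {x. d x l < 1 / real (Suc n)})"
    show "x \<in> {l}"
    proof (rule ccontr)
      assume "x \<notin> {l}"
      then obtain n where "1 / real (Suc n) < d x l" using nat_approx_posE[OF d_pos[of x l]] by auto
      moreover have "d x l < 1 / real (Suc n)" using x by blast
      ultimately show False by simp
    qed
  qed auto
  ultimately have "(\<lambda>n. measure L {x. d x l < 1 / real (Suc n)}) \<longlonglongrightarrow> 0" using L(3) by simp
  then have "\<epsilon> \<le> 0" by (rule LIMSEQ_le_const) (use lower in auto)
  then show False using \<epsilon> by simp
qed

locale boundary_walk = random_walk G \<mu> + boundary_action G d \<iota> \<alpha> S
  for G :: "('a, 'm) monoid_scheme" (structure) and \<mu> :: "'a measure"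
    and d :: "'b::{second_countable_topology,t2_space} \<Rightarrow> 'b \<Rightarrow> real" and \<iota> \<alpha> S +
  assumes bdry_nonempty: "boundary G \<iota> \<noteq> {}"
    and no_finite_invariant: "finite F \<Longrightarrow> F \<noteq> {} \<Longrightarrow> F \<subseteq> boundary G \<iota> \<Longrightarrow>
      \<exists>g\<in>carrier G. emeasure \<mu> {g} \<noteq> 0 \<and> \<alpha> g ` F \<noteq> F"
begin

text \<open>Stationary measures on the boundary, regarded as measures on the whole compactification.\<close>

definition stat :: "'b measure \<Rightarrow> bool" where
  "stat L \<longleftrightarrow> prob_space L \<and> sets L = sets borel \<and> measure L bdry = 1 \<and>
     (\<forall>A\<in>sets borel. emeasure L A = (\<integral>\<^sup>+g. emeasure L (\<alpha> g -` A) \<partial>\<mu>))"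

lemma vimage_\<alpha> [measurable]: "g \<in> carrier G \<Longrightarrow> A \<in> sets borel \<Longrightarrow> \<alpha> g -` A \<in> sets borel"
  using measurable_sets[OF measurable_\<alpha>, of g A] by simp

lemma AE_\<mu>D:
  assumes "AE g in \<mu>. Q g" "g \<in> carrier G" "emeasure \<mu> {g} \<noteq> 0"
  shows "Q g"
proof (rule ccontr)
  assume "\<not> Q g"
  from assms(1) obtain N where N: "{g \<in> space \<mu>. \<not> Q g} \<subseteq> N" "emeasure \<mu> N = 0" "N \<in> sets \<mu>"
    by (rule AE_E)
  have "emeasure \<mu> {g} \<le> emeasure \<mu> N"
    using N \<open>\<not> Q g\<close> assms(2) by (intro emeasure_mono) (auto simp: space_\<mu>)
  then show False using N assms(3) by simp
qed

lemma measurable_action: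
  assumes [measurable_cong]: "sets L = sets (borel :: 'b measure)"
  shows "(\<lambda>p. \<alpha> (fst p) (snd p)) \<in> measurable (\<mu> \<Otimes>\<^sub>M L) borel"
proof -
  have "(\<lambda>p. \<alpha> g (snd p)) \<in> measurable (\<mu> \<Otimes>\<^sub>M L) borel" if "g \<in> carrier G" for g
    using that by measurable
  moreover have "fst \<in> measurable (\<mu> \<Otimes>\<^sub>M L) (count_space (carrier G))"
    using measurable_fst[of \<mu> L] by (simp add: measurable_cong_sets[OF refl sets_\<mu>_count])
  ultimately show ?thesis
    by (rule measurable_compose_countable'[where I = "carrier G"]) (simp_all add: countable_carrier)
qed

lemma emeasure_action:
  assumes L: "prob_space L" "sets L = sets borel" and A [measurable]: "A \<in> sets borel"
  shows "emeasure (distr (\<mu> \<Otimes>\<^sub>M L) borel (\<lambda>p. \<alpha> (fst p) (snd p))) A =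
    (\<integral>\<^sup>+g. emeasure L (\<alpha> g -` A) \<partial>\<mu>)"
proof -
  interpret L: prob_space L by fact
  note [measurable] = measurable_action[OF L(2)]
  have "emeasure (distr (\<mu> \<Otimes>\<^sub>M L) borel (\<lambda>p. \<alpha> (fst p) (snd p))) A =
      (\<integral>\<^sup>+p. indicator A (\<alpha> (fst p) (snd p)) \<partial>(\<mu> \<Otimes>\<^sub>M L))"
    by (simp add: nn_integral_indicator[symmetric] nn_integral_distr del: nn_integral_indicator)
  also have "\<dots> = (\<integral>\<^sup>+g. \<integral>\<^sup>+b. indicator A (\<alpha> g b) \<partial>L \<partial>\<mu>)"
    by (subst L.nn_integral_fst[symmetric]) auto
  also have "\<dots> = (\<integral>\<^sup>+g. emeasure L (\<alpha> g -` A) \<partial>\<mu>)"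
  proof (intro nn_integral_cong)
    fix g assume "g \<in> space \<mu>"
    then have "\<alpha> g -` A \<in> sets L" using A by (simp add: space_\<mu> L(2))
    moreover have "(\<integral>\<^sup>+b. indicator A (\<alpha> g b) \<partial>L) = (\<integral>\<^sup>+b. indicator (\<alpha> g -` A) b \<partial>L)"
      by (intro nn_integral_cong) (auto simp: indicator_def)
    ultimately show "(\<integral>\<^sup>+b. indicator A (\<alpha> g b) \<partial>L) = emeasure L (\<alpha> g -` A)" by simp
  qed
  finally show ?thesis .
qed

context
  fixes L assumes L: "stat L"
begin

interpretation L: prob_space L using L by (simp add: stat_def)

lemma sets_stat [measurable_cong]: "sets L = sets borel"
  using L by (simp add: stat_def)

lemma space_stat: "space L = UNIV"
  using sets_eq_imp_space_eq[OF sets_stat] by simp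

lemma AE_stat_bdry: "AE b in L. b \<in> bdry"
  using L L.prob_eq_1[of bdry] by (auto simp: stat_def sets_stat)

lemmas measurable_action_stat [measurable] = measurable_action[OF sets_stat]

lemma stat_distr: "distr (\<mu> \<Otimes>\<^sub>M L) borel (\<lambda>p. \<alpha> (fst p) (snd p)) = L"
proof (rule measure_eqI)
  fix A assume "A \<in> sets (distr (\<mu> \<Otimes>\<^sub>M L) borel (\<lambda>p. \<alpha> (fst p) (snd p)))"
  then have A: "A \<in> sets borel" by simp
  show "emeasure (distr (\<mu> \<Otimes>\<^sub>M L) borel (\<lambda>p. \<alpha> (fst p) (snd p))) A = emeasure L A"
    using emeasure_action[OF _ sets_stat A] L A by (simp add: stat_def)
qed (simp add: sets_stat)

lemma stat_nn_integral:
  assumes [measurable]: "\<phi> \<in> borel_measurable borel"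
  shows "(\<integral>\<^sup>+b. \<phi> b \<partial>L) = (\<integral>\<^sup>+g. \<integral>\<^sup>+b. \<phi> (\<alpha> g b) \<partial>L \<partial>\<mu>)"
proof -
  have "(\<integral>\<^sup>+b. \<phi> b \<partial>L) = (\<integral>\<^sup>+b. \<phi> b \<partial>distr (\<mu> \<Otimes>\<^sub>M L) borel (\<lambda>p. \<alpha> (fst p) (snd p)))"
    by (simp only: stat_distr)
  also have "\<dots> = (\<integral>\<^sup>+p. \<phi> (\<alpha> (fst p) (snd p)) \<partial>(\<mu> \<Otimes>\<^sub>M L))"
    by (intro nn_integral_distr) auto
  also have "\<dots> = (\<integral>\<^sup>+g. \<integral>\<^sup>+b. \<phi> (\<alpha> g b) \<partial>L \<partial>\<mu>)"
    by (subst L.nn_integral_fst[symmetric]) auto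
  finally show ?thesis .
qed

lemma stat_integral:
  fixes \<phi> :: "'b \<Rightarrow> real"
  assumes [measurable]: "\<phi> \<in> borel_measurable borel" and B: "\<And>b. \<bar>\<phi> b\<bar> \<le> B"
  shows "(\<integral>b. \<phi> b \<partial>L) = (\<integral>g. \<integral>b. \<phi> (\<alpha> g b) \<partial>L \<partial>\<mu>)"
proof -
  interpret pair_prob_space \<mu> L ..
  have "(\<integral>b. \<phi> b \<partial>L) = (\<integral>b. \<phi> b \<partial>distr (\<mu> \<Otimes>\<^sub>M L) borel (\<lambda>p. \<alpha> (fst p) (snd p)))"
    by (simp only: stat_distr)
  also have "\<dots> = (\<integral>p. \<phi> (\<alpha> (fst p) (snd p)) \<partial>(\<mu> \<Otimes>\<^sub>M L))"
    by (intro integral_distr) auto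
  also have "\<dots> = (\<integral>g. \<integral>b. \<phi> (\<alpha> g b) \<partial>L \<partial>\<mu>)"
    using B by (subst integral_fst'[symmetric]) (auto intro!: integrable_const_bound[of _ B])
  finally show ?thesis .
qed

lemma stat_measure:
  assumes A: "A \<in> sets borel"
  shows "measure L A = (\<integral>g. measure L (\<alpha> g -` A) \<partial>\<mu>)"
proof -
  have "measure L A = (\<integral>b. indicator A b \<partial>L)" by (simp add: space_stat)
  also have "\<dots> = (\<integral>g. \<integral>b. indicator A (\<alpha> g b) \<partial>L \<partial>\<mu>)"
    using A by (intro stat_integral[where B = 1]) (auto simp: indicator_def)
  also have "\<dots> = (\<integral>g. measure L (\<alpha> g -` A) \<partial>\<mu>)"
  proof (intro Bochner_Integration.integral_cong refl)
    fix g
    have "(\<integral>b. indicator A (\<alpha> g b) \<partial>L) = (\<integral>b. indicat_real (\<alpha> g -` A) b \<partial>L)"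
      by (intro Bochner_Integration.integral_cong refl) (auto simp: indicator_def)
    then show "(\<integral>b. indicator A (\<alpha> g b) \<partial>L) = measure L (\<alpha> g -` A)" by (simp add: space_stat)
  qed
  finally show ?thesis .
qed

lemma stat_harmonic:
  assumes \<phi>: "\<phi> \<in> borel_measurable borel" and B: "\<And>b. \<bar>\<phi> b\<bar> \<le> B"
  shows "bounded_by B (\<lambda>y. \<integral>b. \<phi> (\<alpha> y b) \<partial>L)" "harmonic (\<lambda>y. \<integral>b. \<phi> (\<alpha> y b) \<partial>L)"
proof -
  have m: "(\<lambda>b. \<phi> (\<alpha> y b)) \<in> borel_measurable borel" if "y \<in> carrier G" for y
    using \<phi> measurable_\<alpha>[OF that] by (rule measurable_compose_rev)
  then have m': "(\<lambda>b. \<phi> (\<alpha> y b)) \<in> borel_measurable L" if "y \<in> carrier G" for y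
    using that by (simp add: measurable_cong_sets[OF sets_stat refl])
  have "\<bar>\<integral>b. \<phi> (\<alpha> y b) \<partial>L\<bar> \<le> B" if y: "y \<in> carrier G" for y
  proof -
    have "\<bar>\<integral>b. \<phi> (\<alpha> y b) \<partial>L\<bar> \<le> (\<integral>b. \<bar>\<phi> (\<alpha> y b)\<bar> \<partial>L)" by (rule integral_abs_bound)
    also have "\<dots> \<le> (\<integral>b. B \<partial>L)"
      using B m'[OF y] by (intro integral_mono) (auto intro!: L.integrable_const_bound[of _ B])
    finally show ?thesis by (simp add: L.prob_space)
  qed
  then show "bounded_by B (\<lambda>y. \<integral>b. \<phi> (\<alpha> y b) \<partial>L)" by (simp add: bounded_by_def)
  show "harmonic (\<lambda>y. \<integral>b. \<phi> (\<alpha> y b) \<partial>L)"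
    unfolding harmonic_def step_def
  proof
    fix y assume y: "y \<in> carrier G"
    have "(\<integral>b. \<phi> (\<alpha> y b) \<partial>L) = (\<integral>g. \<integral>b. \<phi> (\<alpha> y (\<alpha> g b)) \<partial>L \<partial>\<mu>)"
      using m[OF y] B by (rule stat_integral)
    also have "\<dots> = (\<integral>g. \<integral>b. \<phi> (\<alpha> (y \<otimes> g) b) \<partial>L \<partial>\<mu>)"
      using y by (intro Bochner_Integration.integral_cong refl) (auto simp: space_\<mu> \<alpha>_mult)
    finally show "(\<integral>g. \<integral>b. \<phi> (\<alpha> (y \<otimes> g) b) \<partial>L \<partial>\<mu>) = (\<integral>b. \<phi> (\<alpha> y b) \<partial>L)" ..
  qed
qed

text \<open>The atoms of maximal mass form a finite set, and averaging forces every element of the support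
  of \<open>\<mu>\<close> to permute them.\<close>

lemma stat_no_atoms: "measure L {b} = 0"
proof (rule ccontr)
  assume "measure L {b} \<noteq> 0"
  define m where "m x = measure L {x}" for x
  have m: "0 \<le> m x" "m x \<le> 1" for x unfolding m_def by auto
  have mb: "0 < m b" using \<open>measure L {b} \<noteq> 0\<close> m(1)[of b] unfolding m_def by linarith
  have fin: "finite {x. m b \<le> m x}"
  proof (rule ccontr)
    assume inf: "infinite {x. m b \<le> m x}"
    obtain n where n: "1 < real n * m b" using reals_Archimedean3[OF mb] by blast
    obtain F where F: "finite F" "card F = n" "F \<subseteq> {x. m b \<le> m x}"
      using infinite_arbitrarily_large[OF inf] by blast
    have "real n * m b = (\<Sum>x\<in>F. m b)" using F by simp
    also have "\<dots> \<le> (\<Sum>x\<in>F. m x)" using F by (intro sum_mono) auto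
    also have "\<dots> = measure L F"
      unfolding m_def using F(1) by (intro L.finite_measure_eq_sum_singleton[symmetric]) (auto simp: sets_stat)
    finally show False using n L.prob_le_1[of F] by simp
  qed
  define M where "M = Max (m ` {x. m b \<le> m x})"
  have "M \<in> m ` {x. m b \<le> m x}" unfolding M_def using fin by (intro Max_in) auto
  then obtain c where c: "m c = M" "m b \<le> M" by auto
  have le: "m x \<le> M" for x
  proof (cases "m b \<le> m x")
    case True
    then show ?thesis unfolding M_def using fin by (intro Max_ge) auto
  qed (use c in simp)
  define F where "F = {x. m x = M}"
  have F: "finite F" "F \<noteq> {}" using c fin by (auto simp: F_def intro: rev_finite_subset)
  have "F \<subseteq> bdry"
  proof
    fix x assume x: "x \<in> F"
    show "x \<in> bdry"
    proof (rule ccontr)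
      assume "x \<notin> bdry"
      then have "measure L {x} + measure L bdry = measure L ({x} \<union> bdry)"
        by (intro L.finite_measure_Union[symmetric]) (auto simp: sets_stat)
      moreover have "measure L {x} = M" "measure L bdry = 1"
        using x L by (auto simp: F_def m_def stat_def)
      ultimately show False using L.prob_le_1[of "{x} \<union> bdry"] c(2) mb by linarith
    qed
  qed
  then obtain g where g: "g \<in> carrier G" "emeasure \<mu> {g} \<noteq> 0" "\<alpha> g ` F \<noteq> F"
    using no_finite_invariant[OF F] by auto
  have "\<alpha> (inv g) x \<in> F" if x: "x \<in> F" for x
  proof -
    have "M = (\<integral>g. measure L (\<alpha> g -` {x}) \<partial>\<mu>)"
      using stat_measure[of "{x}"] x by (simp add: F_def m_def)
    also have "\<dots> = (\<integral>g. m (\<alpha> (inv g) x) \<partial>\<mu>)"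
    proof (intro Bochner_Integration.integral_cong refl)
      fix g assume "g \<in> space \<mu>"
      then have "\<alpha> g -` {x} = {\<alpha> (inv g) x}" by (auto simp: space_\<mu>)
      then show "measure L (\<alpha> g -` {x}) = m (\<alpha> (inv g) x)" by (simp add: m_def)
    qed
    finally have "M = (\<integral>g. m (\<alpha> (inv g) x) \<partial>\<mu>)" .
    moreover have int: "integrable \<mu> (\<lambda>g. m (\<alpha> (inv g) x))"
      using m by (intro integrable_\<mu>[of 1]) (auto simp: bounded_by_def)
    ultimately have "(\<integral>g. M - m (\<alpha> (inv g) x) \<partial>\<mu>) = 0" by (simp add: \<mu>.prob_space)
    then have "AE g in \<mu>. M - m (\<alpha> (inv g) x) = 0"
      using int le by (subst (asm) integral_nonneg_eq_0_iff_AE) auto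
    then show ?thesis using AE_\<mu>D[OF _ g(1,2)] by (auto simp: F_def)
  qed
  then have "\<alpha> (inv g) ` F \<subseteq> F" by auto
  then have "\<alpha> (inv g) ` F = F"
    using F(1) g(1) by (intro endo_inj_surj) (auto simp: inj_on_def)
  then have "\<alpha> g ` F = \<alpha> g ` \<alpha> (inv g) ` F" by simp
  also have "\<dots> = F" using g(1) by (simp add: image_image)
  finally show False using g(3) by simp
qed

text \<open>The elements that map \<open>L\<close> to a measure absolutely continuous with respect to \<open>L\<close>.  They form a
  semigroup, and an event of full measure for \<open>L\<close> also has full measure for the translates of \<open>L\<close> by them.\<close>

definition nonsingular :: "'a set" where
  "nonsingular = {k \<in> carrier G. \<forall>A\<in>sets borel. emeasure L A = 0 \<longrightarrow> emeasure L (\<alpha> k -` A) = 0}"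

end

text \<open>A finite orbit of a semigroup containing the support of \<open>\<mu>\<close> would be permuted by the support.\<close>

lemma orbits_infinite:
  assumes \<Sigma>: "\<Sigma> \<subseteq> carrier G" "\<one> \<in> \<Sigma>" "\<And>k l. k \<in> \<Sigma> \<Longrightarrow> l \<in> \<Sigma> \<Longrightarrow> k \<otimes> l \<in> \<Sigma>"
    and supp: "\<And>g. g \<in> carrier G \<Longrightarrow> emeasure \<mu> {g} \<noteq> 0 \<Longrightarrow> g \<in> \<Sigma>" and b: "b \<in> bdry"
  shows "infinite ((\<lambda>k. \<alpha> k b) ` \<Sigma>)"
proof
  define F where "F = (\<lambda>k. \<alpha> k b) ` \<Sigma>"
  assume "finite ((\<lambda>k. \<alpha> k b) ` \<Sigma>)"
  then have F: "finite F" "F \<noteq> {}" "F \<subseteq> bdry" using \<Sigma> b by (auto simp: F_def)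
  then obtain g where g: "g \<in> carrier G" "emeasure \<mu> {g} \<noteq> 0" "\<alpha> g ` F \<noteq> F"
    using no_finite_invariant[OF F] by auto
  have "\<alpha> g ` F \<subseteq> F"
  proof
    fix x assume "x \<in> \<alpha> g ` F"
    then obtain k where k: "k \<in> \<Sigma>" "x = \<alpha> g (\<alpha> k b)" by (auto simp: F_def)
    then have "x = \<alpha> (g \<otimes> k) b" using g \<Sigma> by (auto simp: \<alpha>_mult)
    then show "x \<in> F" using \<Sigma>(3)[OF supp[OF g(1,2)] k(1)] by (auto simp: F_def)
  qed
  then have "\<alpha> g ` F = F" using F(1) g(1) by (intro endo_inj_surj) (auto simp: inj_on_def)
  then show False using g(3) by simp
qed

end

context boundary_action
begin

definition strip_pairs :: "'a set \<Rightarrow> ('b \<times> 'b) set" where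
  "strip_pairs K = {(a, b). a \<in> bdry \<and> b \<in> bdry \<and> a \<noteq> b \<and> S a b \<inter> K \<noteq> {}}"

text \<open>By equivariance this is the probability that the strip between \<open>a\<close> and \<open>\<alpha> g b\<close> meets the translate of
  \<open>K\<close> by \<open>g\<close>, where \<open>a\<close> and \<open>b\<close> are independent with distributions \<open>M\<close> and \<open>L\<close>.\<close>

definition meets :: "'b measure \<Rightarrow> 'b measure \<Rightarrow> 'a set \<Rightarrow> 'a \<Rightarrow> real" where
  "meets M L K g = measure (M \<Otimes>\<^sub>M L) {p. (\<alpha> (inv g) (fst p), snd p) \<in> strip_pairs K}"

lemma measurable_strip_pairs [measurable]:
  assumes "K \<subseteq> carrier G"
  shows "strip_pairs K \<in> sets (borel \<Otimes>\<^sub>M borel)"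
proof -
  have "strip_pairs K = (\<Union>s\<in>K. {(a, b). a \<in> bdry \<and> b \<in> bdry \<and> a \<noteq> b \<and> s \<in> S a b})"
    by (auto simp: strip_pairs_def)
  also have "\<dots> \<in> sets (borel \<Otimes>\<^sub>M borel)"
    using assms S_borel countable_subset[OF assms countable_G] by (intro sets.countable_UN'') auto
  finally show ?thesis .
qed

text \<open>If \<open>g n\<close> tends to \<open>b0\<close>, then for fixed \<open>a\<close> and \<open>b\<close> a strip between \<open>a\<close> and \<open>\<alpha> (g n) b\<close> can
  contain one of the points \<open>g n \<otimes> s\<close>, which tend to \<open>b0\<close>, for infinitely many \<open>n\<close> only if \<open>a\<close> is close to
  \<open>b0\<close>, or \<open>\<alpha> (g n) b\<close> is close to \<open>b0\<close> or to \<open>a\<close>.  If \<open>a\<close> is random without atoms,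
  then \<open>a\<close> is close to a given point with small probability only.\<close>

lemma meets_estimate:
  assumes M: "prob_space M" "sets M = sets borel" "\<And>b. measure M {b} = 0"
    and L: "prob_space L" "sets L = sets borel"
    and g: "range g \<subseteq> carrier G" "(\<lambda>n. \<iota> (g n)) \<longlonglongrightarrow> b0" "b0 \<in> bdry"
    and K: "finite K" "K \<subseteq> carrier G" and V: "open V" "b0 \<in> V" and \<epsilon>: "0 < \<epsilon>"
  shows "eventually (\<lambda>n. meets M L K (g n) \<le> measure L {b. \<alpha> (g n) b \<in> V} + \<epsilon>) sequentially"
proof -
  interpret M: prob_space M by fact
  interpret L: prob_space L by fact
  interpret pair: pair_prob_space M L ..
  note [measurable_cong] = M(2) L(2)
  have gn [measurable, simp]: "g n \<in> carrier G" for n using g by auto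
  have spaces [simp]: "space M = UNIV" "space L = UNIV"
    using sets_eq_imp_space_eq[OF M(2)] sets_eq_imp_space_eq[OF L(2)] by auto
  define e where "e = \<epsilon> / 3"
  have e: "0 < e" using \<epsilon> by (simp add: e_def)
  obtain \<delta> where \<delta>: "0 < \<delta>" "\<And>y. measure M {x. d x y < \<delta>} \<le> e"
    using uniformly_small_balls[OF M e] by metis
  define V' where "V' = V \<inter> {y. d y b0 < \<delta>}"
  have V': "open V'" "b0 \<in> V'" using V open_ball_d \<delta> by (auto simp: V'_def)
  then have [measurable]: "V' \<in> sets borel" "V \<in> sets borel" using V by auto
  have mV': "measure M V' \<le> e"
  proof -
    have "measure M V' \<le> measure M {y. d y b0 < \<delta>}"
      using open_ball_d[of b0 \<delta>] by (intro M.finite_measure_mono) (auto simp: V'_def M(2))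
    then show ?thesis using \<delta>(2)[of b0] by linarith
  qed
  define A where "A n = {p. (\<alpha> (inv (g n)) (fst p), snd p) \<in> strip_pairs K}" for n
  define B where "B n = {p \<in> A n. fst p \<notin> V' \<and> \<alpha> (g n) (snd p) \<notin> V' \<and> \<delta> \<le> d (fst p) (\<alpha> (g n) (snd p))}" for n
  have A_sets [measurable]: "A n \<in> sets (M \<Otimes>\<^sub>M L)" for n
  proof -
    have "(\<lambda>p. (\<alpha> (inv (g n)) (fst p), snd p)) \<in> measurable (M \<Otimes>\<^sub>M L) (borel \<Otimes>\<^sub>M borel)"
      by measurable
    from measurable_sets[OF this measurable_strip_pairs[OF K(2)]]
    show ?thesis by (simp add: A_def vimage_def space_pair_measure)
  qed
  have *: "{p \<in> space (M \<Otimes>\<^sub>M L). fst p \<in> V'} \<in> sets (M \<Otimes>\<^sub>M L)"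
    "{p \<in> space (M \<Otimes>\<^sub>M L). \<alpha> (g n) (snd p) \<in> V'} \<in> sets (M \<Otimes>\<^sub>M L)"
    "{p \<in> space (M \<Otimes>\<^sub>M L). d (fst p) (\<alpha> (g n) (snd p)) < \<delta>} \<in> sets (M \<Otimes>\<^sub>M L)"
    "{p \<in> space (M \<Otimes>\<^sub>M L). p \<in> A n \<and> fst p \<notin> V' \<and> \<alpha> (g n) (snd p) \<notin> V' \<and> \<delta> \<le> d (fst p) (\<alpha> (g n) (snd p))} \<in> sets (M \<Otimes>\<^sub>M L)" for n
    by measurable
  then have sets1 [measurable]: "{p. fst p \<in> V'} \<in> sets (M \<Otimes>\<^sub>M L)"
    "{p. \<alpha> (g n) (snd p) \<in> V'} \<in> sets (M \<Otimes>\<^sub>M L)"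
    "{p. d (fst p) (\<alpha> (g n) (snd p)) < \<delta>} \<in> sets (M \<Otimes>\<^sub>M L)"
    "B n \<in> sets (M \<Otimes>\<^sub>M L)" for n
    by (simp_all add: space_pair_measure B_def)
  have 1: "measure (M \<Otimes>\<^sub>M L) {p. fst p \<in> V'} \<le> e"
  proof -
    have "{p. fst p \<in> V'} = V' \<times> space L" by auto
    moreover have "emeasure (M \<Otimes>\<^sub>M L) (V' \<times> space L) = emeasure M V' * emeasure L (space L)"
      by (intro L.emeasure_pair_measure_Times) (auto simp: M(2))
    ultimately have "emeasure (M \<Otimes>\<^sub>M L) {p. fst p \<in> V'} = emeasure M V'"
      by (simp add: L.emeasure_space_1[simplified])
    then show ?thesis using mV' by (simp add: measure_def)
  qed
  have 2: "measure (M \<Otimes>\<^sub>M L) {p. \<alpha> (g n) (snd p) \<in> V'} \<le> measure L {b. \<alpha> (g n) b \<in> V}" for n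
  proof -
    have s: "{b. \<alpha> (g n) b \<in> V'} \<in> sets L" "{b. \<alpha> (g n) b \<in> V} \<in> sets L"
      using measurable_sets[OF measurable_\<alpha>[OF gn], of V' n] measurable_sets[OF measurable_\<alpha>[OF gn], of V n]
      by (simp_all add: vimage_def L(2))
    have "{p. \<alpha> (g n) (snd p) \<in> V'} = space M \<times> {b. \<alpha> (g n) b \<in> V'}" by auto
    moreover have "emeasure (M \<Otimes>\<^sub>M L) (space M \<times> {b. \<alpha> (g n) b \<in> V'}) =
        emeasure M (space M) * emeasure L {b. \<alpha> (g n) b \<in> V'}"
      using s by (intro L.emeasure_pair_measure_Times) auto
    ultimately have "emeasure (M \<Otimes>\<^sub>M L) {p. \<alpha> (g n) (snd p) \<in> V'} = emeasure L {b. \<alpha> (g n) b \<in> V'}"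
      by (simp add: M.emeasure_space_1[simplified])
    then have "measure (M \<Otimes>\<^sub>M L) {p. \<alpha> (g n) (snd p) \<in> V'} = measure L {b. \<alpha> (g n) b \<in> V'}"
      by (simp add: measure_def)
    also have "\<dots> \<le> measure L {b. \<alpha> (g n) b \<in> V}"
      using s by (intro L.finite_measure_mono) (auto simp: V'_def)
    finally show ?thesis .
  qed
  have 3: "measure (M \<Otimes>\<^sub>M L) {p. d (fst p) (\<alpha> (g n) (snd p)) < \<delta>} \<le> e" for n
  proof -
    have "emeasure (M \<Otimes>\<^sub>M L) {p. d (fst p) (\<alpha> (g n) (snd p)) < \<delta>} =
        (\<integral>\<^sup>+b. emeasure M ((\<lambda>a. (a, b)) -` {p. d (fst p) (\<alpha> (g n) (snd p)) < \<delta>}) \<partial>L)"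
      by (rule pair.emeasure_pair_measure_alt2) simp
    also have "\<dots> \<le> (\<integral>\<^sup>+b. ennreal e \<partial>L)"
      using \<delta>(2) by (intro nn_integral_mono) (simp add: vimage_def M.emeasure_eq_measure ennreal_leI)
    also have "\<dots> = ennreal e" by (simp add: L.emeasure_space_1[simplified])
    finally show ?thesis using e by (simp add: pair.emeasure_eq_measure)
  qed
  \<comment> \<open>The event \<open>B n\<close> is what remains of \<open>A n\<close> when the three unlikely or tolerated cases are removed.
    By (CS) no pair belongs to \<open>B n\<close> for infinitely many \<open>n\<close>, so its probability tends to zero.\<close>
  have not_B: "eventually (\<lambda>n. p \<notin> B n) sequentially" for p
  proof (rule ccontr)
    assume "\<not> ?thesis"
    then have "\<not> eventually (\<lambda>n. p \<notin> B n) sequentially" by simp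
    from not_eventually_sequentiallyD[OF this]
    obtain r :: "nat \<Rightarrow> nat" where r: "strict_mono r" "\<And>n. p \<in> B (r n)" by auto
    obtain a b where p: "p = (a, b)" by (cases p)
    obtain s y where s: "strict_mono s" "((\<lambda>n. \<alpha> (g (r n)) b) \<circ> s) \<longlonglongrightarrow> y" by (rule convergent_subsequence)
    define k where "k n = g (r (s n))" for n
    have k: "k n \<in> carrier G" for n by (simp add: k_def)
    have ky: "(\<lambda>n. \<alpha> (k n) b) \<longlonglongrightarrow> y" using s(2) by (simp add: k_def o_def)
    have kb0: "(\<lambda>n. \<iota> (k n)) \<longlonglongrightarrow> b0"
      using LIMSEQ_subseq_LIMSEQ[OF g(2) strict_mono_o[OF r(1) s(1)]] by (simp add: o_def k_def)
    have B: "(\<alpha> (inv (k n)) a, b) \<in> strip_pairs K" "a \<notin> V'" "\<alpha> (k n) b \<notin> V'" "\<delta> \<le> d a (\<alpha> (k n) b)" for n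
      using r(2)[of "s n"] by (simp_all add: B_def A_def p k_def)
    have ab: "\<alpha> (inv (k n)) a \<in> bdry" "b \<in> bdry" "\<alpha> (inv (k n)) a \<noteq> b" "S (\<alpha> (inv (k n)) a) b \<inter> K \<noteq> {}" for n
      using B(1)[of n] by (auto simp: strip_pairs_def)
    then have a: "a \<in> bdry" using \<alpha>_bdry[of "inv (k 0)" a] k by auto
    have y: "y \<in> bdry" by (rule bdry_limit[OF _ ky]) (use ab k in simp)
    have "y \<in> - V'"
      by (rule closed_sequentially[OF _ _ ky]) (use B V' in auto)
    moreover have "\<delta> \<le> d a y"
      by (rule LIMSEQ_le_const[OF tendsto_d[OF tendsto_const ky]]) (use B in auto)
    ultimately have neq: "b0 \<noteq> a" "b0 \<noteq> y" "a \<noteq> y" using V'(2) B(2) \<delta>(1) by auto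
    obtain O0 O1 O2 where O: "open O0" "b0 \<in> O0" "open O1" "a \<in> O1" "open O2" "y \<in> O2"
      and sep: "\<forall>b1\<in>O1 \<inter> bdry. \<forall>b2\<in>O2 \<inter> bdry. b1 \<noteq> b2 \<longrightarrow> \<iota> ` S b1 b2 \<inter> O0 = {}"
      using S_separated[OF g(3) a y neq] by auto
    have "eventually (\<lambda>n. \<forall>s\<in>K. \<iota> (k n \<otimes> s) \<in> O0) sequentially"
    proof (intro eventually_ball_finite[OF K(1)] ballI)
      fix s assume "s \<in> K"
      then have "(\<lambda>n. \<iota> (k n \<otimes> s)) \<longlonglongrightarrow> b0" using K k kb0 g(3) by (intro CP) auto
      then show "eventually (\<lambda>n. \<iota> (k n \<otimes> s) \<in> O0) sequentially" using O(1,2) by (rule topological_tendstoD)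
    qed
    moreover note topological_tendstoD[OF ky O(5,6)]
    ultimately have "eventually (\<lambda>n. False) sequentially"
    proof eventually_elim
      case (elim n)
      obtain s where s: "s \<in> K" "s \<in> S (\<alpha> (inv (k n)) a) b" using ab(4)[of n] by auto
      have "S a (\<alpha> (k n) b) = (\<lambda>s. k n \<otimes> s) ` S (\<alpha> (inv (k n)) a) b"
        using S_equivariant[OF ab(1,2,3) k, of n n] k[of n] by simp
      then have "k n \<otimes> s \<in> S a (\<alpha> (k n) b)" using s by auto
      moreover have "\<alpha> (k n) b \<in> bdry" "a \<noteq> \<alpha> (k n) b" using ab(2) ab(3)[of n] k[of n] by auto
      ultimately show ?case using sep[rule_format, of a "\<alpha> (k n) b"] elim s a O(4) by blast
    qed
    then show False by simp
  qed
  have "(\<lambda>n. integral\<^sup>L (M \<Otimes>\<^sub>M L) (indicat_real (B n))) \<longlonglongrightarrow> integral\<^sup>L (M \<Otimes>\<^sub>M L) (\<lambda>_. 0)"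
  proof (rule integral_dominated_convergence[where w = "\<lambda>_. 1"])
    show "AE p in M \<Otimes>\<^sub>M L. (\<lambda>n. indicat_real (B n) p) \<longlonglongrightarrow> 0"
    proof (rule AE_I2)
      fix p
      show "(\<lambda>n. indicat_real (B n) p) \<longlonglongrightarrow> 0"
        using not_B[of p] by (rule tendsto_eventually[OF eventually_mono]) simp
    qed
  qed (auto simp: indicator_def)
  then have "(\<lambda>n. measure (M \<Otimes>\<^sub>M L) (B n)) \<longlonglongrightarrow> 0" by (simp add: space_pair_measure)
  then have "eventually (\<lambda>n. measure (M \<Otimes>\<^sub>M L) (B n) < e) sequentially"
    using e by (rule order_tendstoD)
  then show ?thesis
  proof eventually_elim
    case (elim n)
    let ?m = "measure (M \<Otimes>\<^sub>M L)"
    have "meets M L K (g n) = ?m (A n)" by (simp add: meets_def A_def)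
    also have "\<dots> \<le> ?m ({p. fst p \<in> V'} \<union> ({p. \<alpha> (g n) (snd p) \<in> V'} \<union>
        ({p. d (fst p) (\<alpha> (g n) (snd p)) < \<delta>} \<union> B n)))"
      by (intro pair.P.finite_measure_mono) (auto simp: B_def)
    also have "\<dots> \<le> ?m {p. fst p \<in> V'} + ?m ({p. \<alpha> (g n) (snd p) \<in> V'} \<union>
        ({p. d (fst p) (\<alpha> (g n) (snd p)) < \<delta>} \<union> B n))"
      by (rule measure_Un_le) auto
    also have "?m ({p. \<alpha> (g n) (snd p) \<in> V'} \<union> ({p. d (fst p) (\<alpha> (g n) (snd p)) < \<delta>} \<union> B n)) \<le>
        ?m {p. \<alpha> (g n) (snd p) \<in> V'} + ?m ({p. d (fst p) (\<alpha> (g n) (snd p)) < \<delta>} \<union> B n)"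
      by (rule measure_Un_le) auto
    also have "?m ({p. d (fst p) (\<alpha> (g n) (snd p)) < \<delta>} \<union> B n) \<le>
        ?m {p. d (fst p) (\<alpha> (g n) (snd p)) < \<delta>} + ?m (B n)"
      by (rule measure_Un_le) auto
    finally show ?case using 1 2[of n] 3[of n] elim by (simp add: e_def)
  qed
qed

text \<open>Every pair of distinct points has a nonempty strip, so finitely many elements of the group
  suffice to meet most of the strips.\<close>

lemma meets_most:
  assumes M: "prob_space M" "sets M = sets borel" "\<And>b. measure M {b} = 0" "AE b in M. b \<in> bdry"
    and L: "prob_space L" "sets L = sets borel" "AE b in L. b \<in> bdry" and \<epsilon>: "0 < \<epsilon>"
  obtains K where "finite K" "K \<subseteq> carrier G" "1 - \<epsilon> < meets M L K \<one>"
proof -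
  interpret M: prob_space M by fact
  interpret L: prob_space L by fact
  interpret pair: pair_prob_space M L ..
  note [measurable_cong] = M(2) L(2)
  have spaces [simp]: "space M = UNIV" "space L = UNIV"
    using sets_eq_imp_space_eq[OF M(2)] sets_eq_imp_space_eq[OF L(2)] by auto
  define K where "K n = from_nat_into (carrier G) ` {..n}" for n :: nat
  have ne: "carrier G \<noteq> {}" by auto
  have K: "finite (K n)" "K n \<subseteq> carrier G" for n
    using from_nat_into[OF ne] by (auto simp: K_def)
  have UK: "(\<Union>n. K n) = carrier G"
    using range_from_nat_into[OF ne countable_G] by (fastforce simp: K_def)
  have meets_1: "meets M L K' \<one> = measure (M \<Otimes>\<^sub>M L) (strip_pairs K')" for K'
    by (simp add: meets_def)
  have sets_pair: "sets (M \<Otimes>\<^sub>M L) = sets (borel \<Otimes>\<^sub>M borel)"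
    using M(2) L(2) by (rule sets_pair_measure_cong)
  have "(\<lambda>n. measure (M \<Otimes>\<^sub>M L) (strip_pairs (K n))) \<longlonglongrightarrow> measure (M \<Otimes>\<^sub>M L) (\<Union>n. strip_pairs (K n))"
  proof (rule pair.P.finite_Lim_measure_incseq)
    show "range (\<lambda>n. strip_pairs (K n)) \<subseteq> sets (M \<Otimes>\<^sub>M L)"
      using measurable_strip_pairs[OF K(2)] by (auto simp: sets_pair)
    show "incseq (\<lambda>n. strip_pairs (K n))"
      by (rule incseq_SucI) (auto simp: strip_pairs_def K_def)
  qed
  moreover have "measure (M \<Otimes>\<^sub>M L) (\<Union>n. strip_pairs (K n)) = 1"
  proof -
    have "(\<Union>n. strip_pairs (K n)) = strip_pairs (\<Union>n. K n)" by (auto simp: strip_pairs_def)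
    then have eq: "(\<Union>n. strip_pairs (K n)) = strip_pairs (carrier G)" by (simp only: UK)
    have diag: "AE b in L. AE a in M. a \<noteq> b"
    proof (rule AE_I2)
      fix b
      have "emeasure M {b} = 0" using M(3)[of b] by (simp add: M.emeasure_eq_measure)
      then show "AE a in M. a \<noteq> b" by (intro AE_I[of _ _ "{b}"]) (auto simp: M(2))
    qed
    have "AE b in L. AE a in M. (a, b) \<in> strip_pairs (carrier G)"
      using L(3) diag
    proof eventually_elim
      case (elim b)
      from elim(2) M(4) show ?case
      proof eventually_elim
        case (elim a)
        then show ?case using \<open>b \<in> bdry\<close> S_nonempty[of a b] S_subset[of a b]
          by (auto simp: strip_pairs_def)
      qed
    qed
    moreover have [measurable]: "strip_pairs (carrier G) \<in> sets (M \<Otimes>\<^sub>M L)"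
      using measurable_strip_pairs[of "carrier G"] by (simp add: sets_pair)
    moreover have ms: "{p \<in> space (M \<Otimes>\<^sub>M L). (fst p, snd p) \<in> strip_pairs (carrier G)} \<in> sets (M \<Otimes>\<^sub>M L)"
      by simp
    ultimately have "AE a in M. AE b in L. (a, b) \<in> strip_pairs (carrier G)"
      using pair.AE_commute[of "\<lambda>a b. (a, b) \<in> strip_pairs (carrier G)"] by simp
    then have "AE p in M \<Otimes>\<^sub>M L. p \<in> strip_pairs (carrier G)"
      using pair.AE_pair_iff[OF ms] by simp
    then show ?thesis unfolding eq by (subst pair.P.prob_eq_1) (auto simp: sets_pair)
  qed
  ultimately have "(\<lambda>n. measure (M \<Otimes>\<^sub>M L) (strip_pairs (K n))) \<longlonglongrightarrow> 1" by simp
  then have "eventually (\<lambda>n. 1 - \<epsilon> < measure (M \<Otimes>\<^sub>M L) (strip_pairs (K n))) sequentially"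
    by (rule order_tendstoD) (use \<epsilon> in simp)
  then obtain n where "1 - \<epsilon> < measure (M \<Otimes>\<^sub>M L) (strip_pairs (K n))"
    by (auto dest: eventually_happens)
  then show ?thesis using that[OF K] by (simp add: meets_1)
qed

end

context boundary_walk
begin

text \<open>Averaging the distributions of the positions of the walk started from a boundary point and
  passing to a weak limit (Krylov and Bogolyubov).\<close>

lemma stat_exists: "\<exists>L. stat L"
proof -
  obtain b where b: "b \<in> bdry" using bdry_nonempty by auto
  let ?U = "\<lambda>N::nat. measure_pmf (pmf_of_set {..N})"
  let ?pos = "\<lambda>p. \<alpha> (walk G \<one> (snd p) (fst p)) b"
  define m where "m N = distr (?U N \<Otimes>\<^sub>M increments) borel ?pos" for N
  have pos [measurable]: "?pos \<in> measurable (?U N \<Otimes>\<^sub>M increments) borel" for N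
  proof -
    have "(\<lambda>p. walk G \<one> (snd p) n) \<in> measurable (?U N \<Otimes>\<^sub>M increments) (count_space (carrier G))" for n
      by (rule measurable_compose[OF measurable_snd measurable_walk]) simp
    moreover have "fst \<in> measurable (?U N \<Otimes>\<^sub>M increments) (count_space UNIV)"
      using measurable_fst[of "?U N" increments] by (simp add: measurable_cong_sets[OF refl sets_measure_pmf_count_space])
    ultimately have "(\<lambda>p. walk G \<one> (snd p) (fst p)) \<in> measurable (?U N \<Otimes>\<^sub>M increments) (count_space (carrier G))"
      by (rule measurable_compose_countable'[where I = UNIV]) auto
    then show ?thesis by (rule measurable_compose) simp
  qed
  have m: "prob_space (m N)" "sets (m N) = sets borel" for N
  proof -
    interpret pair_prob_space "?U N" increments ..
    show "prob_space (m N)" unfolding m_def by (rule P.prob_space_distr) simp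
  qed (simp add: m_def)
  have int_m: "(\<integral>x. \<phi> x \<partial>m N) = (\<Sum>n\<le>N. expect (\<lambda>y. \<phi> (\<alpha> y b)) n \<one>) / real (Suc N)"
    if [measurable]: "\<phi> \<in> borel_measurable borel" and B: "\<And>x. \<bar>\<phi> x\<bar> \<le> B" for \<phi> :: "'b \<Rightarrow> real" and B N
  proof -
    interpret pair_prob_space "?U N" increments ..
    have "(\<integral>x. \<phi> x \<partial>m N) = (\<integral>p. \<phi> (?pos p) \<partial>(?U N \<Otimes>\<^sub>M increments))"
      unfolding m_def by (intro integral_distr) auto
    also have "\<dots> = (\<integral>n. \<integral>h. \<phi> (?pos (n, h)) \<partial>increments \<partial>?U N)"
      using B by (intro integral_fst'[symmetric] integrable_const_bound[of _ B]) auto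
    also have "\<dots> = (\<Sum>n\<le>N. expect (\<lambda>y. \<phi> (\<alpha> y b)) n \<one>) / real (Suc N)"
      by (subst integral_pmf_of_set) (auto simp: expect_def)
    finally show ?thesis .
  qed
  obtain r L where r: "strict_mono r" and L: "prob_space L" "sets L = sets borel"
    and weak: "\<And>\<phi> :: 'b \<Rightarrow> real. continuous_on UNIV \<phi> \<Longrightarrow> (\<lambda>n. integral\<^sup>L (m (r n)) \<phi>) \<longlonglongrightarrow> integral\<^sup>L L \<phi>"
    by (rule weakly_convergent_subsequence[of m, OF m]) blast
  interpret L: prob_space L by fact
  note [measurable_cong] = L(2)
  have space_L: "space L = UNIV" using sets_eq_imp_space_eq[OF L(2)] by simp
  have no_mass: "emeasure L {\<iota> g} = 0" if g: "g \<in> carrier G" for g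
  proof -
    have "continuous_on UNIV (indicat_real {\<iota> g})" unfolding continuous_on_def
    proof
      fix x
      have "open {\<iota> g}" "open (- {\<iota> g})" using open_\<iota>[OF g] by (auto simp: open_Compl)
      then have "eventually (\<lambda>z. indicat_real {\<iota> g} z = indicat_real {\<iota> g} x) (nhds x)"
        unfolding eventually_nhds
        by (cases "x = \<iota> g") (force simp: indicator_def)+
      then have "eventually (\<lambda>z. indicat_real {\<iota> g} z = indicat_real {\<iota> g} x) (at x)"
        unfolding eventually_at_filter by (rule eventually_mono) simp
      then show "(indicat_real {\<iota> g} \<longlongrightarrow> indicat_real {\<iota> g} x) (at x within UNIV)"
        by (rule tendsto_eventually)
    qed
    note weak[OF this]
    moreover have "integral\<^sup>L (m N) (indicat_real {\<iota> g}) = 0" for N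
    proof -
      have 0: "expect (\<lambda>y. indicat_real {\<iota> g} (\<alpha> y b)) n \<one> = 0" for n
      proof -
        have "\<alpha> (walk G \<one> h n) b \<noteq> \<iota> g" if h: "h \<in> space increments" for h
          using \<alpha>_bdry[OF walk_closed[OF one_closed h], of n b] b g by (auto simp: boundary_def)
        then have "expect (\<lambda>y. indicat_real {\<iota> g} (\<alpha> y b)) n \<one> = (\<integral>h. 0 \<partial>increments)"
          unfolding expect_def by (intro Bochner_Integration.integral_cong) auto
        then show ?thesis by simp
      qed
      have "integral\<^sup>L (m N) (indicat_real {\<iota> g}) =
          (\<Sum>n\<le>N. expect (\<lambda>y. indicat_real {\<iota> g} (\<alpha> y b)) n \<one>) / real (Suc N)"
        by (rule int_m[of "indicat_real {\<iota> g}" 1 N]) (auto simp: indicator_def)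
      then show ?thesis by (simp only: 0 sum.neutral_const div_0)
    qed
    ultimately have "integral\<^sup>L L (indicat_real {\<iota> g}) = 0" using LIMSEQ_unique[OF _ tendsto_const] by simp
    then show ?thesis by (simp add: space_L L.emeasure_eq_measure)
  qed
  have "AE x in L. \<forall>g\<in>carrier G. x \<noteq> \<iota> g"
    unfolding AE_ball_countable[OF countable_carrier]
  proof
    fix g assume "g \<in> carrier G"
    then show "AE x in L. x \<noteq> \<iota> g"
      using no_mass[of g] by (intro AE_I[of _ _ "{\<iota> g}"]) (auto simp: L(2))
  qed
  then have "AE x in L. x \<in> bdry" by eventually_elim (auto simp: boundary_def)
  then have "measure L bdry = 1" by (subst L.prob_eq_1) (auto simp: L(2))
  moreover
  let ?N = "distr (\<mu> \<Otimes>\<^sub>M L) borel (\<lambda>p. \<alpha> (fst p) (snd p))"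
  interpret \<mu>L: pair_prob_space \<mu> L ..
  note [measurable] = measurable_action[OF L(2)]
  have "L = ?N"
  proof (rule measure_eqI_continuous)
    show "finite_measure L" by (rule L.finite_measure)
    show "finite_measure ?N" by (intro prob_space.finite_measure \<mu>L.P.prob_space_distr) measurable
    fix \<phi> :: "'b \<Rightarrow> real" assume \<phi>: "continuous_on UNIV \<phi>"
    then have [measurable]: "\<phi> \<in> borel_measurable borel" by (rule borel_measurable_continuous_onI)
    have "bounded (range \<phi>)" using compact_continuous_image[OF \<phi> compact_UNIV] by (rule compact_imp_bounded)
    then obtain B where B: "\<And>x. \<bar>\<phi> x\<bar> \<le> B" by (auto simp: bounded_iff)
    define \<psi> where "\<psi> x = (\<integral>s. \<phi> (\<alpha> s x) \<partial>\<mu>)" for x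
    have int_s: "integrable \<mu> (\<lambda>s. \<phi> (\<alpha> s x))" for x
      using B by (intro integrable_\<mu>[of B]) (auto simp: bounded_by_def)
    have \<psi>_cont: "continuous_on UNIV \<psi>"
    proof (rule continuous_on_sequentiallyI)
      fix x :: "nat \<Rightarrow> 'b" and l assume x: "x \<longlonglongrightarrow> l"
      show "(\<lambda>n. \<psi> (x n)) \<longlonglongrightarrow> \<psi> l"
        unfolding \<psi>_def
      proof (rule integral_dominated_convergence[where w = "\<lambda>_. B"])
        show "AE s in \<mu>. (\<lambda>n. \<phi> (\<alpha> s (x n))) \<longlonglongrightarrow> \<phi> (\<alpha> s l)"
        proof (rule AE_I2)
          fix s assume "s \<in> space \<mu>"
          then have "(\<lambda>n. \<alpha> s (x n)) \<longlonglongrightarrow> \<alpha> s l" using x by (intro tendsto_\<alpha>) (auto simp: space_\<mu>)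
          then show "(\<lambda>n. \<phi> (\<alpha> s (x n))) \<longlonglongrightarrow> \<phi> (\<alpha> s l)"
            by (rule continuous_on_tendsto_compose[OF \<phi>]) auto
        qed
      qed (use B in auto)
    qed
    have \<psi>_B: "\<bar>\<psi> x\<bar> \<le> B" for x
    proof -
      have "\<bar>\<psi> x\<bar> \<le> (\<integral>s. \<bar>\<phi> (\<alpha> s x)\<bar> \<partial>\<mu>)" unfolding \<psi>_def by (rule integral_abs_bound)
      also have "\<dots> \<le> (\<integral>s. B \<partial>\<mu>)" using B int_s by (intro integral_mono) auto
      finally show ?thesis by (simp add: \<mu>.prob_space)
    qed
    have [measurable]: "\<psi> \<in> borel_measurable borel" using \<psi>_cont by (rule borel_measurable_continuous_onI)
    let ?a = "\<lambda>n. expect (\<lambda>y. \<phi> (\<alpha> y b)) n \<one>"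
    have shift: "expect (\<lambda>y. \<psi> (\<alpha> y b)) n \<one> = ?a (Suc n)" for n
    proof -
      interpret \<mu>P: pair_prob_space \<mu> increments ..
      have [measurable]: "(\<lambda>p. \<phi> (\<alpha> (fst p) (\<alpha> (walk G \<one> (snd p) n) b))) \<in> borel_measurable (\<mu> \<Otimes>\<^sub>M increments)"
      proof -
        have "(\<lambda>p. \<phi> (\<alpha> s (\<alpha> (walk G \<one> (snd p) n) b))) \<in> borel_measurable (\<mu> \<Otimes>\<^sub>M increments)" for s
          by (rule measurable_compose[OF measurable_snd
                borel_measurable_walk[of \<one> "\<lambda>y. \<phi> (\<alpha> s (\<alpha> y b))" n]]) simp
        moreover have "fst \<in> measurable (\<mu> \<Otimes>\<^sub>M increments) (count_space (carrier G))"
          using measurable_fst[of \<mu> increments] by (simp add: measurable_cong_sets[OF refl sets_\<mu>_count])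
        ultimately show ?thesis
          by (rule measurable_compose_countable'[where I = "carrier G"]) (simp_all add: countable_carrier)
      qed
      have "?a (Suc n) = (\<integral>s. expect (\<lambda>y. \<phi> (\<alpha> y b)) n (\<one> \<otimes> s) \<partial>\<mu>)"
        using B by (intro expect_Suc_first[of B]) (auto simp: bounded_by_def)
      also have "\<dots> = (\<integral>s. \<integral>h. \<phi> (\<alpha> s (\<alpha> (walk G \<one> h n) b)) \<partial>increments \<partial>\<mu>)"
        unfolding expect_def
      proof (intro Bochner_Integration.integral_cong refl)
        fix s h assume "s \<in> space \<mu>" and h: "h \<in> space increments"
        then have s: "s \<in> carrier G" by (simp add: space_\<mu>)
        have "walk G (\<one> \<otimes> s) h n = s \<otimes> walk G \<one> h n"
          using walk_left[OF s one_closed h, of n] s by simp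
        then show "\<phi> (\<alpha> (walk G (\<one> \<otimes> s) h n) b) = \<phi> (\<alpha> s (\<alpha> (walk G \<one> h n) b))"
          using s walk_closed[OF one_closed h, of n] by (simp add: \<alpha>_mult)
      qed
      also have "\<dots> = (\<integral>h. \<integral>s. \<phi> (\<alpha> s (\<alpha> (walk G \<one> h n) b)) \<partial>\<mu> \<partial>increments)"
        using B by (intro \<mu>P.Fubini_integral[symmetric] \<mu>P.integrable_const_bound[of _ B])
          (auto simp: case_prod_beta)
      finally show ?thesis by (simp add: expect_def \<psi>_def)
    qed
    have "(\<integral>x. \<psi> x \<partial>m N) - (\<integral>x. \<phi> x \<partial>m N) = (?a (Suc N) - ?a 0) / real (Suc N)" for N
    proof -
      have "(\<Sum>n\<le>N. ?a (Suc n)) - (\<Sum>n\<le>N. ?a n) = ?a (Suc N) - ?a 0"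
        unfolding sum_subtractf[symmetric] using sum_lessThan_telescope[of ?a "Suc N"]
        by (simp add: lessThan_Suc_atMost)
      then show ?thesis using int_m[of \<phi> B N] int_m[of \<psi> B N] B \<psi>_B
        by (simp add: shift diff_divide_distrib[symmetric])
    qed
    moreover have a_le: "\<bar>?a n\<bar> \<le> B" for n
    proof -
      have "bounded_by B (\<lambda>y. \<phi> (\<alpha> y b))" using B by (simp add: bounded_by_def)
      from expect_bounded[OF this, of n] show ?thesis by (auto simp: bounded_by_def)
    qed
    then have "\<bar>?a (Suc N) - ?a 0\<bar> \<le> 2 * B" for N
      using a_le[of "Suc N"] a_le[of 0] by linarith
    ultimately have bound: "norm ((\<integral>x. \<psi> x \<partial>m N) - (\<integral>x. \<phi> x \<partial>m N)) \<le> 2 * B * (1 / real (Suc N))" for N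
      by (simp add: abs_divide divide_right_mono)
    have "(\<lambda>N. 2 * B * (1 / real (Suc N))) \<longlonglongrightarrow> 2 * B * 0"
      using LIMSEQ_Suc[OF lim_1_over_n] by (intro tendsto_intros) (simp add: add.commute)
    then have "(\<lambda>N. 2 * B * (1 / real (Suc N))) \<longlonglongrightarrow> 0" by simp
    from Lim_null_comparison[OF always_eventually[OF allI[OF bound]] this]
    have "(\<lambda>N. (\<integral>x. \<psi> x \<partial>m N) - (\<integral>x. \<phi> x \<partial>m N)) \<longlonglongrightarrow> 0" .
    from LIMSEQ_subseq_LIMSEQ[OF this r]
    have "(\<lambda>n. (\<integral>x. \<psi> x \<partial>m (r n)) - (\<integral>x. \<phi> x \<partial>m (r n))) \<longlonglongrightarrow> 0" by (simp add: o_def)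
    moreover have "(\<lambda>n. (\<integral>x. \<psi> x \<partial>m (r n)) - (\<integral>x. \<phi> x \<partial>m (r n))) \<longlonglongrightarrow> (\<integral>x. \<psi> x \<partial>L) - (\<integral>x. \<phi> x \<partial>L)"
      by (intro tendsto_diff weak \<psi>_cont \<phi>)
    ultimately have "(\<integral>x. \<phi> x \<partial>L) = (\<integral>x. \<psi> x \<partial>L)" using LIMSEQ_unique by fastforce
    also have "\<dots> = (\<integral>s. \<integral>x. \<phi> (\<alpha> s x) \<partial>L \<partial>\<mu>)"
      unfolding \<psi>_def using B
      by (intro \<mu>L.Fubini_integral \<mu>L.integrable_const_bound[of _ B]) (auto simp: case_prod_beta)
    also have "\<dots> = (\<integral>p. \<phi> (\<alpha> (fst p) (snd p)) \<partial>(\<mu> \<Otimes>\<^sub>M L))"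
      using B by (subst \<mu>L.integral_fst'[symmetric]) (auto intro!: \<mu>L.integrable_const_bound[of _ B])
    also have "\<dots> = (\<integral>x. \<phi> x \<partial>?N)" by (rule integral_distr[symmetric]) auto
    finally show "(\<integral>x. \<phi> x \<partial>L) = (\<integral>x. \<phi> x \<partial>?N)" .
  qed (simp_all add: L(2))
  then have "\<forall>A\<in>sets borel. emeasure L A = (\<integral>\<^sup>+g. emeasure L (\<alpha> g -` A) \<partial>\<mu>)"
    using emeasure_action[OF L] by metis
  ultimately show ?thesis using L by (auto simp: stat_def)
qed

definition reflected :: "'a measure" where
  "reflected = distr \<mu> (count_space (carrier G)) (\<lambda>g. inv g)"

lemma measurable_inv [measurable]: "(\<lambda>g. inv g) \<in> measurable \<mu> (count_space (carrier G))"
  by (auto simp: measurable_def space_\<mu> sets_\<mu>)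

lemma boundary_walk_reflected: "boundary_walk G reflected d \<iota> \<alpha> S"
proof (intro boundary_walk.intro boundary_walk_axioms.intro random_walk.intro random_walk_axioms.intro)
  show "prob_space reflected" unfolding reflected_def by (rule \<mu>.prob_space_distr) simp
  fix F :: "'b set" assume F: "finite F" "F \<noteq> {}" "F \<subseteq> bdry"
  then obtain g where g: "g \<in> carrier G" "emeasure \<mu> {g} \<noteq> 0" "\<alpha> g ` F \<noteq> F"
    using no_finite_invariant by blast
  have "emeasure reflected {inv g} = emeasure \<mu> ((\<lambda>g. inv g) -` {inv g} \<inter> space \<mu>)"
    unfolding reflected_def using g by (intro emeasure_distr) auto
  also have "(\<lambda>g. inv g) -` {inv g} \<inter> space \<mu> = {g}" using g by (auto simp: space_\<mu>)
  finally have "emeasure reflected {inv g} \<noteq> 0" using g by simp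
  moreover have "\<alpha> (inv g) ` F \<noteq> F"
  proof
    assume "\<alpha> (inv g) ` F = F"
    then have "\<alpha> g ` F = \<alpha> g ` \<alpha> (inv g) ` F" by simp
    also have "\<dots> = F" using g(1) by (simp add: image_image)
    finally show False using g(3) by simp
  qed
  ultimately show "\<exists>g\<in>carrier G. emeasure reflected {g} \<noteq> 0 \<and> \<alpha> g ` F \<noteq> F"
    using g(1) by (intro bexI[of _ "inv g"]) auto
qed (use countable_carrier bdry_nonempty in \<open>auto simp: reflected_def intro: is_group boundary_action_axioms\<close>)

text \<open>The measure \<open>M\<close> is stationary for the walk with inverse increments.  Such a measure compensates the
  first increment of the walk: see \<open>nn_expect_meets\<close>.\<close>

lemma reflected_stationary_exists:
  obtains M where "prob_space M" "sets M = sets borel" "\<And>b. measure M {b} = 0" "AE b in M. b \<in> bdry"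
    "\<And>\<phi>. \<phi> \<in> borel_measurable borel \<Longrightarrow>
      (\<integral>\<^sup>+b. \<phi> b \<partial>M) = (\<integral>\<^sup>+g. \<integral>\<^sup>+b. \<phi> (\<alpha> (inv g) b) \<partial>M \<partial>\<mu>)"
proof -
  interpret R: boundary_walk G reflected d \<iota> \<alpha> S by (rule boundary_walk_reflected)
  obtain M where M: "R.stat M" using R.stat_exists by blast
  show ?thesis
  proof (rule that)
    fix \<phi> :: "'b \<Rightarrow> ennreal" assume \<phi>: "\<phi> \<in> borel_measurable borel"
    have "(\<integral>\<^sup>+b. \<phi> b \<partial>M) = (\<integral>\<^sup>+g. \<integral>\<^sup>+b. \<phi> (\<alpha> g b) \<partial>M \<partial>reflected)"
      using M \<phi> by (rule R.stat_nn_integral)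
    also have "\<dots> = (\<integral>\<^sup>+g. \<integral>\<^sup>+b. \<phi> (\<alpha> (inv g) b) \<partial>M \<partial>\<mu>)"
      unfolding reflected_def by (intro nn_integral_distr) auto
    finally show "(\<integral>\<^sup>+b. \<phi> b \<partial>M) = (\<integral>\<^sup>+g. \<integral>\<^sup>+b. \<phi> (\<alpha> (inv g) b) \<partial>M \<partial>\<mu>)" .
  qed (use M R.stat_no_atoms[OF M] R.AE_stat_bdry[OF M] in \<open>auto simp: R.stat_def\<close>)
qed

end

context boundary_action
begin

lemma meets_eq:
  assumes M: "prob_space M" "sets M = sets borel" and L: "prob_space L" "sets L = sets borel"
    and K: "K \<subseteq> carrier G" and g: "g \<in> carrier G"
  shows "ennreal (meets M L K g) = (\<integral>\<^sup>+b. emeasure M (\<alpha> (inv g) -` {a. (a, b) \<in> strip_pairs K}) \<partial>L)"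
    and "(\<lambda>b. emeasure M (\<alpha> (inv g) -` {a. (a, b) \<in> strip_pairs K})) \<in> borel_measurable L"
proof -
  interpret M: prob_space M by fact
  interpret L: prob_space L by fact
  interpret pair: pair_prob_space M L ..
  note [measurable_cong] = M(2) L(2)
  let ?A = "{p. (\<alpha> (inv g) (fst p), snd p) \<in> strip_pairs K}"
  have [measurable]: "inv g \<in> carrier G" using g by simp
  have "(\<lambda>p. (\<alpha> (inv g) (fst p), snd p)) \<in> measurable (M \<Otimes>\<^sub>M L) (borel \<Otimes>\<^sub>M borel)"
    by measurable
  from measurable_sets[OF this measurable_strip_pairs[OF K]]
  have A: "?A \<in> sets (M \<Otimes>\<^sub>M L)"
    using sets_eq_imp_space_eq[OF M(2)] sets_eq_imp_space_eq[OF L(2)]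
    by (simp add: vimage_def space_pair_measure)
  have eq: "(\<lambda>a. (a, b)) -` ?A = \<alpha> (inv g) -` {a. (a, b) \<in> strip_pairs K}" for b by auto
  have "ennreal (meets M L K g) = emeasure (M \<Otimes>\<^sub>M L) ?A"
    by (simp add: meets_def pair.emeasure_eq_measure)
  also have "\<dots> = (\<integral>\<^sup>+b. emeasure M ((\<lambda>a. (a, b)) -` ?A) \<partial>L)"
    by (rule pair.emeasure_pair_measure_alt2[OF A])
  finally show "ennreal (meets M L K g) = (\<integral>\<^sup>+b. emeasure M (\<alpha> (inv g) -` {a. (a, b) \<in> strip_pairs K}) \<partial>L)"
    by (simp only: eq)
  show "(\<lambda>b. emeasure M (\<alpha> (inv g) -` {a. (a, b) \<in> strip_pairs K})) \<in> borel_measurable L"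
    using pair.measurable_emeasure_Pair2[OF A] by (simp only: eq)
qed

lemma strip_pairs_section [measurable]:
  assumes "K \<subseteq> carrier G"
  shows "{a. (a, b) \<in> strip_pairs K} \<in> sets borel"
  using sets_Pair2[OF measurable_strip_pairs[OF assms], of b] by (simp add: vimage_def)

lemma meets_bounds: "prob_space M \<Longrightarrow> prob_space L \<Longrightarrow> 0 \<le> meets M L K g \<and> meets M L K g \<le> 1"
proof -
  assume "prob_space M" "prob_space L"
  then interpret pair: pair_prob_space M L
    by (simp add: pair_prob_space_def pair_sigma_finite_def prob_space_imp_sigma_finite)
  show ?thesis by (simp add: meets_def)
qed

text \<open>An infinite set of elements preserving a measure would contain a sequence converging to the
  boundary; the strips would then force the measure to concentrate at the limit point.\<close>

lemma no_invariant_measure: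
  assumes L: "prob_space L" "sets L = sets borel" "\<And>b. measure L {b} = 0" "AE b in L. b \<in> bdry"
    and I: "I \<subseteq> carrier G" "infinite I"
    and inv: "\<And>g A. g \<in> I \<Longrightarrow> A \<in> sets borel \<Longrightarrow> emeasure L (\<alpha> g -` A) = emeasure L A"
  shows False
proof -
  interpret L: prob_space L by fact
  obtain u :: "nat \<Rightarrow> 'a" where u: "inj u" "range u \<subseteq> I"
    using infinite_countable_subset[OF I(2)] by blast
  obtain r b0 where r: "strict_mono r" "((\<lambda>n. \<iota> (u n)) \<circ> r) \<longlonglongrightarrow> b0" by (rule convergent_subsequence)
  define g where "g n = u (r n)" for n
  have g: "range g \<subseteq> carrier G" "g n \<in> I" "(\<lambda>n. \<iota> (g n)) \<longlonglongrightarrow> b0" for n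
    using u I r by (auto simp: g_def o_def)
  have "inj g"
    using inj_compose[OF u(1) strict_mono_imp_inj_on[OF r(1)]] by (simp add: g_def[abs_def] o_def)
  have b0: "b0 \<in> bdry"
  proof (rule limit_in_bdry[OF g(3) _ g(1)])
    fix x
    have "finite {n. g n = x}"
      using finite_vimageI[OF _ \<open>inj g\<close>, of "{x}"] by (simp add: vimage_def)
    then obtain N where "\<forall>n\<in>{n. g n = x}. n < N" using finite_nat_set_iff_bounded by metis
    then show "eventually (\<lambda>n. g n \<noteq> x) sequentially"
      unfolding eventually_sequentially by (intro exI[of _ N]) auto
  qed
  obtain K where K: "finite K" "K \<subseteq> carrier G" "1 - 1/4 < meets L L K \<one>"
    using meets_most[OF L L(1,2,4), of "1/4"] by auto
  have meets_inv: "meets L L K h = meets L L K \<one>" if h: "h \<in> I" for h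
  proof -
    have hG: "h \<in> carrier G" using h I by auto
    have inv': "emeasure L (\<alpha> (inv h) -` A) = emeasure L A" if A: "A \<in> sets borel" for A
    proof -
      have "\<alpha> (inv h) -` A \<in> sets borel"
        using measurable_sets[OF measurable_\<alpha>[OF inv_closed[OF hG]] A] by simp
      from inv[OF h this] show ?thesis using hG by (simp add: vimage_def)
    qed
    have "ennreal (meets L L K h) = (\<integral>\<^sup>+b. emeasure L (\<alpha> (inv h) -` {a. (a, b) \<in> strip_pairs K}) \<partial>L)"
      by (rule meets_eq(1)[OF L(1,2) L(1,2) K(2) hG])
    also have "\<dots> = (\<integral>\<^sup>+b. emeasure L {a. (a, b) \<in> strip_pairs K} \<partial>L)"
      by (simp only: inv'[OF strip_pairs_section[OF K(2)]])
    also have "\<dots> = ennreal (meets L L K \<one>)"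
      using meets_eq(1)[OF L(1,2) L(1,2) K(2) one_closed] by (simp add: vimage_def)
    finally have "ennreal (meets L L K h) = ennreal (meets L L K \<one>)" .
    then show ?thesis using meets_bounds[OF L(1) L(1)] by simp
  qed
  obtain \<delta> where \<delta>: "0 < \<delta>" "\<And>y. measure L {x. d x y < \<delta>} \<le> 1/4"
    using uniformly_small_balls[OF L(1-3), of "1/4"] by auto
  have "b0 \<in> {y. d y b0 < \<delta>}" using \<delta>(1) by simp
  from meets_estimate[OF L(1-3) L(1,2) g(1,3) b0 K(1,2) open_ball_d this, of "1/4"]
  have "eventually (\<lambda>n. meets L L K (g n) \<le> measure L {b. \<alpha> (g n) b \<in> {y. d y b0 < \<delta>}} + 1/4) sequentially"
    by simp
  then obtain n where "meets L L K (g n) \<le> measure L {b. \<alpha> (g n) b \<in> {y. d y b0 < \<delta>}} + 1/4"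
    by (auto dest: eventually_happens)
  also have "{b. \<alpha> (g n) b \<in> {y. d y b0 < \<delta>}} = \<alpha> (g n) -` {y. d y b0 < \<delta>}" by auto
  also have "measure L (\<alpha> (g n) -` {y. d y b0 < \<delta>}) = measure L {y. d y b0 < \<delta>}"
    using inv[OF g(2)[of n], of "{y. d y b0 < \<delta>}"] open_ball_d by (simp add: measure_def)
  finally show False using \<delta>(2)[of b0] K(3) meets_inv[OF g(2)[of n]] by simp
qed

end

context boundary_walk
begin

lemma countable_nonsingular: "stat L \<Longrightarrow> countable (nonsingular L)"
  using countable_carrier by (auto simp: nonsingular_def intro: countable_subset)

lemma nonsingular_carrier: "stat L \<Longrightarrow> nonsingular L \<subseteq> carrier G"
  by (auto simp: nonsingular_def)

lemma nonsingular_one: "stat L \<Longrightarrow> \<one> \<in> nonsingular L"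
  by (simp add: nonsingular_def vimage_def)

lemma nonsingular_mult:
  assumes L: "stat L" and kl: "k \<in> nonsingular L" "l \<in> nonsingular L"
  shows "k \<otimes> l \<in> nonsingular L"
proof -
  have G: "k \<in> carrier G" "l \<in> carrier G" using kl nonsingular_carrier[OF L] by auto
  have "emeasure L (\<alpha> (k \<otimes> l) -` A) = 0" if A: "A \<in> sets borel" "emeasure L A = 0" for A
  proof -
    have "emeasure L (\<alpha> k -` A) = 0" using kl(1) A by (simp add: nonsingular_def[OF L])
    then have "emeasure L (\<alpha> l -` (\<alpha> k -` A)) = 0"
      using kl(2) vimage_\<alpha>[OF G(1) A(1)] by (simp add: nonsingular_def[OF L])
    also have "\<alpha> l -` (\<alpha> k -` A) = \<alpha> (k \<otimes> l) -` A" using G by (auto simp: \<alpha>_mult)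
    finally show ?thesis .
  qed
  then show ?thesis using G by (simp add: nonsingular_def[OF L])
qed

lemma nonsingular_support:
  assumes L: "stat L" and g: "g \<in> carrier G" "emeasure \<mu> {g} \<noteq> 0"
  shows "g \<in> nonsingular L"
proof -
  have "emeasure L (\<alpha> g -` A) = 0" if A: "A \<in> sets borel" "emeasure L A = 0" for A
  proof -
    have "(\<integral>\<^sup>+g. emeasure L (\<alpha> g -` A) \<partial>\<mu>) = 0" using L A by (simp add: stat_def)
    then have "AE g in \<mu>. emeasure L (\<alpha> g -` A) = 0" by (simp add: nn_integral_0_iff_AE)
    from AE_\<mu>D[OF this g] show ?thesis .
  qed
  then show ?thesis using g by (simp add: nonsingular_def[OF L])
qed

lemma nonsingular_AE:
  assumes L: "stat L" and k: "k \<in> nonsingular L" and Q: "AE b in L. Q b"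
  shows "AE b in L. Q (\<alpha> k b)"
proof -
  have kG: "k \<in> carrier G" using k nonsingular_carrier[OF L] by auto
  from Q obtain N where N: "{b \<in> space L. \<not> Q b} \<subseteq> N" "emeasure L N = 0" "N \<in> sets L" by (rule AE_E)
  then have NB: "N \<in> sets borel" using sets_stat[OF L] by simp
  have "emeasure L (\<alpha> k -` N) = 0" using k NB N(2) by (simp add: nonsingular_def[OF L])
  then show ?thesis
    using N(1) vimage_\<alpha>[OF kG NB] space_stat[OF L] sets_stat[OF L]
    by (intro AE_I[of _ _ "\<alpha> k -` N"]) auto
qed

lemma AE_increments_support: "AE h in increments. \<forall>i. emeasure \<mu> {h i} \<noteq> 0"
proof -
  have "AE s in \<mu>. emeasure \<mu> {s} \<noteq> 0"
  proof -
    have "AE s in \<mu>. \<forall>g\<in>{g \<in> carrier G. emeasure \<mu> {g} = 0}. s \<noteq> g"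
      unfolding AE_ball_countable[OF countable_subset[OF _ countable_carrier, of "{g \<in> carrier G. emeasure \<mu> {g} = 0}", simplified]]
      by (auto intro!: AE_I[of _ _ "{g}" for g] simp: sets_\<mu>)
    with AE_space show ?thesis by eventually_elim (auto simp: space_\<mu>)
  qed
  then show ?thesis unfolding AE_all_countable using prob_\<mu> by (intro allI AE_PiM_component) auto
qed

lemma AE_walk_nonsingular:
  assumes L: "stat L"
  shows "AE h in increments. \<forall>n. walk G \<one> h n \<in> nonsingular L"
  using AE_increments_support AE_increments_carrier
proof eventually_elim
  case (elim h)
  show ?case
  proof
    fix n show "walk G \<one> h n \<in> nonsingular L"
    proof (induction n)
      case (Suc n)
      then show ?case
        using nonsingular_mult[OF L _ nonsingular_support[OF L], of _ "h n"] elim by (simp add: walk.simps(2))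
    qed (simp add: nonsingular_one[OF L])
  qed
qed

text \<open>If the walk returned to \<open>g\<close> infinitely often, all the harmonic functions \<open>y \<mapsto> L (\<alpha> y -` A)\<close>
  would have no energy at \<open>g\<close>, so \<open>L\<close> would be invariant under the support of \<open>\<mu>\<close>.\<close>

lemma transient:
  assumes L: "stat L" and g: "g \<in> carrier G"
  shows "AE h in increments. eventually (\<lambda>n. walk G \<one> h n \<noteq> g) sequentially"
proof (rule ccontr)
  assume recurrent: "\<not> ?thesis"
  interpret L: prob_space L using L by (simp add: stat_def)
  define I where "I = {k \<in> carrier G. \<forall>A\<in>sets borel. emeasure L (\<alpha> k -` A) = emeasure L A}"
  have supp: "s \<in> I" if s: "s \<in> carrier G" "emeasure \<mu> {s} \<noteq> 0" for s
  proof -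
    have "measure L (\<alpha> s -` A) = measure L A" if A: "A \<in> sets borel" for A
    proof -
      define C where "C = \<alpha> (inv g) -` A"
      have C: "C \<in> sets borel" using A g by (simp add: C_def)
      define f where "f y = (\<integral>b. indicat_real C (\<alpha> y b) \<partial>L)" for y
      have f: "bounded_by 1 f" "harmonic f"
        using stat_harmonic[OF L, of "indicat_real C" 1] C by (auto simp: f_def[abs_def] indicator_def)
      have f_eq: "f y = measure L (\<alpha> y -` C)" for y
      proof -
        have "f y = (\<integral>b. indicat_real (\<alpha> y -` C) b \<partial>L)"
          unfolding f_def by (intro Bochner_Integration.integral_cong refl) (auto simp: indicator_def)
        then show ?thesis by (simp add: space_stat[OF L])
      qed
      have "energy f g = 0"
        using finitely_many_visits[OF f one_closed g] recurrent by blast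
      moreover have "integrable \<mu> (\<lambda>s. (f (g \<otimes> s) - f g)\<^sup>2)"
        by (rule integrable_\<mu>[OF bounded_by_square[OF bounded_by_translate[OF bounded_by_diff[OF f(1) g] g]]])
      ultimately have "AE s in \<mu>. (f (g \<otimes> s) - f g)\<^sup>2 = 0"
        unfolding energy_def by (subst (asm) integral_nonneg_eq_0_iff_AE) auto
      from AE_\<mu>D[OF this s] have "f (g \<otimes> s) = f g" by simp
      moreover have "\<alpha> (g \<otimes> s) -` C = \<alpha> s -` A" "\<alpha> g -` C = A"
        using g s by (auto simp: C_def \<alpha>_mult)
      ultimately show ?thesis by (simp add: f_eq)
    qed
    then show ?thesis using s by (simp add: I_def L.emeasure_eq_measure)
  qed
  have I: "I \<subseteq> carrier G" "\<one> \<in> I" by (auto simp: I_def vimage_def)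
  have mult: "k \<otimes> l \<in> I" if kl: "k \<in> I" "l \<in> I" for k l
  proof -
    have G: "k \<in> carrier G" "l \<in> carrier G" using kl I by auto
    have "emeasure L (\<alpha> (k \<otimes> l) -` A) = emeasure L A" if A: "A \<in> sets borel" for A
    proof -
      have "\<alpha> (k \<otimes> l) -` A = \<alpha> l -` (\<alpha> k -` A)" using G by (auto simp: \<alpha>_mult)
      then show ?thesis using kl A vimage_\<alpha>[OF G(1) A] by (simp add: I_def)
    qed
    then show ?thesis using G by (simp add: I_def)
  qed
  obtain b where "b \<in> bdry" using bdry_nonempty by auto
  from orbits_infinite[OF I mult supp this] have "infinite I" by auto
  moreover have "emeasure L (\<alpha> k -` A) = emeasure L A" if "k \<in> I" "A \<in> sets borel" for k A
    using that by (simp add: I_def)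
  ultimately show False
    by (rule no_invariant_measure[OF L.prob_space_axioms sets_stat[OF L] stat_no_atoms[OF L]
          AE_stat_bdry[OF L] I(1)])
qed

text \<open>The position at time \<open>Suc n\<close> is distributed as \<open>s \<otimes> y\<close>, with \<open>s\<close> distributed according to \<open>\<mu>\<close> and with an
  independent position \<open>y\<close> at time \<open>n\<close>.  The average over \<open>s\<close> replaces \<open>M\<close> by the average of its images
  under the inverses of \<open>s\<close>, which is \<open>M\<close>.\<close>

lemma nn_expect_meets:
  assumes M: "prob_space M" "sets M = sets borel"
      "\<And>\<phi>. \<phi> \<in> borel_measurable borel \<Longrightarrow> (\<integral>\<^sup>+b. \<phi> b \<partial>M) = (\<integral>\<^sup>+g. \<integral>\<^sup>+b. \<phi> (\<alpha> (inv g) b) \<partial>M \<partial>\<mu>)"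
    and L: "prob_space L" "sets L = sets borel" and K: "K \<subseteq> carrier G"
  shows "(\<integral>\<^sup>+h. ennreal (meets M L K (walk G \<one> h n)) \<partial>increments) = ennreal (meets M L K \<one>)"
proof -
  interpret M: prob_space M by fact
  interpret L: prob_space L by fact
  interpret \<mu>L: pair_prob_space \<mu> L ..
  interpret \<mu>P: pair_prob_space \<mu> increments ..
  note [measurable_cong] = M(2) L(2)
  let ?m = "\<lambda>y. ennreal (meets M L K y)"
  let ?E = "\<lambda>b. {a. (a, b) \<in> strip_pairs K}"
  have step: "(\<integral>\<^sup>+s. ?m (s \<otimes> y) \<partial>\<mu>) = ?m y" if y: "y \<in> carrier G" for y
  proof -
    have m1: "?m (s \<otimes> y) = (\<integral>\<^sup>+b. emeasure M (\<alpha> (inv (s \<otimes> y)) -` ?E b) \<partial>L)" if "s \<in> carrier G" for s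
      using meets_eq(1)[OF M(1,2) L K, of "s \<otimes> y"] that y by simp
    have mE: "(\<lambda>p. emeasure M (\<alpha> (inv (fst p \<otimes> y)) -` ?E (snd p))) \<in> borel_measurable (\<mu> \<Otimes>\<^sub>M L)"
    proof -
      have "(\<lambda>p. emeasure M (\<alpha> (inv (s \<otimes> y)) -` ?E (snd p))) \<in> borel_measurable (\<mu> \<Otimes>\<^sub>M L)"
        if "s \<in> carrier G" for s
        by (rule measurable_compose[OF measurable_snd meets_eq(2)[OF M(1,2) L K]]) (use that y in simp)
      moreover have "fst \<in> measurable (\<mu> \<Otimes>\<^sub>M L) (count_space (carrier G))"
        using measurable_fst[of \<mu> L] by (simp add: measurable_cong_sets[OF refl sets_\<mu>_count])
      ultimately show ?thesis
        by (rule measurable_compose_countable'[where I = "carrier G"]) (simp_all add: countable_carrier)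
    qed
    have "(\<integral>\<^sup>+s. ?m (s \<otimes> y) \<partial>\<mu>) = (\<integral>\<^sup>+s. \<integral>\<^sup>+b. emeasure M (\<alpha> (inv (s \<otimes> y)) -` ?E b) \<partial>L \<partial>\<mu>)"
      using m1 by (intro nn_integral_cong) (simp add: space_\<mu>)
    also have "\<dots> = (\<integral>\<^sup>+b. \<integral>\<^sup>+s. emeasure M (\<alpha> (inv (s \<otimes> y)) -` ?E b) \<partial>\<mu> \<partial>L)"
      by (rule \<mu>L.Fubini'[symmetric]) (simp only: case_prod_unfold mE)
    also have "\<dots> = (\<integral>\<^sup>+b. emeasure M (\<alpha> (inv y) -` ?E b) \<partial>L)"
    proof (intro nn_integral_cong)
      fix b
      let ?A = "\<alpha> (inv y) -` ?E b"
      have A: "?A \<in> sets borel" by (rule vimage_\<alpha>[OF inv_closed[OF y] strip_pairs_section[OF K]])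
      have "(\<integral>\<^sup>+s. emeasure M (\<alpha> (inv (s \<otimes> y)) -` ?E b) \<partial>\<mu>) = (\<integral>\<^sup>+s. \<integral>\<^sup>+a. indicator ?A (\<alpha> (inv s) a) \<partial>M \<partial>\<mu>)"
      proof (intro nn_integral_cong)
        fix s assume "s \<in> space \<mu>"
        then have s: "s \<in> carrier G" by (simp add: space_\<mu>)
        then have eq: "\<alpha> (inv (s \<otimes> y)) -` ?E b = \<alpha> (inv s) -` ?A"
          using y by (auto simp: inv_mult_group \<alpha>_mult)
        have "\<alpha> (inv s) -` ?A \<in> sets M" unfolding M(2) by (rule vimage_\<alpha>[OF inv_closed[OF s] A])
        then have "emeasure M (\<alpha> (inv s) -` ?A) = (\<integral>\<^sup>+a. indicator (\<alpha> (inv s) -` ?A) a \<partial>M)"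
          by (rule nn_integral_indicator[symmetric])
        also have "\<dots> = (\<integral>\<^sup>+a. indicator ?A (\<alpha> (inv s) a) \<partial>M)"
          by (intro nn_integral_cong) (auto simp: indicator_def)
        finally show "emeasure M (\<alpha> (inv (s \<otimes> y)) -` ?E b) = (\<integral>\<^sup>+a. indicator ?A (\<alpha> (inv s) a) \<partial>M)"
          by (simp only: eq)
      qed
      also have "\<dots> = (\<integral>\<^sup>+a. indicator ?A a \<partial>M)"
        by (rule M(3)[symmetric]) (rule borel_measurable_indicator[OF A])
      also have "\<dots> = emeasure M ?A"
        by (rule nn_integral_indicator) (simp only: M(2) A)
      finally show "(\<integral>\<^sup>+s. emeasure M (\<alpha> (inv (s \<otimes> y)) -` ?E b) \<partial>\<mu>) = emeasure M ?A" .
    qed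
    also have "\<dots> = ?m y" by (rule meets_eq(1)[OF M(1,2) L K y, symmetric])
    finally show ?thesis .
  qed
  show ?thesis
  proof (induction n)
    case 0
    then show ?case by (simp add: inc.P.emeasure_space_1)
  next
    case (Suc n)
    have [measurable]: "(\<lambda>h. ?m (walk G \<one> h k)) \<in> borel_measurable increments" for k
      by (rule borel_measurable_walk) simp
    have mW: "(\<lambda>p. ?m (fst p \<otimes> walk G \<one> (snd p) n)) \<in> borel_measurable (\<mu> \<Otimes>\<^sub>M increments)"
    proof -
      have "(\<lambda>p. ?m (s \<otimes> walk G \<one> (snd p) n)) \<in> borel_measurable (\<mu> \<Otimes>\<^sub>M increments)" for s
        by (rule measurable_compose[OF measurable_snd borel_measurable_walk[of \<one> "\<lambda>y. ?m (s \<otimes> y)" n]]) simp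
      moreover have "fst \<in> measurable (\<mu> \<Otimes>\<^sub>M increments) (count_space (carrier G))"
        using measurable_fst[of \<mu> increments] by (simp add: measurable_cong_sets[OF refl sets_\<mu>_count])
      ultimately show ?thesis
        by (rule measurable_compose_countable'[where I = "carrier G"]) (simp_all add: countable_carrier)
    qed
    have "(\<integral>\<^sup>+h. ?m (walk G \<one> h (Suc n)) \<partial>increments) =
        (\<integral>\<^sup>+s. \<integral>\<^sup>+h. ?m (walk G \<one> (case_nat s h) (Suc n)) \<partial>increments \<partial>\<mu>)"
      by (rule nn_integral_first_step) simp
    also have "\<dots> = (\<integral>\<^sup>+s. \<integral>\<^sup>+h. ?m (s \<otimes> walk G \<one> h n) \<partial>increments \<partial>\<mu>)"
    proof (intro nn_integral_cong)
      fix s h assume "s \<in> space \<mu>" and h: "h \<in> space increments"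
      then have s: "s \<in> carrier G" by (simp add: space_\<mu>)
      show "?m (walk G \<one> (case_nat s h) (Suc n)) = ?m (s \<otimes> walk G \<one> h n)"
        using walk_left[OF s one_closed h, of n] s by (simp add: walk_Suc_first)
    qed
    also have "\<dots> = (\<integral>\<^sup>+h. \<integral>\<^sup>+s. ?m (s \<otimes> walk G \<one> h n) \<partial>\<mu> \<partial>increments)"
      by (rule \<mu>P.Fubini'[symmetric]) (simp only: case_prod_unfold mW)
    also have "\<dots> = (\<integral>\<^sup>+h. ?m (walk G \<one> h n) \<partial>increments)"
      using step walk_closed by (intro nn_integral_cong) auto
    finally show ?case using Suc by simp
  qed
qed

end

section \<open>Convergence to the boundary\<close>

lemma (in compact_metrizable) basis_regular:
  assumes "open U" "x \<in> U"
  obtains j where "x \<in> basis j" "closure (basis j) \<subseteq> U"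
proof -
  obtain r where r: "0 < r" "{y. d y x < r} \<subseteq> U" by (rule open_contains_ball_d[OF assms])
  obtain B where "B \<in> range basis" "x \<in> B" "B \<subseteq> {y. d y x < r / 2}"
    using topological_basisE[OF basis open_ball_d, of x x "r / 2"] r by auto
  then obtain j where j: "x \<in> basis j" "basis j \<subseteq> {y. d y x < r / 2}" by auto
  have "closed {y. d y x \<le> r / 2}"
    by (intro closed_Collect_le continuous_on_d continuous_on_id continuous_on_const)
  then have "closure (basis j) \<subseteq> {y. d y x \<le> r / 2}" using j(2) by (intro closure_minimal) auto
  then have "closure (basis j) \<subseteq> U" using r by force
  then show ?thesis using that j(1) by blast
qed

lemma (in compact_metrizable) measurable_pointwise_limit:
  fixes u :: "nat \<Rightarrow> 'c \<Rightarrow> 'b"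
  assumes [measurable]: "\<And>n. u n \<in> borel_measurable M"
    and lim: "\<And>x. x \<in> space M \<Longrightarrow> (\<lambda>n. u n x) \<longlonglongrightarrow> v x"
  shows "v \<in> borel_measurable M"
proof (rule borel_measurableI)
  fix U :: "'b set" assume U: "open U"
  have [measurable]: "basis j \<in> sets borel" for j using open_basis[of j] by auto
  have "v x \<in> U \<longleftrightarrow> (\<exists>j\<in>{j. closure (basis j) \<subseteq> U}. \<exists>N. \<forall>n\<ge>N. u n x \<in> basis j)" if x: "x \<in> space M" for x
  proof
    assume "v x \<in> U"
    then obtain j where "v x \<in> basis j" "closure (basis j) \<subseteq> U" by (rule basis_regular[OF U])
    then show "\<exists>j\<in>{j. closure (basis j) \<subseteq> U}. \<exists>N. \<forall>n\<ge>N. u n x \<in> basis j"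
      using topological_tendstoD[OF lim[OF x] open_basis, of j] by (auto simp: eventually_sequentially)
  next
    assume "\<exists>j\<in>{j. closure (basis j) \<subseteq> U}. \<exists>N. \<forall>n\<ge>N. u n x \<in> basis j"
    then obtain j N where j: "closure (basis j) \<subseteq> U" "\<forall>n\<ge>N. u n x \<in> basis j" by auto
    have "eventually (\<lambda>n. u n x \<in> closure (basis j)) sequentially"
      unfolding eventually_sequentially using j(2) closure_subset[of "basis j"] by blast
    then have "v x \<in> closure (basis j)"
      using Lim_in_closed_set[OF closed_closure _ _ lim[OF x]] by auto
    then show "v x \<in> U" using j by auto
  qed
  then have "v -` U \<inter> space M =
      {x \<in> space M. \<exists>j\<in>{j. closure (basis j) \<subseteq> U}. \<exists>N. \<forall>n\<ge>N. u n x \<in> basis j}"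
    by auto
  also have "\<dots> \<in> sets M" by measurable
  finally show "v -` U \<inter> space M \<in> sets M" .
qed

lemma (in compact_metrizable) convergent_iff_Cauchy_d:
  fixes u :: "nat \<Rightarrow> 'b"
  shows "(\<exists>l. u \<longlonglongrightarrow> l) \<longleftrightarrow> (\<forall>k. \<exists>N. \<forall>m\<ge>N. \<forall>n\<ge>N. d (u m) (u n) < 1 / real (Suc k))"
proof
  assume "\<exists>l. u \<longlonglongrightarrow> l"
  then obtain l where l: "u \<longlonglongrightarrow> l" ..
  show "\<forall>k. \<exists>N. \<forall>m\<ge>N. \<forall>n\<ge>N. d (u m) (u n) < 1 / real (Suc k)"
  proof
    fix k
    have "(\<lambda>n. d (u n) l) \<longlonglongrightarrow> 0" using l by (simp only: tendsto_iff_d[symmetric])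
    then have "eventually (\<lambda>n. d (u n) l < 1 / real (Suc k) / 2) sequentially"
      by (rule order_tendstoD) simp
    then obtain N where N: "\<And>n. n \<ge> N \<Longrightarrow> d (u n) l < 1 / real (Suc k) / 2"
      by (auto simp: eventually_sequentially)
    have "d (u m) (u n) < 1 / real (Suc k)" if "m \<ge> N" "n \<ge> N" for m n
      using N[OF that(1)] N[OF that(2)] d_triangle[of "u m" "u n" l] d_commute[of l "u n"] by linarith
    then show "\<exists>N. \<forall>m\<ge>N. \<forall>n\<ge>N. d (u m) (u n) < 1 / real (Suc k)" by blast
  qed
next
  assume C: "\<forall>k. \<exists>N. \<forall>m\<ge>N. \<forall>n\<ge>N. d (u m) (u n) < 1 / real (Suc k)"
  obtain r l where r: "strict_mono r" "(u \<circ> r) \<longlonglongrightarrow> l" by (rule convergent_subsequence)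
  have "(\<lambda>n. d (u n) l) \<longlonglongrightarrow> 0"
  proof (rule LIMSEQ_I)
    fix e :: real assume "0 < e"
    then obtain k where k: "1 / real (Suc k) < e / 2" using nat_approx_posE[of "e / 2"] by auto
    from spec[OF C, of k] obtain N where N: "\<forall>m\<ge>N. \<forall>n\<ge>N. d (u m) (u n) < 1 / real (Suc k)" ..
    have "d (u n) l < e" if n: "n \<ge> N" for n
    proof -
      have "d (u n) l \<le> 1 / real (Suc k)"
      proof (rule LIMSEQ_le_const2[OF tendsto_d[OF tendsto_const r(2)]], intro exI allI impI)
        fix i assume "N \<le> i"
        then have "N \<le> r i" using seq_suble[OF r(1), of i] by simp
        then show "d (u n) ((u \<circ> r) i) \<le> 1 / real (Suc k)" using N n by (auto intro: less_imp_le)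
      qed
      then show ?thesis using k d_nonneg[of "u n" l] \<open>0 < e\<close> by linarith
    qed
    then show "\<exists>no. \<forall>n\<ge>no. norm (d (u n) l - 0) < e" using d_nonneg by auto
  qed
  then show "\<exists>l. u \<longlonglongrightarrow> l" by (auto simp: tendsto_iff_d[of u])
qed

context boundary_action
begin

text \<open>Paths that do not converge to the boundary are assigned an arbitrary fixed boundary point.\<close>

definition path_limit :: "(nat \<Rightarrow> 'a) \<Rightarrow> 'b" where
  "path_limit x = (if \<exists>z\<in>bdry. (\<lambda>n. \<iota> (x n)) \<longlonglongrightarrow> z then lim (\<lambda>n. \<iota> (x n)) else (SOME b. b \<in> bdry))"

lemma path_limit_eq: "(\<lambda>n. \<iota> (x n)) \<longlonglongrightarrow> z \<Longrightarrow> z \<in> bdry \<Longrightarrow> path_limit x = z"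
  using limI by (auto simp: path_limit_def)

lemma path_limit_in_bdry:
  assumes "bdry \<noteq> {}"
  shows "path_limit x \<in> bdry"
proof (cases "\<exists>z\<in>bdry. (\<lambda>n. \<iota> (x n)) \<longlonglongrightarrow> z")
  case True
  then show ?thesis using path_limit_eq[of x] by auto
next
  case False
  have "\<exists>b. b \<in> bdry" using assms by auto
  from someI_ex[OF this] show ?thesis using False by (simp add: path_limit_def)
qed

lemma measurable_path_limit: "path_limit \<in> borel_measurable (path_space G)"
proof -
  let ?M = "path_space G"
  have [measurable]: "(\<lambda>x. \<iota> (x n)) \<in> borel_measurable ?M" for n
    unfolding path_space_def
    by (rule measurable_compose[of "\<lambda>x. x n" _ "count_space (carrier G)"]) auto
  define C where "C = {x \<in> space ?M. \<exists>l. (\<lambda>n. \<iota> (x n)) \<longlonglongrightarrow> l}"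
  have C [measurable]: "C \<in> sets ?M" unfolding C_def convergent_iff_Cauchy_d by measurable
  define b where "b = (SOME b. b \<in> bdry)"
  define v where "v x = (if x \<in> C then lim (\<lambda>n. \<iota> (x n)) else b)" for x
  have [measurable]: "v \<in> borel_measurable ?M"
  proof (rule measurable_pointwise_limit)
    show "(\<lambda>x. if x \<in> C then \<iota> (x n) else b) \<in> borel_measurable ?M" for n by measurable
    show "(\<lambda>n. if x \<in> C then \<iota> (x n) else b) \<longlonglongrightarrow> v x" for x
      using limI by (auto simp: v_def C_def)
  qed
  have "path_limit x = (if v x \<in> bdry then v x else b)" if "x \<in> space ?M" for x
    using that limI by (auto simp: path_limit_def v_def C_def b_def)
  moreover have "(\<lambda>x. if v x \<in> bdry then v x else b) \<in> borel_measurable ?M" by measurable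
  ultimately show ?thesis by (subst measurable_cong) auto
qed

end

context boundary_walk
begin

context
  fixes L assumes L: "stat L"
begin

interpretation L: prob_space L using L by (simp add: stat_def)

lemmas [measurable_cong] = sets_stat[OF L]

abbreviation mean_dist :: "'a \<Rightarrow> 'b \<Rightarrow> real" where
  "mean_dist y z \<equiv> (\<integral>b. d (\<alpha> y b) z \<partial>L)"

lemma integrable_bounded_action:
  fixes \<phi> :: "'b \<Rightarrow> real"
  assumes \<phi>: "\<phi> \<in> borel_measurable borel" and y: "y \<in> carrier G" and B: "\<And>b. \<bar>\<phi> b\<bar> \<le> B"
  shows "integrable L (\<lambda>b. \<phi> (\<alpha> y b))"
proof (rule L.integrable_const_bound[of _ B])
  show "(\<lambda>b. \<phi> (\<alpha> y b)) \<in> borel_measurable L"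
    using measurable_compose[OF measurable_\<alpha>[OF y] \<phi>]
    by (simp add: measurable_cong_sets[OF sets_stat[OF L] refl])
qed (use B in auto)

lemma mean_dist_Lipschitz:
  assumes y: "y \<in> carrier G"
  shows "\<bar>mean_dist y z - mean_dist y z'\<bar> \<le> d z z'"
proof -
  have int: "integrable L (\<lambda>b. d (\<alpha> y b) z)" for z
    using y d_nonneg d_le_1 by (intro integrable_bounded_action[of "\<lambda>b. d b z" y 1]) auto
  have "\<bar>mean_dist y z - mean_dist y z'\<bar> = \<bar>\<integral>b. d (\<alpha> y b) z - d (\<alpha> y b) z' \<partial>L\<bar>"
    using int by simp
  also have "\<dots> \<le> (\<integral>b. \<bar>d (\<alpha> y b) z - d (\<alpha> y b) z'\<bar> \<partial>L)" by (rule integral_abs_bound)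
  also have "\<dots> \<le> (\<integral>b. d z z' \<partial>L)"
    using int d_Lipschitz by (intro integral_mono) auto
  finally show ?thesis by (simp add: L.prob_space)
qed

lemma mean_dist_le:
  assumes y: "y \<in> carrier G" and e: "0 \<le> e"
  shows "mean_dist y z \<le> e + (1 - measure L {b. d (\<alpha> y b) z < e})"
proof -
  define W where "W = {b. d (\<alpha> y b) z < e}"
  have W_eq: "W = \<alpha> y -` {x. d x z < e}" by (auto simp: W_def)
  have W: "W \<in> sets L"
    unfolding W_eq sets_stat[OF L] by (rule vimage_\<alpha>[OF y borel_open[OF open_ball_d]])
  then have int: "integrable L (indicat_real W)" by (simp add: less_top[symmetric])
  have "mean_dist y z \<le> (\<integral>b. e + (1 - indicat_real W b) \<partial>L)"
  proof (rule integral_mono)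
    show "integrable L (\<lambda>b. d (\<alpha> y b) z)"
      using y d_nonneg d_le_1 by (intro integrable_bounded_action[of "\<lambda>b. d b z" y 1]) auto
    show "integrable L (\<lambda>b. e + (1 - indicat_real W b))" using int by simp
    show "d (\<alpha> y b) z \<le> e + (1 - indicat_real W b)" for b
      using d_le_1[of "\<alpha> y b" z] e by (cases "b \<in> W") (simp_all add: W_def)
  qed
  also have "\<dots> = e + (1 - measure L W)"
    using int W L.prob_space by (simp add: space_stat[OF L])
  finally show ?thesis by (simp add: W_def)
qed

lemma AE_mean_dist_convergent:
  "AE h in increments. \<forall>z. convergent (\<lambda>n. mean_dist (walk G \<one> h n) z)"
proof -
  obtain D :: "'b set" where D: "countable D" "\<And>x r. 0 < r \<Longrightarrow> \<exists>z\<in>D. d z x < r"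
    using countable_dense_subset by blast
  have "AE h in increments. \<forall>z\<in>D. convergent (\<lambda>n. mean_dist (walk G \<one> h n) z)"
    unfolding AE_ball_countable[OF D(1)]
  proof
    fix z
    have "bounded_by 1 (\<lambda>y. mean_dist y z)" "harmonic (\<lambda>y. mean_dist y z)"
      using stat_harmonic[OF L, of "\<lambda>b. d b z" 1] d_nonneg d_le_1 by auto
    then show "AE h in increments. convergent (\<lambda>n. mean_dist (walk G \<one> h n) z)"
      by (rule harmonic_convergent) simp
  qed
  with AE_space show ?thesis
  proof eventually_elim
    case (elim h)
    show ?case
    proof
      fix z
      have "Cauchy (\<lambda>n. mean_dist (walk G \<one> h n) z)"
      proof (rule metric_CauchyI)
        fix e :: real assume "0 < e"
        then obtain z' where z': "z' \<in> D" "d z' z < e / 3" using D(2)[of "e / 3" z] by auto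
        then have "Cauchy (\<lambda>n. mean_dist (walk G \<one> h n) z')" using elim convergent_Cauchy by blast
        from metric_CauchyD[OF this, of "e / 3"] \<open>0 < e\<close>
        obtain N where N: "\<forall>m\<ge>N. \<forall>n\<ge>N.
            dist (mean_dist (walk G \<one> h m) z') (mean_dist (walk G \<one> h n) z') < e / 3"
          by auto
        have "dist (mean_dist (walk G \<one> h m) z) (mean_dist (walk G \<one> h n) z) < e"
          if "m \<ge> N" "n \<ge> N" for m n
          using N[rule_format, OF that] mean_dist_Lipschitz[OF walk_closed[OF one_closed elim(1)], of m z' z]
            mean_dist_Lipschitz[OF walk_closed[OF one_closed elim(1)], of n z' z] z'(2)
          unfolding dist_real_def by linarith
        then show "\<exists>N. \<forall>m\<ge>N. \<forall>n\<ge>N. dist (mean_dist (walk G \<one> h m) z) (mean_dist (walk G \<one> h n) z) < e"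
          by blast
      qed
      then show "convergent (\<lambda>n. mean_dist (walk G \<one> h n) z)" by (rule real_Cauchy_convergent)
    qed
  qed
qed

text \<open>The mean of \<open>meets M L (K j)\<close> along the walk is constant and larger than \<open>1 - (1/4)^j\<close>, so its value
  is at least \<open>1 - (1/2)^j\<close> at infinitely many times, except for paths of probability \<open>(1/2)^j\<close> at most.  Along a
  subsequence of such times that converges to \<open>b0\<close> the images of \<open>L\<close> have almost all their mass close
  to \<open>b0\<close>.  As the mean distance to \<open>b0\<close> converges along the whole path, its limit is small.\<close>

lemma AE_concentrates:
  "AE h in increments. \<exists>z\<in>bdry. (\<lambda>n. mean_dist (walk G \<one> h n) z) \<longlonglongrightarrow> 0"
proof -
  obtain M where M: "prob_space M" "sets M = sets borel" "\<And>b. measure M {b} = 0" "AE b in M. b \<in> bdry"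
    "\<And>\<phi>. \<phi> \<in> borel_measurable borel \<Longrightarrow>
      (\<integral>\<^sup>+b. \<phi> b \<partial>M) = (\<integral>\<^sup>+g. \<integral>\<^sup>+b. \<phi> (\<alpha> (inv g) b) \<partial>M \<partial>\<mu>)"
    by (rule reflected_stationary_exists) blast
  have L': "prob_space L" "sets L = sets borel" using L by (auto simp: stat_def)
  have "\<forall>j. \<exists>K. finite K \<and> K \<subseteq> carrier G \<and> 1 - (1/4)^j < meets M L K \<one>"
  proof
    fix j :: nat
    obtain K where "finite K" "K \<subseteq> carrier G" "1 - (1/4)^j < meets M L K \<one>"
      by (rule meets_most[OF M(1-4) L' AE_stat_bdry[OF L], of "(1/4)^j"]) auto
    then show "\<exists>K. finite K \<and> K \<subseteq> carrier G \<and> 1 - (1/4)^j < meets M L K \<one>" by blast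
  qed
  from choice[OF this] obtain K where K: "\<forall>j. finite (K j) \<and> K j \<subseteq> carrier G \<and> 1 - (1/4)^j < meets M L (K j) \<one>" ..
  define m where "m j y = meets M L (K j) y" for j y
  have m: "0 \<le> m j y" "m j y \<le> 1" for j y using meets_bounds[OF M(1) L'(1)] by (auto simp: m_def)
  have [measurable]: "(\<lambda>h. m j (walk G \<one> h n)) \<in> borel_measurable increments" for j n
    by (rule borel_measurable_walk) simp
  define E where "E j = {h \<in> space increments. \<exists>N. \<forall>n\<ge>N. m j (walk G \<one> h n) < 1 - (1/2)^j}" for j
  have E_sets [measurable]: "E j \<in> sets increments" for j unfolding E_def by measurable
  have E_le: "measure increments (E j) \<le> (1/2)^j" for j
  proof -
    define A where "A N = {h \<in> space increments. \<forall>n\<ge>N. m j (walk G \<one> h n) < 1 - (1/2)^j}" for N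
    have [measurable]: "A N \<in> sets increments" for N unfolding A_def by measurable
    have "(\<lambda>N. measure increments (A N)) \<longlonglongrightarrow> measure increments (\<Union>N. A N)"
    proof (rule inc.P.finite_Lim_measure_incseq)
      show "range A \<subseteq> sets increments" by auto
      show "incseq A" by (rule incseq_SucI) (auto simp: A_def)
    qed
    moreover have "(\<Union>N. A N) = E j" by (auto simp: A_def E_def)
    moreover have "measure increments (A N) \<le> (1/2)^j" for N
    proof -
      have int: "integrable increments (\<lambda>h. m j (walk G \<one> h N))"
        using m by (intro inc.P.integrable_const_bound[of _ 1]) auto
      have "ennreal (\<integral>h. m j (walk G \<one> h N) \<partial>increments) = (\<integral>\<^sup>+h. ennreal (m j (walk G \<one> h N)) \<partial>increments)"
        using m int by (intro nn_integral_eq_integral[symmetric]) auto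
      also have "\<dots> = ennreal (m j \<one>)"
        unfolding m_def using K by (intro nn_expect_meets[OF M(1,2,5) L']) auto
      finally have "(\<integral>h. m j (walk G \<one> h N) \<partial>increments) = m j \<one>"
        using m by (simp add: integral_nonneg_AE)
      then have "(\<integral>h. 1 - m j (walk G \<one> h N) \<partial>increments) = 1 - m j \<one>"
        using int by (simp add: inc.P.prob_space)
      moreover have "(1/2)^j * measure increments (A N) = (\<integral>h. (1/2)^j * indicator (A N) h \<partial>increments)"
        by simp
      moreover have "\<dots> \<le> (\<integral>h. 1 - m j (walk G \<one> h N) \<partial>increments)"
      proof (rule integral_mono)
        show "integrable increments (\<lambda>h. (1/2)^j * indicat_real (A N) h)"
          by (intro Bochner_Integration.integrable_mult_right integrable_real_indicator)
            (auto simp: less_top[symmetric])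
        show "integrable increments (\<lambda>h. 1 - m j (walk G \<one> h N))" using int by simp
        fix h
        show "(1/2)^j * indicat_real (A N) h \<le> 1 - m j (walk G \<one> h N)"
          using m[of j "walk G \<one> h N"] by (auto simp: A_def indicator_def intro: less_imp_le dest!: spec[of _ N])
      qed
      ultimately have "(1/2)^j * measure increments (A N) \<le> 1 - m j \<one>" by linarith
      also have "\<dots> \<le> (1/4)^j" using K[THEN spec, of j] by (simp add: m_def)
      also have "(1/4::real)^j = (1/2)^j * (1/2)^j" by (simp add: power_mult_distrib[symmetric])
      finally show ?thesis by simp
    qed
    ultimately show ?thesis by (intro LIMSEQ_le_const2[of "\<lambda>N. measure increments (A N)"]) auto
  qed
  have "AE h in increments. \<exists>j\<ge>i. h \<notin> E j" for i
  proof -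
    have "measure increments (\<Inter>j\<in>{i..}. E j) \<le> (1/2)^(i + n)" for n
    proof -
      have "measure increments (\<Inter>j\<in>{i..}. E j) \<le> measure increments (E (i + n))"
        by (intro inc.P.finite_measure_mono) auto
      then show ?thesis using E_le[of "i + n"] by linarith
    qed
    moreover have "(\<lambda>n. (1/2::real)^(i + n)) \<longlonglongrightarrow> 0"
      using LIMSEQ_ignore_initial_segment[OF LIMSEQ_power_zero[of "1/2::real"], of i] by (simp add: add.commute)
    ultimately have "measure increments (\<Inter>j\<in>{i..}. E j) \<le> 0"
      by (intro LIMSEQ_le_const[of "\<lambda>n. (1/2::real)^(i + n)"]) auto
    then have "emeasure increments (\<Inter>j\<in>{i..}. E j) = 0"
      by (simp add: inc.P.emeasure_eq_measure measure_le_0_iff)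
    then have "AE h in increments. h \<notin> (\<Inter>j\<in>{i..}. E j)"
      by (intro AE_not_in) (auto simp: null_sets_def)
    then show ?thesis by eventually_elim auto
  qed
  then have "AE h in increments. \<forall>i. \<exists>j\<ge>i. h \<notin> E j" unfolding AE_all_countable by blast
  moreover have "AE h in increments. \<forall>g\<in>carrier G. eventually (\<lambda>n. walk G \<one> h n \<noteq> g) sequentially"
    unfolding AE_ball_countable[OF countable_carrier] using transient[OF L] by blast
  moreover note AE_mean_dist_convergent AE_space
  ultimately show ?thesis
  proof eventually_elim
    case (elim h)
    define x where "x n = walk G \<one> h n" for n
    have x: "x n \<in> carrier G" for n unfolding x_def using walk_closed[OF one_closed elim(4)] .
    define F where "F z = lim (\<lambda>n. mean_dist (x n) z)" for z
    have F: "(\<lambda>n. mean_dist (x n) z) \<longlonglongrightarrow> F z" for z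
      using elim(3) by (simp add: F_def x_def convergent_LIMSEQ_iff)
    have F_Lip: "F z \<le> F z' + d z z'" for z z'
    proof (rule LIMSEQ_le[OF F tendsto_add[OF F tendsto_const]], intro exI allI impI)
      fix n :: nat assume "0 \<le> n"
      show "mean_dist (x n) z \<le> mean_dist (x n) z' + d z z'"
        using mean_dist_Lipschitz[OF x, of n z z'] by linarith
    qed
    have F_nonneg: "0 \<le> F z" for z
      by (rule LIMSEQ_le_const[OF F]) (auto intro!: exI[of _ 0] integral_nonneg_AE AE_I2 d_nonneg)
    have small: "\<exists>z\<in>bdry. F z \<le> 3 * (1/2)^j" if "h \<notin> E j" for j
    proof -
      let ?e = "(1/2::real)^j"
      have "\<not> eventually (\<lambda>n. m j (x n) < 1 - ?e) sequentially"
        using that elim(4) by (auto simp: E_def x_def eventually_sequentially)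
      from not_eventually_sequentiallyD[OF this]
      obtain r :: "nat \<Rightarrow> nat" where r: "strict_mono r" "\<forall>n. \<not> m j (x (r n)) < 1 - ?e" by auto
      obtain s b0 where s: "strict_mono s" "((\<lambda>n. \<iota> (x (r n))) \<circ> s) \<longlonglongrightarrow> b0" by (rule convergent_subsequence)
      define g where "g n = x (r (s n))" for n
      have rs: "strict_mono (r \<circ> s)" using r(1) s(1) by (rule strict_mono_o)
      have g: "range g \<subseteq> carrier G" "(\<lambda>n. \<iota> (g n)) \<longlonglongrightarrow> b0" using s x by (auto simp: g_def o_def)
      have gn: "g n \<in> carrier G" for n using g by auto
      have b0: "b0 \<in> bdry"
      proof (rule limit_in_bdry[OF g(2) _ g(1)])
        fix y assume "y \<in> carrier G"
        then have "eventually (\<lambda>n. x n \<noteq> y) sequentially" using elim(2) by (simp add: x_def)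
        from eventually_subseq[OF rs this] show "eventually (\<lambda>n. g n \<noteq> y) sequentially" by (simp add: g_def)
      qed
      let ?V = "{y. d y b0 < ?e}"
      have "b0 \<in> ?V" by simp
      from meets_estimate[OF M(1-3) L' g b0 _ _ open_ball_d this, of "K j" ?e] K
      have ev: "eventually (\<lambda>n. m j (g n) \<le> measure L {b. \<alpha> (g n) b \<in> ?V} + ?e) sequentially"
        by (simp add: m_def)
      have "F b0 \<le> 3 * ?e"
      proof (rule tendsto_upperbound[OF _ eventually_mono[OF ev]])
        show "(\<lambda>n. mean_dist (g n) b0) \<longlonglongrightarrow> F b0"
          using LIMSEQ_subseq_LIMSEQ[OF F rs] by (simp add: o_def g_def)
        fix n assume n: "m j (g n) \<le> measure L {b. \<alpha> (g n) b \<in> ?V} + ?e"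
        have "1 - ?e \<le> m j (g n)" using r(2) by (simp add: g_def not_less)
        then have lower: "1 - 2 * ?e \<le> measure L {b. \<alpha> (g n) b \<in> ?V}" using n by simp
        have "mean_dist (g n) b0 \<le> ?e + (1 - measure L {b. d (\<alpha> (g n) b) b0 < ?e})"
          by (rule mean_dist_le[OF gn]) (rule zero_le_power, simp)
        then show "mean_dist (g n) b0 \<le> 3 * ?e" using lower by (simp only: mem_Collect_eq)
      qed simp
      then show ?thesis using b0 by blast
    qed
    have "\<forall>i. \<exists>z. z \<in> bdry \<and> F z \<le> 3 * (1/2)^i"
    proof
      fix i
      obtain j where j: "i \<le> j" "h \<notin> E j" using elim(1) by blast
      obtain z where z: "z \<in> bdry" "F z \<le> 3 * (1/2)^j" using small[OF j(2)] by blast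
      have "(1/2::real)^j \<le> (1/2)^i" using j(1) by (intro power_decreasing) auto
      then have "F z \<le> 3 * (1/2)^i" using z(2) by linarith
      then show "\<exists>z. z \<in> bdry \<and> F z \<le> 3 * (1/2)^i" using z(1) by blast
    qed
    from choice[OF this] obtain z where z: "\<forall>i. z i \<in> bdry \<and> F (z i) \<le> 3 * (1/2)^i" ..
    obtain r l where r: "strict_mono r" "(z \<circ> r) \<longlonglongrightarrow> l" by (rule convergent_subsequence)
    have l: "l \<in> bdry" by (rule bdry_limit[OF _ r(2)]) (use z in simp)
    have "(\<lambda>n. 3 * (1/2::real)^(r n) + d l ((z \<circ> r) n)) \<longlonglongrightarrow> 3 * 0 + d l l"
      using LIMSEQ_subseq_LIMSEQ[OF LIMSEQ_power_zero[of "1/2::real"] r(1)]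
      by (intro tendsto_intros r(2)) (simp_all add: o_def)
    then have lim0: "(\<lambda>n. 3 * (1/2::real)^(r n) + d l ((z \<circ> r) n)) \<longlonglongrightarrow> 0" by simp
    have "F l \<le> 0"
    proof (rule LIMSEQ_le_const[OF lim0], intro exI allI impI)
      fix n :: nat assume "0 \<le> n"
      show "F l \<le> 3 * (1/2)^(r n) + d l ((z \<circ> r) n)"
        using F_Lip[of l "z (r n)"] z[THEN spec, of "r n"] by simp
    qed
    then have "F l = 0" using F_nonneg[of l] by linarith
    then show ?case using l F[of l] by (auto simp: x_def)
  qed
qed

end

end

lemma (in prob_space) AE_imp_ex:
  assumes "AE x in M. P x"
  shows "\<exists>x. P x"
proof (rule ccontr)
  assume none: "\<nexists>x. P x"
  from assms have "AE x in M. False" by eventually_elim (use none in blast)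
  then show False by (simp add: AE_False)
qed

context boundary_walk
begin

context
  fixes L assumes L: "stat L"
begin

interpretation L: prob_space L using L by (simp add: stat_def)

lemmas [measurable_cong] = sets_stat[OF L]

text \<open>The point \<open>z\<close> where the images of \<open>L\<close> concentrate is the only limit point of the path: if a subsequence
  converges to \<open>l\<close>, a further one moves \<open>L\<close>-almost every point, and all translates of it by nonsingular
  elements, to \<open>z\<close>, and \<open>limit_of_generic_orbit\<close> yields \<open>z = l\<close>.\<close>

lemma AE_converges:
  "AE h in increments. \<exists>z\<in>bdry. (\<lambda>n. \<iota> (walk G \<one> h n)) \<longlonglongrightarrow> z \<and>
     (\<lambda>n. \<integral>b. d (\<alpha> (walk G \<one> h n) b) z \<partial>L) \<longlonglongrightarrow> 0"
proof -
  have "AE h in increments. \<forall>g\<in>carrier G. eventually (\<lambda>n. walk G \<one> h n \<noteq> g) sequentially"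
    unfolding AE_ball_countable[OF countable_carrier] using transient[OF L] by blast
  with AE_concentrates[OF L] AE_walk_nonsingular[OF L] AE_space show ?thesis
  proof eventually_elim
    case (elim h)
    define x where "x n = walk G \<one> h n" for n
    have x: "x n \<in> nonsingular L" "x n \<in> carrier G" for n
      using elim(2) nonsingular_carrier[OF L] by (auto simp: x_def)
    obtain z where z: "z \<in> bdry" "(\<lambda>n. \<integral>b. d (\<alpha> (x n) b) z \<partial>L) \<longlonglongrightarrow> 0"
      using elim(1) by (auto simp: x_def)
    have "(\<lambda>n. \<iota> (x n)) \<longlonglongrightarrow> z"
    proof (rule tendsto_if_subsequences)
      fix r l assume r: "strict_mono r" and "((\<lambda>n. \<iota> (x n)) \<circ> r) \<longlonglongrightarrow> l"
      then have l: "(\<lambda>n. \<iota> (x (r n))) \<longlonglongrightarrow> l" by (simp add: o_def)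
      have l_bdry: "l \<in> bdry"
      proof (rule limit_in_bdry[OF l])
        fix y assume "y \<in> carrier G"
        then have "eventually (\<lambda>n. x n \<noteq> y) sequentially" using elim(4) by (simp add: x_def)
        from eventually_subseq[OF r this] show "eventually (\<lambda>n. x (r n) \<noteq> y) sequentially" .
      qed (use x in auto)
      have int: "integrable L (\<lambda>b. d (\<alpha> (x (r n)) b) z)" for n
        using x d_nonneg d_le_1 by (intro integrable_bounded_action[OF L, of "\<lambda>b. d b z" _ 1]) auto
      have "(\<lambda>n. \<integral>b. norm (d (\<alpha> (x (r n)) b) z) \<partial>L) \<longlonglongrightarrow> 0"
        using LIMSEQ_subseq_LIMSEQ[OF z(2) r] d_nonneg by (simp add: o_def)
      from tendsto_L1_AE_subseq[OF int this]
      obtain s :: "nat \<Rightarrow> nat" where s: "strict_mono s"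
        "AE b in L. (\<lambda>n. d (\<alpha> (x (r (s n))) b) z) \<longlonglongrightarrow> 0" by auto
      define g where "g n = x (r (s n))" for n
      have g: "range g \<subseteq> nonsingular L" using x by (auto simp: g_def)
      have g_l: "(\<lambda>n. \<iota> (g n)) \<longlonglongrightarrow> l"
        using LIMSEQ_subseq_LIMSEQ[OF l s(1)] by (simp add: o_def g_def)
      have AE_g: "AE b in L. (\<lambda>n. \<alpha> (g n) b) \<longlonglongrightarrow> z"
        using s(2) by (simp add: g_def tendsto_iff_d[of _ z])
      have "AE b in L. \<forall>k\<in>nonsingular L. (\<lambda>n. \<alpha> (g n) (\<alpha> k b)) \<longlonglongrightarrow> z"
        unfolding AE_ball_countable[OF countable_nonsingular[OF L]]
        using nonsingular_AE[OF L _ AE_g] by blast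
      with AE_stat_bdry[OF L]
      have "AE b in L. b \<in> bdry \<and> (\<forall>k\<in>nonsingular L. (\<lambda>n. \<alpha> (g n) (\<alpha> k b)) \<longlonglongrightarrow> z)"
        by eventually_elim simp
      then have "\<exists>b. b \<in> bdry \<and> (\<forall>k\<in>nonsingular L. (\<lambda>n. \<alpha> (g n) (\<alpha> k b)) \<longlonglongrightarrow> z)"
        by (rule L.AE_imp_ex)
      then obtain b where b: "b \<in> bdry" "\<And>k. k \<in> nonsingular L \<Longrightarrow> (\<lambda>n. \<alpha> (g n) (\<alpha> k b)) \<longlonglongrightarrow> z"
        by auto
      have "z = l"
      proof (rule limit_of_generic_orbit[OF nonsingular_carrier[OF L] nonsingular_one[OF L]
            nonsingular_mult[OF L] _ g g_l l_bdry b])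
        show "infinite ((\<lambda>k. \<alpha> k b) ` nonsingular L)" if "b \<in> bdry" for b
          by (rule orbits_infinite[OF nonsingular_carrier[OF L] nonsingular_one[OF L]
                nonsingular_mult[OF L] nonsingular_support[OF L] that])
      qed
      then show "l = z" ..
    qed
    then show ?case using z by (auto simp: x_def)
  qed
qed

lemma AE_path_limit:
  "AE h in increments. (\<lambda>n. \<iota> (walk G \<one> h n)) \<longlonglongrightarrow> path_limit (walk G \<one> h)"
  using AE_converges by eventually_elim (use path_limit_eq in auto)

lemma tendsto_integral_continuous:
  fixes \<phi> :: "'b \<Rightarrow> real"
  assumes \<phi>: "continuous_on UNIV \<phi>" "\<And>x. \<bar>\<phi> x\<bar> \<le> B"
    and y: "\<And>n. y n \<in> carrier G" and z: "(\<lambda>n. \<integral>b. d (\<alpha> (y n) b) z \<partial>L) \<longlonglongrightarrow> 0"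
  shows "(\<lambda>n. \<integral>b. \<phi> (\<alpha> (y n) b) \<partial>L) \<longlonglongrightarrow> \<phi> z"
proof (rule LIMSEQ_I)
  fix e :: real assume e: "0 < e"
  have [measurable]: "\<phi> \<in> borel_measurable borel" using \<phi>(1) by (rule borel_measurable_continuous_onI)
  have B: "0 \<le> B" using \<phi>(2)[of z] by linarith
  have "open {x. \<bar>\<phi> x - \<phi> z\<bar> < e / 2}"
    using \<phi>(1) by (intro open_Collect_less continuous_intros)
  then obtain \<delta> where \<delta>: "0 < \<delta>" "{x. d x z < \<delta>} \<subseteq> {x. \<bar>\<phi> x - \<phi> z\<bar> < e / 2}"
    by (rule open_contains_ball_d) (use e in auto)
  have bound: "\<bar>\<phi> x - \<phi> z\<bar> \<le> e / 2 + 2 * B / \<delta> * d x z" for x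
  proof (cases "d x z < \<delta>")
    case True
    then have "\<bar>\<phi> x - \<phi> z\<bar> < e / 2" using \<delta>(2) by blast
    moreover have "0 \<le> 2 * B / \<delta> * d x z" using B \<delta>(1) d_nonneg by simp
    ultimately show ?thesis by linarith
  next
    case False
    then have "2 * B / \<delta> * \<delta> \<le> 2 * B / \<delta> * d x z" using B \<delta>(1) by (intro mult_left_mono) auto
    then have "2 * B \<le> 2 * B / \<delta> * d x z" using \<delta>(1) by simp
    then show ?thesis using \<phi>(2)[of x] \<phi>(2)[of z] e by linarith
  qed
  have int: "integrable L (\<lambda>b. d (\<alpha> (y n) b) z)" "integrable L (\<lambda>b. \<phi> (\<alpha> (y n) b))" for n
    using y d_nonneg d_le_1 \<phi>(2)
    by (auto intro!: integrable_bounded_action[OF L, of "\<lambda>b. d b z" "y n" 1]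
        integrable_bounded_action[OF L, of \<phi> "y n" B])
  have ineq: "\<bar>(\<integral>b. \<phi> (\<alpha> (y n) b) \<partial>L) - \<phi> z\<bar> \<le> e / 2 + 2 * B / \<delta> * (\<integral>b. d (\<alpha> (y n) b) z \<partial>L)" for n
  proof -
    have "(\<integral>b. \<phi> (\<alpha> (y n) b) \<partial>L) - \<phi> z = (\<integral>b. \<phi> (\<alpha> (y n) b) - \<phi> z \<partial>L)"
      using int(2)[of n] L.prob_space by simp
    also have "\<bar>\<dots>\<bar> \<le> (\<integral>b. \<bar>\<phi> (\<alpha> (y n) b) - \<phi> z\<bar> \<partial>L)" by (rule integral_abs_bound)
    also have "\<dots> \<le> (\<integral>b. e / 2 + 2 * B / \<delta> * d (\<alpha> (y n) b) z \<partial>L)"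
      using int[of n] bound by (intro integral_mono) auto
    also have "\<dots> = e / 2 + 2 * B / \<delta> * (\<integral>b. d (\<alpha> (y n) b) z \<partial>L)"
      using int(1)[of n] L.prob_space by simp
    finally show ?thesis .
  qed
  have "(\<lambda>n. e / 2 + 2 * B / \<delta> * (\<integral>b. d (\<alpha> (y n) b) z \<partial>L)) \<longlonglongrightarrow> e / 2 + 2 * B / \<delta> * 0"
    by (intro tendsto_intros z)
  then have "eventually (\<lambda>n. e / 2 + 2 * B / \<delta> * (\<integral>b. d (\<alpha> (y n) b) z \<partial>L) < e) sequentially"
    by (rule order_tendstoD) (use e in simp)
  then obtain N where "\<And>n. n \<ge> N \<Longrightarrow> e / 2 + 2 * B / \<delta> * (\<integral>b. d (\<alpha> (y n) b) z \<partial>L) < e"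
    by (auto simp: eventually_sequentially)
  then show "\<exists>N. \<forall>n\<ge>N. norm ((\<integral>b. \<phi> (\<alpha> (y n) b) \<partial>L) - \<phi> z) < e"
    unfolding real_norm_def using ineq by (intro exI[of _ N]) (blast intro: le_less_trans)
qed

end

lemma measurable_limit_of_walk [measurable]:
  "(\<lambda>h. path_limit (walk G \<one> h)) \<in> borel_measurable increments"
  by (rule measurable_compose[OF measurable_walk_path measurable_path_limit]) simp

text \<open>The mean of the harmonic function \<open>y \<mapsto> \<integral>b. \<phi> (\<alpha> y b) \<partial>L\<close> along the walk is constant, and its values
  converge to the value of \<open>\<phi>\<close> at the limit of the path.\<close>

theorem stat_eq_hitting:
  assumes L: "stat L"
  shows "L = distr increments borel (\<lambda>h. path_limit (walk G \<one> h))"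
proof (rule measure_eqI_continuous)
  interpret L: prob_space L using L by (simp add: stat_def)
  show "finite_measure L" by (rule L.finite_measure)
  show "finite_measure (distr increments borel (\<lambda>h. path_limit (walk G \<one> h)))"
    by (intro prob_space.finite_measure inc.P.prob_space_distr) simp
  fix \<phi> :: "'b \<Rightarrow> real" assume \<phi>: "continuous_on UNIV \<phi>"
  then have [measurable]: "\<phi> \<in> borel_measurable borel" by (rule borel_measurable_continuous_onI)
  have "bounded (range \<phi>)" using compact_continuous_image[OF \<phi> compact_UNIV] by (rule compact_imp_bounded)
  then obtain B where B: "\<And>x. \<bar>\<phi> x\<bar> \<le> B" by (auto simp: bounded_iff)
  define f where "f y = (\<integral>b. \<phi> (\<alpha> y b) \<partial>L)" for y
  have f: "bounded_by B f" "harmonic f"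
    unfolding f_def using stat_harmonic[OF L, of \<phi> B] B by auto
  have "AE h in increments. (\<lambda>n. f (walk G \<one> h n)) \<longlonglongrightarrow> \<phi> (path_limit (walk G \<one> h))"
    using AE_converges[OF L] AE_space
  proof eventually_elim
    case (elim h)
    then obtain z where z: "z \<in> bdry" "(\<lambda>n. \<iota> (walk G \<one> h n)) \<longlonglongrightarrow> z"
      "(\<lambda>n. \<integral>b. d (\<alpha> (walk G \<one> h n) b) z \<partial>L) \<longlonglongrightarrow> 0" by auto
    have "path_limit (walk G \<one> h) = z" using z path_limit_eq by blast
    then show ?case
      unfolding f_def
      using tendsto_integral_continuous[OF L \<phi> B walk_closed[OF one_closed elim(2)] z(3)] by simp
  qed
  then have "(\<lambda>n. \<integral>h. f (walk G \<one> h n) \<partial>increments) \<longlonglongrightarrow> (\<integral>h. \<phi> (path_limit (walk G \<one> h)) \<partial>increments)"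
    using f(1) walk_closed[OF one_closed]
    by (intro integral_dominated_convergence[where w = "\<lambda>_. B"]) (auto simp: bounded_by_def intro!: AE_I2)
  moreover have "(\<integral>h. f (walk G \<one> h n) \<partial>increments) = (\<integral>b. \<phi> b \<partial>L)" for n
    using expect_harmonic[OF f one_closed, of n] by (simp add: expect_def f_def)
  ultimately have "(\<integral>b. \<phi> b \<partial>L) = (\<integral>h. \<phi> (path_limit (walk G \<one> h)) \<partial>increments)"
    using LIMSEQ_unique[OF tendsto_const] by simp
  also have "\<dots> = (\<integral>b. \<phi> b \<partial>distr increments borel (\<lambda>h. path_limit (walk G \<one> h)))"
    by (rule integral_distr[symmetric]) auto
  finally show "(\<integral>b. \<phi> b \<partial>L) = (\<integral>b. \<phi> b \<partial>distr increments borel (\<lambda>h. path_limit (walk G \<one> h)))" .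
qed (simp_all add: sets_stat[OF L])

end

section \<open>Equivariant maps and quotients of the Poisson boundary\<close>

lemma emeasure_completion_Un_null:
  assumes "S \<in> sets M" "N \<subseteq> N'" "N' \<in> null_sets M"
  shows "emeasure (completion M) (S \<union> N) = emeasure M S"
proof (rule antisym)
  have SN: "S \<union> N \<in> sets (completion M)" using assms by (intro sets_completionI[OF refl assms(2,3,1)])
  have "emeasure (completion M) (S \<union> N) \<le> emeasure (completion M) (S \<union> N')"
    using assms by (intro emeasure_mono) auto
  also have "\<dots> = emeasure M (S \<union> N')"
    using assms by (subst emeasure_completion) (auto simp: null_setsD2)
  also have "\<dots> = emeasure M S" using assms by (intro emeasure_Un_null_set) auto
  finally show "emeasure (completion M) (S \<union> N) \<le> emeasure M S" .
  have "emeasure M S = emeasure (completion M) S" using assms by simp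
  also have "\<dots> \<le> emeasure (completion M) (S \<union> N)" using SN by (intro emeasure_mono) auto
  finally show "emeasure M S \<le> emeasure (completion M) (S \<union> N)" .
qed

lemma vimage_completion:
  assumes f: "f \<in> measurable M N" and A: "A \<in> sets (completion (distr M N f))"
  shows "f -` A \<inter> space M \<in> sets (completion M)"
    and "emeasure (completion M) (f -` A \<inter> space M) = emeasure (completion (distr M N f)) A"
proof -
  obtain S E E' where *: "A = S \<union> E" "E \<subseteq> E'" "E' \<in> null_sets (distr M N f)" "S \<in> sets (distr M N f)"
    using A by (rule sets_completionE)
  have S: "f -` S \<inter> space M \<in> sets M" using * f by (auto intro: measurable_sets)
  have E': "f -` E' \<inter> space M \<in> null_sets M"
    using * f by (simp add: null_sets_distr_iff)
  have eq: "f -` A \<inter> space M = (f -` S \<inter> space M) \<union> (f -` E \<inter> space M)" using * by auto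
  have sub: "f -` E \<inter> space M \<subseteq> f -` E' \<inter> space M" using * by auto
  show "f -` A \<inter> space M \<in> sets (completion M)" by (rule sets_completionI[OF eq sub E' S])
  have "emeasure (completion M) (f -` A \<inter> space M) = emeasure M (f -` S \<inter> space M)"
    unfolding eq by (rule emeasure_completion_Un_null[OF S sub E'])
  also have "\<dots> = emeasure (distr M N f) S" using * f by (simp add: emeasure_distr)
  also have "\<dots> = emeasure (completion (distr M N f)) A"
    unfolding *(1) by (rule emeasure_completion_Un_null[OF *(4,2,3), symmetric])
  finally show "emeasure (completion M) (f -` A \<inter> space M) = emeasure (completion (distr M N f)) A" .
qed

context compact_metrizable
begin

text \<open>The image of a Borel set under a Borel map need not be Borel.  Over a standard Borel space the graph of
  the map is, after coding the values by reals, a Borel set in the plane, so a compact subset of the graph carries most of its mass, and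
  the projections of compact sets are compact.\<close>

lemma image_inner_approximation:
  fixes f :: "'c \<Rightarrow> 'b"
  assumes sb: "standard_borel_space \<Gamma>" and \<nu>: "prob_space \<nu>" "sets \<nu> = sets \<Gamma>"
    and f: "f \<in> borel_measurable \<Gamma>" and B: "B \<in> sets \<Gamma>" and \<epsilon>: "0 < \<epsilon>"
  shows "\<exists>N\<in>sets borel. N \<subseteq> f ` B \<and> measure \<nu> B - \<epsilon> \<le> measure \<nu> (f -` N \<inter> space \<nu>)"
proof -
  interpret \<nu>: prob_space \<nu> by fact
  have space_\<nu>: "space \<nu> = space \<Gamma>" using sets_eq_imp_space_eq[OF \<nu>(2)] .
  obtain R r h where R: "R \<in> sets (borel :: real measure)"
    and r: "r \<in> measurable \<Gamma> (restrict_space borel R)" and h: "h \<in> measurable (restrict_space borel R) \<Gamma>"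
    and hr: "\<And>p. p \<in> space \<Gamma> \<Longrightarrow> h (r p) = p" and rh: "\<And>x. x \<in> R \<Longrightarrow> r (h x) = x"
    using sb unfolding standard_borel_space_def by blast
  have r_borel [measurable]: "r \<in> borel_measurable \<Gamma>" and rR: "\<And>p. p \<in> space \<Gamma> \<Longrightarrow> r p \<in> R"
    using r by (auto simp: measurable_restrict_space2_iff)
  note f[measurable] \<nu>(2)[measurable_cong]
  define T where "T p = (r p, code (f p))" for p
  have T [measurable]: "T \<in> borel_measurable \<nu>"
  proof -
    have "(\<lambda>p. (r p, code (f p))) \<in> borel_measurable \<nu>" by measurable
    then show ?thesis by (simp add: T_def[abs_def])
  qed
  define D where "D = {x \<in> R. h x \<in> B}"
  have D [measurable]: "D \<in> sets borel"
  proof -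
    have "h -` B \<inter> space (restrict_space borel R) \<in> sets (restrict_space borel R)"
      using h B by (rule measurable_sets)
    then have "h -` B \<inter> R \<in> sets borel" using R by (simp add: space_restrict_space sets_restrict_space_iff)
    also have "h -` B \<inter> R = D" by (auto simp: D_def)
    finally show ?thesis .
  qed
  define k where "k x = (if x \<in> R then code (f (h x)) else 0)" for x
  have [measurable]: "k \<in> borel_measurable borel"
  proof -
    have "(\<lambda>x. code (f (h x))) \<in> borel_measurable (restrict_space borel R)"
      by (rule measurable_compose[OF h]) measurable
    then show ?thesis
      unfolding k_def using R by (subst measurable_If_restrict_space_iff) (auto simp: space_restrict_space)
  qed
  define B' where "B' = {q :: real \<times> real. fst q \<in> D \<and> snd q = k (fst q)}"
  have "{q \<in> space borel. fst q \<in> D \<and> snd q = k (fst q)} \<in> sets (borel :: (real \<times> real) measure)"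
    unfolding borel_prod[symmetric] by measurable
  then have B' [measurable]: "B' \<in> sets borel" by (simp add: B'_def)
  define \<kappa> where "\<kappa> = distr \<nu> borel T"
  interpret \<kappa>: prob_space \<kappa> unfolding \<kappa>_def by (rule \<nu>.prob_space_distr) simp
  have T_B': "T -` B' \<inter> space \<nu> = B"
    using hr rR sets.sets_into_space[OF B] by (auto simp: T_def B'_def D_def k_def space_\<nu>)
  then have "emeasure \<kappa> B' = emeasure \<nu> B" by (simp add: \<kappa>_def emeasure_distr)
  moreover have "emeasure \<kappa> B' = (SUP K\<in>{K. K \<subseteq> B' \<and> compact K}. emeasure \<kappa> K)"
  proof (rule inner_regular)
    show "sets \<kappa> = sets borel" by (simp add: \<kappa>_def)
    show "emeasure \<kappa> (space \<kappa>) \<noteq> \<infinity>" by (simp add: \<kappa>.emeasure_space_1)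
  qed (rule B')
  ultimately have sup: "emeasure \<nu> B = (SUP K\<in>{K. K \<subseteq> B' \<and> compact K}. emeasure \<kappa> K)" by simp
  have "\<exists>K. K \<subseteq> B' \<and> compact K \<and> measure \<nu> B - \<epsilon> \<le> measure \<kappa> K"
  proof (cases "measure \<nu> B - \<epsilon> \<le> 0")
    case True
    then show ?thesis by (intro exI[of _ "{}"]) simp
  next
    case False
    then have "ennreal (measure \<nu> B - \<epsilon>) < emeasure \<nu> B"
      using \<epsilon> by (simp add: \<nu>.emeasure_eq_measure ennreal_lessI)
    then obtain K where "K \<subseteq> B'" "compact K" "ennreal (measure \<nu> B - \<epsilon>) < emeasure \<kappa> K"
      unfolding sup less_SUP_iff by auto
    then show ?thesis
      using False by (intro exI[of _ K]) (simp add: \<kappa>.emeasure_eq_measure ennreal_less_iff)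
  qed
  then obtain K where K: "K \<subseteq> B'" "compact K" "measure \<nu> B - \<epsilon> \<le> measure \<kappa> K" by auto
  have "compact (snd ` K)" using K(2) by (intro compact_continuous_image continuous_intros)
  then have sK [measurable]: "snd ` K \<in> sets borel" by (intro borel_closed compact_imp_closed)
  have [measurable]: "K \<in> sets borel" using K(2) by (intro borel_closed compact_imp_closed)
  define N where "N = code -` (snd ` K)"
  have N [measurable]: "N \<in> sets borel"
    using measurable_sets[OF measurable_code sK] by (simp add: N_def)
  have "N \<subseteq> f ` B"
  proof
    fix b assume "b \<in> N"
    then obtain x where "(x, code b) \<in> K" by (auto simp: N_def)
    then have x: "x \<in> R" "h x \<in> B" "code b = code (f (h x))" using K(1) by (auto simp: B'_def D_def k_def)
    have "b = f (h x)" using arg_cong[OF x(3), of decode] by simp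
    then show "b \<in> f ` B" using x(2) by blast
  qed
  moreover have "measure \<nu> B - \<epsilon> \<le> measure \<nu> (f -` N \<inter> space \<nu>)"
  proof -
    have "measure \<kappa> K = measure \<nu> (T -` K \<inter> space \<nu>)" by (simp add: \<kappa>_def measure_distr)
    also have "\<dots> \<le> measure \<nu> (f -` N \<inter> space \<nu>)"
    proof (rule \<nu>.finite_measure_mono)
      show "T -` K \<inter> space \<nu> \<subseteq> f -` N \<inter> space \<nu>" by (force simp: T_def N_def)
      show "f -` N \<inter> space \<nu> \<in> sets \<nu>" by measurable
    qed
    finally show ?thesis using K(3) by linarith
  qed
  ultimately show ?thesis using N by blast
qed

lemma image_inner_set:
  fixes f :: "'c \<Rightarrow> 'b"
  assumes "standard_borel_space \<Gamma>" and \<nu>: "prob_space \<nu>" "sets \<nu> = sets \<Gamma>"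
    and f: "f \<in> borel_measurable \<Gamma>" and "B \<in> sets \<Gamma>"
  obtains N where "N \<in> sets borel" "N \<subseteq> f ` B" "measure \<nu> B \<le> measure \<nu> (f -` N \<inter> space \<nu>)"
proof -
  interpret \<nu>: prob_space \<nu> by fact
  have "\<forall>n. \<exists>N. N \<in> sets borel \<and> N \<subseteq> f ` B \<and>
      measure \<nu> B - 1 / real (Suc n) \<le> measure \<nu> (f -` N \<inter> space \<nu>)"
  proof
    fix n
    have "0 < 1 / real (Suc n)" by simp
    from image_inner_approximation[OF assms this]
    show "\<exists>N. N \<in> sets borel \<and> N \<subseteq> f ` B \<and> measure \<nu> B - 1 / real (Suc n) \<le> measure \<nu> (f -` N \<inter> space \<nu>)"
      by (elim bexE) (intro exI conjI, auto)
  qed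
  from choice[OF this] obtain N where N: "\<forall>n. N n \<in> sets borel \<and> N n \<subseteq> f ` B \<and>
      measure \<nu> B - 1 / real (Suc n) \<le> measure \<nu> (f -` N n \<inter> space \<nu>)" ..
  have U: "(\<Union>n. N n) \<in> sets borel" using N by auto
  have "f \<in> borel_measurable \<nu>" using f by (simp add: measurable_cong_sets[OF \<nu>(2) refl])
  from measurable_sets[OF this U]
  have "measure \<nu> (f -` N n \<inter> space \<nu>) \<le> measure \<nu> (f -` (\<Union>n. N n) \<inter> space \<nu>)" for n
    by (intro \<nu>.finite_measure_mono) auto
  then have le: "measure \<nu> B - 1 / real (Suc n) \<le> measure \<nu> (f -` (\<Union>n. N n) \<inter> space \<nu>)" for n
    using N[rule_format, of n] by (meson order_trans)
  have "(\<lambda>n. measure \<nu> B - 1 / real (Suc n)) \<longlonglongrightarrow> measure \<nu> B - 0"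
    using LIMSEQ_Suc[OF lim_1_over_n] by (intro tendsto_diff tendsto_const) (simp add: add.commute)
  then have "measure \<nu> B - 0 \<le> measure \<nu> (f -` (\<Union>n. N n) \<inter> space \<nu>)"
    by (rule LIMSEQ_le_const2) (use le in blast)
  then show ?thesis using that[OF U] N by auto
qed

end

text \<open>The projection to the blocks is measurable for every \<open>\<sigma>\<close>-algebra of unions of blocks, so the quotient
  measure is the measure of the union.\<close>

lemma sets_quotient_measure:
  assumes "partition_on (space M) P"
  shows "space (quotient_measure M P) = P"
    and "sets (quotient_measure M P) = {\<eta>. \<eta> \<subseteq> P \<and> \<Union>\<eta> \<in> sets M}"
    and "\<eta> \<subseteq> P \<Longrightarrow> \<Union>\<eta> \<in> sets M \<Longrightarrow> emeasure (quotient_measure M P) \<eta> = emeasure M (\<Union>\<eta>)"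
proof -
  let ?\<A> = "{\<eta>. \<eta> \<subseteq> P \<and> \<Union>\<eta> \<in> sets M}"
  have P: "\<Union>P = space M" "\<And>C D. C \<in> P \<Longrightarrow> D \<in> P \<Longrightarrow> C \<noteq> D \<Longrightarrow> C \<inter> D = {}"
    using assms by (auto simp: partition_on_def disjoint_def)
  have diff: "\<Union>(P - \<eta>) = space M - \<Union>\<eta>" if "\<eta> \<subseteq> P" for \<eta>
    using P that by blast
  have alg: "sigma_algebra P ?\<A>"
    unfolding sigma_algebra_iff2
  proof (intro conjI ballI allI impI)
    fix \<eta> assume "\<eta> \<in> ?\<A>"
    then show "P - \<eta> \<in> ?\<A>" using diff[of \<eta>] by auto
  next
    fix A :: "nat \<Rightarrow> 'a set set" assume "range A \<subseteq> ?\<A>"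
    then have "\<And>i. A i \<subseteq> P" "\<And>i. \<Union>(A i) \<in> sets M" by auto
    moreover have "\<Union>(\<Union>i. A i) = (\<Union>i. \<Union>(A i))" by auto
    ultimately show "(\<Union>i. A i) \<in> ?\<A>" by auto
  qed auto
  have sub: "?\<A> \<subseteq> Pow P" by auto
  show space: "space (quotient_measure M P) = P"
    by (simp add: quotient_measure_def space_measure_of[OF sub])
  have sets_sigma: "sets (sigma P ?\<A>) = ?\<A>" using alg sub by (simp add: sigma_algebra.sigma_sets_eq)
  then show sets: "sets (quotient_measure M P) = ?\<A>" by (simp add: quotient_measure_def)
  define pr where "pr p = (THE C. C \<in> P \<and> p \<in> C)" for p
  have pr: "pr p = C" if "C \<in> P" "p \<in> C" for p C
    unfolding pr_def using that P(2) by (intro the_equality) auto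
  have vim: "pr -` \<eta> \<inter> space M = \<Union>\<eta>" if "\<eta> \<subseteq> P" for \<eta>
  proof (intro equalityI subsetI)
    fix p assume p: "p \<in> pr -` \<eta> \<inter> space M"
    then have "p \<in> \<Union>P" using P(1) by simp
    then obtain C where "C \<in> P" "p \<in> C" by auto
    then show "p \<in> \<Union>\<eta>" using pr[of C p] p by auto
  next
    fix p assume "p \<in> \<Union>\<eta>"
    then obtain C where C: "C \<in> \<eta>" "p \<in> C" by auto
    then have "C \<in> P" using that by auto
    moreover have "p \<in> space M" using P(1) C \<open>C \<in> P\<close> by auto
    ultimately show "p \<in> pr -` \<eta> \<inter> space M" using pr[of C p] C by simp
  qed
  have meas: "pr \<in> measurable M (sigma P ?\<A>)"
  proof (rule measurable_measure_of[OF sub])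
    show "pr \<in> space M \<rightarrow> P"
    proof
      fix p assume "p \<in> space M"
      then have "p \<in> \<Union>P" using P(1) by simp
      then obtain C where "C \<in> P" "p \<in> C" by auto
      then show "pr p \<in> P" using pr[of C p] by simp
    qed
  qed (use vim in auto)
  assume \<eta>: "\<eta> \<subseteq> P" "\<Union>\<eta> \<in> sets M"
  have "emeasure (quotient_measure M P) \<eta> = emeasure M (pr -` \<eta> \<inter> space M)"
    unfolding quotient_measure_def pr_def[symmetric, abs_def]
    using \<eta> sets_sigma by (intro emeasure_distr meas) auto
  then show "emeasure (quotient_measure M P) \<eta> = emeasure M (\<Union>\<eta>)" by (simp only: vim[OF \<eta>(1)])
qed

context boundary_action
begin

abbreviation bb :: "'b measure" where "bb \<equiv> boundary_borel G \<iota>"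

lemma space_bb: "space bb = bdry"
  by (simp add: boundary_borel_def space_restrict_space)

lemma sets_bb: "A \<in> sets bb \<longleftrightarrow> A \<subseteq> bdry \<and> A \<in> sets borel"
  by (simp add: boundary_borel_def sets_restrict_space_iff)

text \<open>The level sets of an equivariant map \<open>f\<close> form an invariant measurable partition once
  the invariant null set where equivariance fails is made a separate block, and the quotient is the image
  measure: by inner approximation the image of \<open>f\<close> contains an invariant Borel set of full measure, and
  a subset of it with measurable preimage is measurable for the completed image measure.\<close>

lemma equivariant_map_quotient:
  fixes f :: "'c \<Rightarrow> 'b"
  assumes sb: "standard_borel_space \<Gamma>" and \<nu>: "prob_space \<nu>" "sets \<nu> = sets \<Gamma>"
    and act: "group_action G (space \<Gamma>) \<beta>" "\<And>g. g \<in> carrier G \<Longrightarrow> \<beta> g \<in> measurable \<Gamma> \<Gamma>"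
    and f: "f \<in> borel_measurable \<Gamma>" "\<And>p. p \<in> space \<Gamma> \<Longrightarrow> f p \<in> bdry"
    and equiv: "\<And>g. g \<in> carrier G \<Longrightarrow> AE p in \<nu>. f (\<beta> g p) = \<alpha> g (f p)"
  shows "\<exists>P. measurable_partition \<Gamma> P \<and> (\<forall>g\<in>carrier G. \<forall>C\<in>P. \<beta> g ` C \<in> P) \<and>
    isomorphic_mod0 G (quotient_measure (completion \<nu>) P) (\<lambda>g C. \<beta> g ` C)
      (completion (distr \<nu> (boundary_borel G \<iota>) f)) \<alpha>"
proof -
  interpret \<nu>: prob_space \<nu> by fact
  interpret A: group_action G "space \<Gamma>" \<beta> by (rule act)
  have space_\<nu>: "space \<nu> = space \<Gamma>" using sets_eq_imp_space_eq[OF \<nu>(2)] .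
  note [measurable] = f(1) and [measurable_cong] = \<nu>(2)
  have \<beta>_space: "\<beta> g p \<in> space \<Gamma>" if "g \<in> carrier G" "p \<in> space \<Gamma>" for g p
    using A.element_image[OF that refl] .
  have \<beta>_mult: "\<beta> (g \<otimes> h) p = \<beta> g (\<beta> h p)" if "g \<in> carrier G" "h \<in> carrier G" "p \<in> space \<Gamma>" for g h p
    using A.composition_rule[OF that(3,1,2)] .
  have \<beta>_one: "\<beta> \<one> p = p" if "p \<in> space \<Gamma>" for p
    using A.id_eq_one that by (metis restrict_apply')
  have \<beta>_inv: "\<beta> g (\<beta> (inv g) p) = p" if "g \<in> carrier G" "p \<in> space \<Gamma>" for g p
    using \<beta>_mult[of g "inv g" p] \<beta>_one that by simp
  \<comment> \<open>The points where \<open>f\<close> is equivariant under the whole group form an invariant set.\<close>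
  define \<Gamma>0 where "\<Gamma>0 = {p \<in> space \<Gamma>. \<forall>g\<in>carrier G. f (\<beta> g p) = \<alpha> g (f p)}"
  have \<Gamma>0_sub: "\<Gamma>0 \<subseteq> space \<Gamma>" by (auto simp: \<Gamma>0_def)
  have \<Gamma>0_eq: "f (\<beta> g p) = \<alpha> g (f p)" if "p \<in> \<Gamma>0" "g \<in> carrier G" for g p
    using that by (simp add: \<Gamma>0_def)
  have \<Gamma>0_\<beta>: "\<beta> g p \<in> \<Gamma>0" if p: "p \<in> \<Gamma>0" and g: "g \<in> carrier G" for g p
  proof -
    have "f (\<beta> h (\<beta> g p)) = \<alpha> h (f (\<beta> g p))" if h: "h \<in> carrier G" for h
    proof -
      have "f (\<beta> h (\<beta> g p)) = f (\<beta> (h \<otimes> g) p)" using \<beta>_mult[OF h g] p \<Gamma>0_sub by auto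
      also have "\<dots> = \<alpha> (h \<otimes> g) (f p)" using \<Gamma>0_eq[OF p] g h by simp
      finally show ?thesis using \<Gamma>0_eq[OF p g] g h by (simp add: \<alpha>_mult)
    qed
    then show ?thesis using \<beta>_space[OF g] p \<Gamma>0_sub by (auto simp: \<Gamma>0_def)
  qed
  have "\<Gamma>0 = (\<Inter>g\<in>carrier G. {p \<in> space \<Gamma>. d (f (\<beta> g p)) (\<alpha> g (f p)) = 0})"
    by (auto simp: \<Gamma>0_def)
  also have "\<dots> \<in> sets \<Gamma>"
  proof (rule sets.countable_INT'[OF countable_G])
    have "{p \<in> space \<Gamma>. d (f (\<beta> g p)) (\<alpha> g (f p)) = 0} \<in> sets \<Gamma>" if g: "g \<in> carrier G" for g
    proof -
    have [measurable]: "(\<lambda>p. f (\<beta> g p)) \<in> borel_measurable \<Gamma>" by (rule measurable_compose[OF act(2)[OF g] f(1)])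
    have [measurable]: "(\<lambda>p. \<alpha> g (f p)) \<in> borel_measurable \<Gamma>" by (rule measurable_compose[OF f(1) measurable_\<alpha>[OF g]])
      show ?thesis by measurable
    qed
    then show "(\<lambda>g. {p \<in> space \<Gamma>. d (f (\<beta> g p)) (\<alpha> g (f p)) = 0}) ` carrier G \<subseteq> sets \<Gamma>" by blast
  qed auto
  finally have \<Gamma>0_sets: "\<Gamma>0 \<in> sets \<Gamma>" .
  have AE_\<Gamma>0: "AE p in \<nu>. p \<in> \<Gamma>0"
  proof -
    have "AE p in \<nu>. \<forall>g\<in>carrier G. f (\<beta> g p) = \<alpha> g (f p)"
      unfolding AE_ball_countable[OF countable_G] using equiv by blast
    with AE_space show ?thesis by eventually_elim (simp add: \<Gamma>0_def space_\<nu>)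
  qed
  have \<nu>_\<Gamma>0: "measure \<nu> \<Gamma>0 = 1"
    using \<nu>.prob_eq_1[of \<Gamma>0] AE_\<Gamma>0 \<Gamma>0_sets \<nu>(2) by simp
  define blk where "blk b = {p \<in> \<Gamma>0. f p = b}" for b
  define P where "P = (blk ` (f ` \<Gamma>0) \<union> {space \<Gamma> - \<Gamma>0}) - {{}}"
  have blk_inj: "b = c" if "b \<in> f ` \<Gamma>0" "blk b = blk c" for b c
    using that unfolding blk_def by blast
  have blk_P: "blk b \<in> P" if "b \<in> f ` \<Gamma>0" for b
    using that unfolding P_def blk_def by blast
  have P_cases: "(\<exists>b\<in>f ` \<Gamma>0. C = blk b) \<or> C = space \<Gamma> - \<Gamma>0" if "C \<in> P" for C
    using that by (auto simp: P_def)
  have part: "partition_on (space \<Gamma>) P"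
  proof (rule partition_onI)
    show "\<Union>P = space \<Gamma>"
    proof (intro equalityI subsetI)
      fix p assume "p \<in> \<Union>P"
      then show "p \<in> space \<Gamma>" using \<Gamma>0_sub by (auto simp: P_def blk_def)
    next
      fix p assume p: "p \<in> space \<Gamma>"
      show "p \<in> \<Union>P"
      proof (cases "p \<in> \<Gamma>0")
        case True
        then have "p \<in> blk (f p)" "blk (f p) \<in> P" using blk_P by (auto simp: blk_def)
        then show ?thesis by blast
      next
        case False
        then have "space \<Gamma> - \<Gamma>0 \<in> P" using p by (auto simp: P_def)
        then show ?thesis using p False by blast
      qed
    qed
    fix C D assume CD: "C \<in> P" "D \<in> P" "C \<noteq> D"
    show "disjnt C D"
      using P_cases[OF CD(1)] P_cases[OF CD(2)] CD(3) by (auto simp: blk_def disjnt_def)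
  qed (simp add: P_def)
  have mpart: "measurable_partition \<Gamma> P"
    unfolding measurable_partition_def
  proof (intro conjI part)
    define U where "U n = (if n = 0 then \<Gamma>0 else \<Gamma>0 \<inter> f -` basis (n - 1))" for n :: nat
    have U_f: "U n = (\<Union>b\<in>{b \<in> f ` \<Gamma>0. n = 0 \<or> b \<in> basis (n - 1)}. blk b)" for n
      by (auto simp: U_def blk_def)
    have "\<forall>n. U n \<in> sets \<Gamma> \<and> (\<exists>\<eta>\<subseteq>P. U n = \<Union>\<eta>)"
    proof (intro allI conjI)
      fix n
      have "f -` basis (n - 1) \<inter> space \<Gamma> \<in> sets \<Gamma>"
        using open_basis[of "n - 1"] by (intro measurable_sets[OF f(1)]) auto
      then have "\<Gamma>0 \<inter> (f -` basis (n - 1) \<inter> space \<Gamma>) \<in> sets \<Gamma>" using \<Gamma>0_sets by (rule sets.Int[rotated])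
      moreover have "\<Gamma>0 \<inter> (f -` basis (n - 1) \<inter> space \<Gamma>) = \<Gamma>0 \<inter> f -` basis (n - 1)" using \<Gamma>0_sub by auto
      ultimately show "U n \<in> sets \<Gamma>" using \<Gamma>0_sets by (simp add: U_def)
      show "\<exists>\<eta>\<subseteq>P. U n = \<Union>\<eta>"
        using blk_P by (intro exI[of _ "blk ` {b \<in> f ` \<Gamma>0. n = 0 \<or> b \<in> basis (n - 1)}"]) (auto simp: U_f)
    qed
    moreover have sep: "\<exists>n. C \<subseteq> U n \<and> D \<inter> U n = {} \<or> D \<subseteq> U n \<and> C \<inter> U n = {}"
      if CD: "C \<in> P" "D \<in> P" "C \<noteq> D" for C D
    proof (cases "C = space \<Gamma> - \<Gamma>0 \<or> D = space \<Gamma> - \<Gamma>0")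
      case True
      then show ?thesis
        using P_cases[OF CD(1)] P_cases[OF CD(2)] CD(3)
        by (intro exI[of _ 0]) (auto simp: U_def blk_def)
    next
      case False
      then obtain b c where bc: "b \<in> f ` \<Gamma>0" "c \<in> f ` \<Gamma>0" "C = blk b" "D = blk c"
        using P_cases[OF CD(1)] P_cases[OF CD(2)] by blast
      then have "b \<noteq> c" using CD(3) by auto
      then obtain j where "b \<in> basis j" "closure (basis j) \<subseteq> - {c}"
        using basis_regular[of "- {c}" b] by (auto simp: open_Compl)
      then have "b \<in> basis j" "c \<notin> basis j" using closure_subset[of "basis j"] by auto
      then have "C \<subseteq> U (Suc j)" "D \<inter> U (Suc j) = {}" using bc by (auto simp: U_def blk_def)
      then show ?thesis by blast
    qed
    ultimately show "\<exists>A :: nat \<Rightarrow> 'c set. (\<forall>n. A n \<in> sets \<Gamma> \<and> (\<exists>\<eta>\<subseteq>P. A n = \<Union>\<eta>)) \<and>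
        (\<forall>C\<in>P. \<forall>D\<in>P. C \<noteq> D \<longrightarrow> (\<exists>n. C \<subseteq> A n \<and> D \<inter> A n = {} \<or> D \<subseteq> A n \<and> C \<inter> A n = {}))"
      by (intro exI[of _ U]) (use sep in blast)
  qed
  have \<beta>_blk: "\<beta> g ` blk b = blk (\<alpha> g b)" if g: "g \<in> carrier G" for g b
  proof (intro equalityI subsetI)
    fix p assume "p \<in> \<beta> g ` blk b"
    then show "p \<in> blk (\<alpha> g b)" using \<Gamma>0_\<beta> \<Gamma>0_eq g by (auto simp: blk_def)
  next
    fix p assume p: "p \<in> blk (\<alpha> g b)"
    then have "p \<in> \<Gamma>0" "f p = \<alpha> g b" "p \<in> space \<Gamma>" using \<Gamma>0_sub by (auto simp: blk_def)
    then have "\<beta> (inv g) p \<in> blk b" using \<Gamma>0_\<beta>[of p "inv g"] \<Gamma>0_eq[of p "inv g"] g by (simp add: blk_def)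
    then show "p \<in> \<beta> g ` blk b" using \<beta>_inv[OF g \<open>p \<in> space \<Gamma>\<close>] by force
  qed
  have \<alpha>_f\<Gamma>0: "\<alpha> g b \<in> f ` \<Gamma>0" if "g \<in> carrier G" "b \<in> f ` \<Gamma>0" for g b
  proof -
    from that(2) obtain p where "p \<in> \<Gamma>0" "b = f p" by auto
    then have "\<alpha> g b = f (\<beta> g p)" "\<beta> g p \<in> \<Gamma>0" using \<Gamma>0_\<beta> \<Gamma>0_eq that(1) by auto
    then show ?thesis by blast
  qed
  have inv_P: "\<forall>g\<in>carrier G. \<forall>C\<in>P. \<beta> g ` C \<in> P"
  proof (intro ballI)
    fix g C assume g: "g \<in> carrier G" and C: "C \<in> P"
    from P_cases[OF C] show "\<beta> g ` C \<in> P"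
    proof
      assume "\<exists>b\<in>f ` \<Gamma>0. C = blk b"
      then show ?thesis using \<beta>_blk[OF g] \<alpha>_f\<Gamma>0[OF g] blk_P by auto
    next
      assume *: "C = space \<Gamma> - \<Gamma>0"
      have "\<beta> g ` C = C"
      proof (intro equalityI subsetI)
        fix p assume "p \<in> \<beta> g ` C"
        then obtain q where q: "q \<in> C" "p = \<beta> g q" by auto
        have "p \<notin> \<Gamma>0"
        proof
          assume "p \<in> \<Gamma>0"
          then have "\<beta> (inv g) p \<in> \<Gamma>0" using \<Gamma>0_\<beta> g by simp
          moreover have "\<beta> (inv g) p = q" using \<beta>_inv[of "inv g" q] q g * by simp
          ultimately show False using q * by simp
        qed
        then show "p \<in> C" using * q \<beta>_space[OF g] by auto
      next
        fix p assume p: "p \<in> C"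
        have "\<beta> (inv g) p \<in> C"
          using p * \<beta>_space[of "inv g" p] \<Gamma>0_\<beta>[of "\<beta> (inv g) p" g] \<beta>_inv[of g p] g by auto
        then show "p \<in> \<beta> g ` C" using \<beta>_inv[of g p] g p * by force
      qed
      then show ?thesis using C by simp
    qed
  qed
  let ?lam = "distr \<nu> (boundary_borel G \<iota>) f"
  let ?Q = "quotient_measure (completion \<nu>) P"
  have f_bb: "f \<in> measurable \<nu> (boundary_borel G \<iota>)"
    unfolding boundary_borel_def
    using f by (intro measurable_restrict_space2) (auto simp: space_\<nu> measurable_cong_sets[OF \<nu>(2) refl])
  have part': "partition_on (space (completion \<nu>)) P" using part by (simp add: space_\<nu>)
  note Q = sets_quotient_measure[OF part']
  obtain N1 where N1: "N1 \<in> sets borel" "N1 \<subseteq> f ` \<Gamma>0" "1 \<le> measure \<nu> (f -` N1 \<inter> space \<nu>)"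
    using image_inner_set[OF sb \<nu> f(1) \<Gamma>0_sets] \<nu>_\<Gamma>0 by auto
  define N0 where "N0 = (\<Union>g\<in>carrier G. \<alpha> (inv g) -` N1)"
  have N0_borel: "N0 \<in> sets borel"
    unfolding N0_def
  proof (rule sets.countable_UN''[OF countable_G])
    fix g assume "g \<in> carrier G"
    then show "\<alpha> (inv g) -` N1 \<in> sets borel"
      using measurable_sets[OF measurable_\<alpha> N1(1), of "inv g"] by simp
  qed
  have N0_f: "N0 \<subseteq> f ` \<Gamma>0"
  proof
    fix b assume "b \<in> N0"
    then obtain g where g: "g \<in> carrier G" "\<alpha> (inv g) b \<in> N1" by (auto simp: N0_def)
    have "\<alpha> (inv g) b \<in> f ` \<Gamma>0" using g(2) N1(2) by blast
    then have "\<alpha> g (\<alpha> (inv g) b) \<in> f ` \<Gamma>0" by (rule \<alpha>_f\<Gamma>0[OF g(1)])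
    moreover have "\<alpha> g (\<alpha> (inv g) b) = b" using \<alpha>_mult[of g "inv g" b] \<alpha>_one g(1) by simp
    ultimately show "b \<in> f ` \<Gamma>0" by simp
  qed
  have N0_bdry: "N0 \<subseteq> bdry" using N0_f f(2) \<Gamma>0_sub by auto
  have N1_N0: "N1 \<subseteq> N0"
    by (auto simp: N0_def intro!: bexI[of _ \<one>])
  have N0_\<alpha>: "\<alpha> g b \<in> N0" if g: "g \<in> carrier G" and b: "b \<in> N0" for g b
  proof -
    obtain h where h: "h \<in> carrier G" "\<alpha> (inv h) b \<in> N1" using b by (auto simp: N0_def)
    have "\<alpha> (inv (g \<otimes> h)) (\<alpha> g b) = \<alpha> (inv h) b" using g h by (simp add: inv_mult_group \<alpha>_mult)
    then show ?thesis using g h by (auto simp: N0_def intro!: bexI[of _ "g \<otimes> h"])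
  qed
  have \<alpha>_N0: "\<alpha> g ` N0 = N0" if g: "g \<in> carrier G" for g
  proof (intro equalityI subsetI)
    fix b assume "b \<in> N0"
    then have "\<alpha> (inv g) b \<in> N0" using N0_\<alpha> g by simp
    then show "b \<in> \<alpha> g ` N0" using g by (force intro: image_eqI[of _ _ "\<alpha> (inv g) b"])
  qed (use N0_\<alpha> g in auto)
  define M0 where "M0 = blk ` N0"
  have M0_P: "M0 \<subseteq> P" using N0_f blk_P by (auto simp: M0_def)
  have Un_blk: "\<Union>(blk ` D) = \<Gamma>0 \<inter> f -` D" for D by (auto simp: blk_def)
  define F where "F C = f (SOME p. p \<in> C)" for C
  have F: "F (blk b) = b" if "b \<in> f ` \<Gamma>0" for b
  proof -
    have "\<exists>p. p \<in> blk b" using that by (auto simp: blk_def)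
    from someI_ex[OF this] show ?thesis by (simp add: F_def blk_def)
  qed
  have AE_N1: "AE p in \<nu>. p \<in> f -` N1 \<inter> space \<nu>"
  proof -
    have "f -` N1 \<inter> space \<nu> \<in> sets \<nu>"
      using N1(1) f(1) by (intro measurable_sets[of f _ borel]) (auto simp: measurable_cong_sets[OF \<nu>(2) refl])
    then show ?thesis using N1(3) \<nu>.prob_le_1 by (subst \<nu>.AE_in_set_eq_1) (auto intro: antisym)
  qed
  \<comment> \<open>Preimages under \<open>f\<close> of subsets of \<open>N0\<close>, up to the null set outside \<open>\<Gamma>0\<close>.\<close>
  have pre: "\<Gamma>0 \<inter> f -` D \<in> sets (completion \<nu>)"
    "emeasure (completion \<nu>) (\<Gamma>0 \<inter> f -` D) = emeasure (completion ?lam) D"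
    if D: "D \<in> sets (completion ?lam)" for D
  proof -
    note V = vimage_completion[OF f_bb D]
    have G0: "\<Gamma>0 \<in> sets (completion \<nu>)" using \<Gamma>0_sets \<nu>(2) by auto
    have eq: "\<Gamma>0 \<inter> f -` D = \<Gamma>0 \<inter> (f -` D \<inter> space \<nu>)" using \<Gamma>0_sub space_\<nu> by auto
    show *: "\<Gamma>0 \<inter> f -` D \<in> sets (completion \<nu>)" unfolding eq using V(1) G0 by blast
    have "AE p in completion \<nu>. p \<in> \<Gamma>0" by (rule AE_completion[OF AE_\<Gamma>0])
    then have "emeasure (completion \<nu>) (\<Gamma>0 \<inter> f -` D) = emeasure (completion \<nu>) (f -` D \<inter> space \<nu>)"
      by (intro emeasure_eq_AE[OF _ * V(1)], eventually_elim) (use space_\<nu> \<Gamma>0_sub in auto)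
    then show "emeasure (completion \<nu>) (\<Gamma>0 \<inter> f -` D) = emeasure (completion ?lam) D" using V(2) by simp
  qed
  have N0_lam: "N0 \<in> sets ?lam" using N0_bdry N0_borel by (simp add: sets_bb)
  have N0_full: "emeasure (completion ?lam) (space (completion ?lam) - N0) = 0"
  proof -
    have "emeasure (completion ?lam) (space (completion ?lam) - N0) = emeasure ?lam (space ?lam - N0)"
      using N0_lam by simp
    also have "\<dots> = emeasure \<nu> (f -` (bdry - N0) \<inter> space \<nu>)"
      using N0_lam f_bb by (subst emeasure_distr) (auto simp: space_bb sets_bb)
    also have "\<dots> = emeasure \<nu> {}"
    proof (rule emeasure_eq_AE)
      show "AE x in \<nu>. (x \<in> f -` (bdry - N0) \<inter> space \<nu>) = (x \<in> {})"
        using AE_N1 by eventually_elim (use N1_N0 in auto)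
      show "f -` (bdry - N0) \<inter> space \<nu> \<in> sets \<nu>"
        using N0_borel by (intro measurable_sets[OF f_bb]) (auto simp: sets_bb)
    qed simp
    finally show ?thesis by simp
  qed
  have M0_Q: "M0 \<in> sets ?Q"
    using M0_P pre(1)[of N0] N0_lam by (auto simp: Q(2) M0_def Un_blk)
  have M0_Q': "M0 \<inter> space ?Q \<in> sets ?Q" unfolding Q(1) Int_absorb2[OF M0_P] by (rule M0_Q)
  have sets_RQ: "\<eta> \<in> sets (restrict_space ?Q M0) \<longleftrightarrow> \<eta> \<subseteq> M0 \<and> \<Union>\<eta> \<in> sets (completion \<nu>)" for \<eta>
  proof -
    have "\<eta> \<in> sets (restrict_space ?Q M0) \<longleftrightarrow> \<eta> \<subseteq> M0 \<and> \<eta> \<in> sets ?Q"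
      by (rule sets_restrict_space_iff[OF M0_Q'])
    also have "\<dots> \<longleftrightarrow> \<eta> \<subseteq> M0 \<and> \<Union>\<eta> \<in> sets (completion \<nu>)" using M0_P by (auto simp: Q(2))
    finally show ?thesis .
  qed
  have N0_compl: "N0 \<inter> space (completion ?lam) \<in> sets (completion ?lam)"
    using N0_lam sets.sets_into_space[OF N0_lam] by (simp add: Int_absorb2)
  have sets_RN: "D \<in> sets (restrict_space (completion ?lam) N0) \<longleftrightarrow> D \<subseteq> N0 \<and> D \<in> sets (completion ?lam)" for D
    using N0_compl by (rule sets_restrict_space_iff)
  have space_RQ: "space (restrict_space ?Q M0) = M0" using M0_P by (auto simp: space_restrict_space Q)
  have space_RN: "space (restrict_space (completion ?lam) N0) = N0"
    using N0_bdry by (auto simp: space_restrict_space space_bb)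
  have blk_M0: "blk ` D \<subseteq> M0" if "D \<subseteq> N0" for D using that by (auto simp: M0_def)
  have FM: "F C \<in> N0" "blk (F C) = C" if "C \<in> M0" for C
    using that F N0_f by (auto simp: M0_def)
  have bij: "bij_betw F M0 N0"
    by (rule bij_betw_byWitness[where f' = blk]) (use FM F N0_f in \<open>auto simp: M0_def\<close>)
  have inv_F: "the_inv_into M0 F b = blk b" if "b \<in> N0" for b
  proof (rule the_inv_into_f_eq)
    show "inj_on F M0" using bij by (rule bij_betw_imp_inj_on)
  qed (use that F N0_f in \<open>auto simp: M0_def\<close>)
  have F_vim: "F -` D \<inter> M0 = blk ` D" if "D \<subseteq> N0" for D
    using FM that F N0_f by (force simp: M0_def)
  have F_meas: "F \<in> measurable (restrict_space ?Q M0) (restrict_space (completion ?lam) N0)"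
  proof (rule measurableI)
    fix C assume "C \<in> space (restrict_space ?Q M0)"
    then show "F C \<in> space (restrict_space (completion ?lam) N0)" using FM by (simp add: space_RQ space_RN)
  next
    fix D assume "D \<in> sets (restrict_space (completion ?lam) N0)"
    then have D: "D \<subseteq> N0" "D \<in> sets (completion ?lam)" by (auto simp: sets_RN)
    then show "F -` D \<inter> space (restrict_space ?Q M0) \<in> sets (restrict_space ?Q M0)"
      using pre(1)[OF D(2)] blk_M0[OF D(1)] unfolding space_RQ F_vim[OF D(1)] sets_RQ Un_blk by blast
  qed
  \<comment> \<open>A subset of \<open>N0\<close> with measurable preimage contains a Borel set of the same measure, and so does
    its complement.\<close>
  have inner: "\<exists>N. N \<in> sets borel \<and> N \<subseteq> D \<and> measure (completion \<nu>) (\<Gamma>0 \<inter> f -` D) \<le> measure \<nu> (f -` N \<inter> space \<nu>)"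
    if D: "\<Gamma>0 \<inter> f -` D \<in> sets (completion \<nu>)" for D
  proof -
    obtain E1 E E' where E: "\<Gamma>0 \<inter> f -` D = E1 \<union> E" "E \<subseteq> E'" "E' \<in> null_sets \<nu>" "E1 \<in> sets \<nu>"
      using D by (rule sets_completionE)
    then have E1: "E1 \<in> sets \<Gamma>" using \<nu>(2) by simp
    obtain N where N: "N \<in> sets borel" "N \<subseteq> f ` E1" "measure \<nu> E1 \<le> measure \<nu> (f -` N \<inter> space \<nu>)"
      using image_inner_set[OF sb \<nu> f(1) E1] by blast
    have "N \<subseteq> D" using N(2) E(1) by auto
    moreover have "measure (completion \<nu>) (\<Gamma>0 \<inter> f -` D) = measure \<nu> E1"
      unfolding E(1) measure_def using emeasure_completion_Un_null[OF E(4,2,3)] by simp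
    ultimately show ?thesis using N by auto
  qed
  have inv_meas: "the_inv_into M0 F \<in> measurable (restrict_space (completion ?lam) N0) (restrict_space ?Q M0)"
  proof (rule measurableI)
    fix b assume "b \<in> space (restrict_space (completion ?lam) N0)"
    then show "the_inv_into M0 F b \<in> space (restrict_space ?Q M0)" 
      unfolding space_RQ space_RN using inv_F blk_M0[of "{b}"] by simp
  next
    fix \<eta> assume "\<eta> \<in> sets (restrict_space ?Q M0)"
    then have \<eta>: "\<eta> \<subseteq> M0" "\<Union>\<eta> \<in> sets (completion \<nu>)" by (auto simp: sets_RQ)
    define D where "D = {b \<in> N0. blk b \<in> \<eta>}"
    define D' where "D' = N0 - D"
    have "\<Gamma>0 \<inter> f -` D = \<Union>\<eta>"
    proof -
      have "blk ` D = \<eta>" using \<eta>(1) by (auto simp: D_def M0_def)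
      then show ?thesis using Un_blk[of D] by simp
    qed
    then have D_c: "\<Gamma>0 \<inter> f -` D \<in> sets (completion \<nu>)" using \<eta>(2) by simp
    have eq': "\<Gamma>0 \<inter> f -` D' = (\<Gamma>0 \<inter> f -` N0) - (\<Gamma>0 \<inter> f -` D)" by (auto simp: D'_def D_def)
    have N0_c: "\<Gamma>0 \<inter> f -` N0 \<in> sets (completion \<nu>)" using pre(1)[of N0] N0_lam by auto
    then have D'_c: "\<Gamma>0 \<inter> f -` D' \<in> sets (completion \<nu>)" unfolding eq' using D_c by blast
    obtain N where N: "N \<in> sets borel" "N \<subseteq> D"
      "measure (completion \<nu>) (\<Gamma>0 \<inter> f -` D) \<le> measure \<nu> (f -` N \<inter> space \<nu>)"
      using inner[OF D_c] by blast
    obtain N' where N': "N' \<in> sets borel" "N' \<subseteq> D'"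
      "measure (completion \<nu>) (\<Gamma>0 \<inter> f -` D') \<le> measure \<nu> (f -` N' \<inter> space \<nu>)"
      using inner[OF D'_c] by blast
    interpret c: prob_space "completion \<nu>" by (rule prob_spaceI) (simp add: \<nu>.emeasure_space_1)
    have "measure (completion \<nu>) (\<Gamma>0 \<inter> f -` N0) = 1"
    proof (subst c.prob_eq_1[OF N0_c])
      show "AE p in completion \<nu>. p \<in> \<Gamma>0 \<inter> f -` N0"
        using AE_completion[OF AE_N1] AE_completion[OF AE_\<Gamma>0] by eventually_elim (use N1_N0 in auto)
    qed
    moreover have "measure (completion \<nu>) (\<Gamma>0 \<inter> f -` D') =
        measure (completion \<nu>) (\<Gamma>0 \<inter> f -` N0) - measure (completion \<nu>) (\<Gamma>0 \<inter> f -` D)"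
      unfolding eq' by (rule c.finite_measure_Diff[OF N0_c D_c]) (auto simp: D_def)
    ultimately have ge: "1 \<le> measure \<nu> (f -` N \<inter> space \<nu>) + measure \<nu> (f -` N' \<inter> space \<nu>)"
      using N(3) N'(3) by linarith
    have vim: "f -` A \<inter> space \<nu> \<in> sets \<nu>" if "A \<in> sets borel" for A
      using that f(1) by (intro measurable_sets[of f _ borel]) (auto simp: measurable_cong_sets[OF \<nu>(2) refl])
    have disj: "N \<inter> N' = {}" using N(2) N'(2) by (auto simp: D'_def)
    have "measure \<nu> (f -` (N \<union> N') \<inter> space \<nu>) = measure \<nu> (f -` N \<inter> space \<nu>) + measure \<nu> (f -` N' \<inter> space \<nu>)"
      using \<nu>.finite_measure_Union[OF vim[OF N(1)] vim[OF N'(1)]] disj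
      by (simp add: Int_Un_distrib2 vimage_Un disjoint_iff)
    then have "measure \<nu> (f -` (N \<union> N') \<inter> space \<nu>) = 1"
      using ge \<nu>.prob_le_1[of "f -` (N \<union> N') \<inter> space \<nu>"] by linarith
    then have AE_NN: "AE p in \<nu>. p \<in> f -` (N \<union> N') \<inter> space \<nu>"
      using \<nu>.AE_in_set_eq_1[OF vim, of "N \<union> N'"] N(1) N'(1) by auto
    let ?Z = "N0 - (N \<union> N')"
    have Z: "?Z \<in> null_sets ?lam"
    proof (rule null_setsI)
      show Zs: "?Z \<in> sets ?lam" using N0_bdry N0_borel N(1) N'(1) by (auto simp: sets_bb)
      have "emeasure ?lam ?Z = emeasure \<nu> (f -` ?Z \<inter> space \<nu>)" using Zs f_bb by (simp add: emeasure_distr)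
      also have "\<dots> = emeasure \<nu> {}"
      proof (rule emeasure_eq_AE)
        show "AE p in \<nu>. (p \<in> f -` ?Z \<inter> space \<nu>) = (p \<in> {})"
          using AE_NN by eventually_elim auto
        show "f -` ?Z \<inter> space \<nu> \<in> sets \<nu>" using N0_borel N(1) N'(1) by (intro vim) auto
      qed simp
      finally show "emeasure ?lam ?Z = 0" by simp
    qed
    have "D \<in> sets (completion ?lam)"
    proof (rule sets_completionI[OF _ _ Z])
      show "D = N \<union> (D - N)" using N(2) by auto
      show "D - N \<subseteq> ?Z" using N'(2) by (auto simp: D_def D'_def)
      show "N \<in> sets ?lam" using N N0_bdry by (auto simp: sets_bb D_def)
    qed
    moreover have "the_inv_into M0 F -` \<eta> \<inter> N0 = D" using inv_F by (auto simp: D_def)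
    ultimately show "the_inv_into M0 F -` \<eta> \<inter> space (restrict_space (completion ?lam) N0)
        \<in> sets (restrict_space (completion ?lam) N0)"
      by (simp add: space_RN sets_RN) (auto simp: D_def)
  qed
  have emeas_Q: "emeasure (restrict_space ?Q M0) (blk ` D) = emeasure (completion ?lam) D"
    if D: "D \<subseteq> N0" "D \<in> sets (completion ?lam)" for D
  proof -
    have "emeasure (restrict_space ?Q M0) (blk ` D) = emeasure ?Q (blk ` D)"
      by (rule emeasure_restrict_space[OF M0_Q' blk_M0[OF D(1)]])
    also have "\<dots> = emeasure (completion \<nu>) (\<Union>(blk ` D))"
    proof (rule Q(3))
      show "blk ` D \<subseteq> P" using blk_M0[OF D(1)] M0_P by blast
      show "\<Union>(blk ` D) \<in> sets (completion \<nu>)" unfolding Un_blk by (rule pre(1)[OF D(2)])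
    qed
    also have "\<dots> = emeasure (completion ?lam) D" unfolding Un_blk by (rule pre(2)[OF D(2)])
    finally show ?thesis .
  qed
  have distr_eq: "distr (restrict_space ?Q M0) (restrict_space (completion ?lam) N0) F =
      restrict_space (completion ?lam) N0"
  proof (rule measure_eqI)
    fix D assume "D \<in> sets (distr (restrict_space ?Q M0) (restrict_space (completion ?lam) N0) F)"
    then have Ds: "D \<in> sets (restrict_space (completion ?lam) N0)" by simp
    then have D: "D \<subseteq> N0" "D \<in> sets (completion ?lam)" by (auto simp: sets_RN)
    have "emeasure (distr (restrict_space ?Q M0) (restrict_space (completion ?lam) N0) F) D =
        emeasure (restrict_space ?Q M0) (blk ` D)"
      using emeasure_distr[OF F_meas Ds] F_vim[OF D(1)] by (simp add: space_RQ)
    also have "\<dots> = emeasure (completion ?lam) D" by (rule emeas_Q[OF D])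
    also have "\<dots> = emeasure (restrict_space (completion ?lam) N0) D"
      by (rule emeasure_restrict_space[OF N0_compl D(1), symmetric])
    finally show "emeasure (distr (restrict_space ?Q M0) (restrict_space (completion ?lam) N0) F) D =
        emeasure (restrict_space (completion ?lam) N0) D" .
  qed simp
  have M0_full: "emeasure ?Q (space ?Q - M0) = 0"
  proof -
    have "\<Union>(P - M0) = space (completion \<nu>) - \<Union>M0"
    proof -
      have "\<Union>P = space (completion \<nu>)" "\<And>C D. C \<in> P \<Longrightarrow> D \<in> P \<Longrightarrow> C \<noteq> D \<Longrightarrow> C \<inter> D = {}"
        using part' by (auto simp: partition_on_def disjoint_def)
      then show ?thesis using M0_P by blast
    qed
    also have "\<Union>M0 = \<Gamma>0 \<inter> f -` N0" by (simp add: M0_def Un_blk)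
    finally have eq: "\<Union>(P - M0) = space (completion \<nu>) - (\<Gamma>0 \<inter> f -` N0)" .
    have s: "\<Gamma>0 \<inter> f -` N0 \<in> sets (completion \<nu>)" using pre(1)[of N0] N0_lam by auto
    have "emeasure ?Q (P - M0) = emeasure (completion \<nu>) (\<Union>(P - M0))"
    proof (rule Q(3))
      show "\<Union>(P - M0) \<in> sets (completion \<nu>)" unfolding eq using s by blast
    qed blast
    also have "\<dots> = emeasure (completion \<nu>) {}"
      unfolding eq
    proof (rule emeasure_eq_AE)
      show "AE p in completion \<nu>. (p \<in> space (completion \<nu>) - (\<Gamma>0 \<inter> f -` N0)) = (p \<in> {})"
        using AE_completion[OF AE_N1] AE_completion[OF AE_\<Gamma>0] by eventually_elim (use N1_N0 in auto)
      show "space (completion \<nu>) - (\<Gamma>0 \<inter> f -` N0) \<in> sets (completion \<nu>)" using s by blast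
    qed simp
    finally show ?thesis by (simp add: Q(1))
  qed
  have inv_M0: "(\<lambda>C. \<beta> g ` C) ` M0 = M0" if g: "g \<in> carrier G" for g
  proof -
    have "(\<lambda>C. \<beta> g ` C) ` M0 = blk ` (\<alpha> g ` N0)" by (simp add: M0_def image_image \<beta>_blk[OF g])
    then show ?thesis by (simp add: \<alpha>_N0[OF g] M0_def)
  qed
  have F_equiv: "F (\<beta> g ` C) = \<alpha> g (F C)" if g: "g \<in> carrier G" and C: "C \<in> M0" for g C
  proof -
    obtain b where b: "b \<in> N0" "C = blk b" using C by (auto simp: M0_def)
    have "\<beta> g ` C = blk (\<alpha> g b)" using \<beta>_blk[OF g] b(2) by simp
    moreover have "F (blk c) = c" if "c \<in> N0" for c using F N0_f that by blast
    ultimately show ?thesis using N0_\<alpha>[OF g b(1)] b by simp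
  qed
  have "isomorphic_mod0 G ?Q (\<lambda>g C. \<beta> g ` C) (completion ?lam) \<alpha>"
    unfolding isomorphic_mod0_def
    using M0_Q N0_lam M0_full N0_full inv_M0 \<alpha>_N0 bij F_meas inv_meas distr_eq F_equiv
    by (intro bexI[of _ M0] bexI[of _ N0] exI[of _ F]) auto
  then show ?thesis using mpart inv_P by blast
qed

end

section \<open>The boundary as a quotient of the Poisson boundary\<close>

context random_walk
begin

lemma measurable_walk_pair:
  "(\<lambda>(x, h). walk G x h) \<in> measurable (count_space (carrier G) \<Otimes>\<^sub>M increments) (path_space G)"
  by (rule measurable_pair_measure_countable1[OF countable_carrier])
    (simp add: measurable_walk_path)

lemma path_measure_eq: "path_measure G \<mu> = distr increments (path_space G) (walk G \<one>)"
proof -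
  let ?R = "return (count_space (carrier G)) \<one>"
  have m: "(\<lambda>(x, h). walk G x h) \<in> measurable (?R \<Otimes>\<^sub>M increments) (path_space G)"
    using measurable_walk_pair
    by (subst measurable_cong_sets[OF sets_pair_measure_cong[OF sets_return refl] refl])
  show ?thesis
    unfolding markov_measure_def
  proof (rule measure_eqI)
    fix A assume "A \<in> sets (distr (?R \<Otimes>\<^sub>M increments) (path_space G) (\<lambda>(x, h). walk G x h))"
    then have A: "A \<in> sets (path_space G)" by simp
    let ?V = "(\<lambda>(x, h). walk G x h) -` A \<inter> space (?R \<Otimes>\<^sub>M increments)"
    have V: "?V \<in> sets (?R \<Otimes>\<^sub>M increments)" by (rule measurable_sets[OF m A])
    have "emeasure (distr (?R \<Otimes>\<^sub>M increments) (path_space G) (\<lambda>(x, h). walk G x h)) A =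
        emeasure (?R \<Otimes>\<^sub>M increments) ?V"
      by (rule emeasure_distr[OF m A])
    also have "\<dots> = (\<integral>\<^sup>+x. emeasure increments (Pair x -` ?V) \<partial>?R)"
      by (rule inc.P.emeasure_pair_measure_alt[OF V])
    also have "\<dots> = emeasure increments (Pair \<one> -` ?V)"
      by (rule nn_integral_return) auto
    also have "Pair \<one> -` ?V = walk G \<one> -` A \<inter> space increments"
      by (auto simp: space_pair_measure)
    also have "emeasure increments \<dots> = emeasure (distr increments (path_space G) (walk G \<one>)) A"
      using A by (simp add: emeasure_distr)
    finally show "emeasure (distr (?R \<Otimes>\<^sub>M increments) (path_space G) (\<lambda>(x, h). walk G x h)) A =
      emeasure (distr increments (path_space G) (walk G \<one>)) A" .
  qed simp
qed

lemma AE_counting_path_measure: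
  assumes Q: "AE x in counting_path_measure G \<mu>. Q x" and y: "y \<in> carrier G"
  shows "AE h in increments. Q (walk G y h)"
proof -
  interpret c: sigma_finite_measure "count_space (carrier G)"
    by (rule sigma_finite_measure_count_space_countable[OF countable_carrier])
  interpret p: pair_sigma_finite "count_space (carrier G)" increments ..
  have "AE p in count_space (carrier G) \<Otimes>\<^sub>M increments. Q ((\<lambda>(x, h). walk G x h) p)"
    using Q unfolding markov_measure_def by (rule AE_distrD[OF measurable_walk_pair])
  then have "AE x in count_space (carrier G). AE h in increments. Q ((\<lambda>(x, h). walk G x h) (x, h))"
    by (rule p.AE_pair)
  then show ?thesis using y by (simp add: AE_count_space)
qed

lemma nn_integral_\<mu>:
  fixes f :: "'a \<Rightarrow> ennreal"
  shows "(\<integral>\<^sup>+g. f g \<partial>\<mu>) = (\<integral>\<^sup>+g. emeasure \<mu> {g} * f g \<partial>count_space (carrier G))"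
proof -
  have "\<mu> = density (count_space (carrier G)) (\<lambda>g. emeasure \<mu> {g})"
  proof (rule measure_eqI_countable[of _ "carrier G"])
    fix a assume a: "a \<in> carrier G"
    have "emeasure (density (count_space (carrier G)) (\<lambda>g. emeasure \<mu> {g})) {a} =
        (\<integral>\<^sup>+g. emeasure \<mu> {g} * indicator {a} g \<partial>count_space (carrier G))"
      using a by (subst emeasure_density) auto
    also have "\<dots> = emeasure \<mu> {a}"
      using a by (subst nn_integral_indicator_singleton) auto
    finally show "emeasure \<mu> {a} = emeasure (density (count_space (carrier G)) (\<lambda>g. emeasure \<mu> {g})) {a}" ..
  qed (use sets_\<mu> countable_carrier in auto)
  then have "(\<integral>\<^sup>+g. f g \<partial>\<mu>) = (\<integral>\<^sup>+g. f g \<partial>density (count_space (carrier G)) (\<lambda>g. emeasure \<mu> {g}))"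
    by simp
  also have "\<dots> = (\<integral>\<^sup>+g. emeasure \<mu> {g} * f g \<partial>count_space (carrier G))"
    by (rule nn_integral_density) auto
  finally show ?thesis .
qed

end

context boundary_walk
begin

lemma measurable_path_limit_bb: "path_limit \<in> measurable (path_space G) bb"
  unfolding boundary_borel_def
  using path_limit_in_bdry[OF bdry_nonempty] by (intro measurable_restrict_space2 measurable_path_limit) auto

definition hitting :: "'b measure" where
  "hitting = distr (path_measure G \<mu>) bb path_limit"

lemma hitting_eq: "hitting = distr increments bb (\<lambda>h. path_limit (walk G \<one> h))"
  unfolding hitting_def path_measure_eq
  by (subst distr_distr) (auto simp: measurable_path_limit_bb comp_def)

lemma measurable_limit_of_walk_bb: "(\<lambda>h. path_limit (walk G \<one> h)) \<in> measurable increments bb"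
  by (rule measurable_compose[OF measurable_walk_path measurable_path_limit_bb]) simp

lemma prob_space_hitting: "prob_space hitting"
  unfolding hitting_eq by (rule inc.P.prob_space_distr[OF measurable_limit_of_walk_bb])

text \<open>Measures on the boundary are the measures on the whole space that charge only the boundary.\<close>

lemma
  assumes \<eta>: "sets \<eta> = sets bb"
  shows measurable_inclusion: "(\<lambda>b. b) \<in> borel_measurable \<eta>"
    and emeasure_inclusion: "A \<in> sets borel \<Longrightarrow> emeasure (distr \<eta> borel (\<lambda>b. b)) A = emeasure \<eta> (A \<inter> bdry)"
proof -
  have sp: "space \<eta> = bdry" using sets_eq_imp_space_eq[OF \<eta>] space_bb by simp
  show m: "(\<lambda>b. b) \<in> borel_measurable \<eta>"
    by (rule measurableI) (use sp \<eta> sets_bb in auto)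
  show "emeasure (distr \<eta> borel (\<lambda>b. b)) A = emeasure \<eta> (A \<inter> bdry)" if "A \<in> sets borel"
    using emeasure_distr[OF m that] sp by simp
qed

lemma stationary_iff_stat:
  assumes \<eta>: "prob_space \<eta>" "sets \<eta> = sets bb"
  shows "stationary G \<mu> \<alpha> \<eta> \<longleftrightarrow> stat (distr \<eta> borel (\<lambda>b. b))"
proof -
  interpret \<eta>: prob_space \<eta> by fact
  let ?L = "distr \<eta> borel (\<lambda>b. b)"
  have sp: "space \<eta> = bdry" using sets_eq_imp_space_eq[OF \<eta>(2)] space_bb by simp
  have sets_\<eta>: "A \<in> sets \<eta> \<longleftrightarrow> A \<subseteq> bdry \<and> A \<in> sets borel" for A using \<eta>(2) sets_bb by simp
  note L = emeasure_inclusion[OF \<eta>(2)]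
  have p: "prob_space ?L" by (rule \<eta>.prob_space_distr[OF measurable_inclusion[OF \<eta>(2)]])
  have one: "measure ?L bdry = 1"
    using L[OF bdry_borel] \<eta>.emeasure_space_1 by (simp add: measure_def sp)
  have act: "emeasure (distr \<eta> \<eta> (\<alpha> g)) A = emeasure ?L (\<alpha> g -` A)"
    if g: "g \<in> carrier G" and A: "A \<in> sets \<eta>" for g A
  proof -
    have "\<alpha> g \<in> measurable \<eta> \<eta>"
    proof (rule measurableI)
      fix B assume "B \<in> sets \<eta>"
      then show "\<alpha> g -` B \<inter> space \<eta> \<in> sets \<eta>" using vimage_\<alpha>[OF g] by (auto simp: sets_\<eta> sp)
    qed (use g in \<open>simp add: sp\<close>)
    from emeasure_distr[OF this A]
    have "emeasure (distr \<eta> \<eta> (\<alpha> g)) A = emeasure \<eta> (\<alpha> g -` A \<inter> bdry)"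
      by (simp add: sp)
    then show ?thesis using L vimage_\<alpha>[OF g] A by (simp add: sets_\<eta>)
  qed
  have "stationary G \<mu> \<alpha> \<eta> \<longleftrightarrow> (\<forall>A\<in>sets \<eta>. emeasure \<eta> A = (\<integral>\<^sup>+g. emeasure ?L (\<alpha> g -` A) \<partial>\<mu>))"
    unfolding stationary_def nn_integral_\<mu>
    by (intro ball_cong refl arg_cong2[where f = "(=)"] nn_integral_cong) (simp add: act)
  also have "\<dots> \<longleftrightarrow> (\<forall>A\<in>sets borel. emeasure ?L A = (\<integral>\<^sup>+g. emeasure ?L (\<alpha> g -` A) \<partial>\<mu>))"
  proof (intro iffI ballI)
    fix A :: "'b set" assume *: "\<forall>A\<in>sets \<eta>. emeasure \<eta> A = (\<integral>\<^sup>+g. emeasure ?L (\<alpha> g -` A) \<partial>\<mu>)" and A: "A \<in> sets borel"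
    have "emeasure ?L A = emeasure \<eta> (A \<inter> bdry)" by (rule L[OF A])
    also have "\<dots> = (\<integral>\<^sup>+g. emeasure ?L (\<alpha> g -` (A \<inter> bdry)) \<partial>\<mu>)"
      using * A bdry_borel by (auto simp: sets_\<eta>)
    also have "\<dots> = (\<integral>\<^sup>+g. emeasure ?L (\<alpha> g -` A) \<partial>\<mu>)"
    proof (rule nn_integral_cong)
      fix g assume "g \<in> space \<mu>"
      then have g: "g \<in> carrier G" by (simp add: space_\<mu>)
      have "\<alpha> g -` (A \<inter> bdry) = \<alpha> g -` A \<inter> bdry" using g by auto
      then show "emeasure ?L (\<alpha> g -` (A \<inter> bdry)) = emeasure ?L (\<alpha> g -` A)"
        using L[OF vimage_\<alpha>[OF g sets.Int[OF A bdry_borel]]] L[OF vimage_\<alpha>[OF g A]]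
        by (simp add: Int_assoc)
    qed
    finally show "emeasure ?L A = (\<integral>\<^sup>+g. emeasure ?L (\<alpha> g -` A) \<partial>\<mu>)" .
  next
    fix A :: "'b set" assume *: "\<forall>A\<in>sets borel. emeasure ?L A = (\<integral>\<^sup>+g. emeasure ?L (\<alpha> g -` A) \<partial>\<mu>)" and "A \<in> sets \<eta>"
    then have A: "A \<in> sets borel" "A \<inter> bdry = A" by (auto simp: sets_\<eta>)
    then show "emeasure \<eta> A = (\<integral>\<^sup>+g. emeasure ?L (\<alpha> g -` A) \<partial>\<mu>)" using * L[OF A(1)] by simp
  qed
  finally show ?thesis using p one by (simp add: stat_def)
qed

lemma stat_hitting: "stat (distr hitting borel (\<lambda>b. b))"
proof -
  obtain L where L: "stat L" using stat_exists by blast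
  have "distr hitting borel (\<lambda>b. b) = distr increments borel (\<lambda>h. path_limit (walk G \<one> h))"
    unfolding hitting_eq
    by (subst distr_distr) (auto simp: measurable_limit_of_walk_bb comp_def measurable_inclusion)
  then show ?thesis using stat_eq_hitting[OF L] L by simp
qed

lemma stationary_hitting: "stationary G \<mu> \<alpha> hitting"
  using stationary_iff_stat[OF prob_space_hitting] stat_hitting by (simp add: hitting_def)

lemma stationary_unique:
  assumes \<eta>: "prob_space \<eta>" "sets \<eta> = sets bb" "stationary G \<mu> \<alpha> \<eta>"
  shows "\<eta> = hitting"
proof (rule measure_eqI)
  have sh: "sets hitting = sets bb" by (simp add: hitting_def)
  show "sets \<eta> = sets hitting" using \<eta>(2) sh by simp
  have eq: "distr \<eta> borel (\<lambda>b. b) = distr hitting borel (\<lambda>b. b)"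
    using stat_eq_hitting[OF stat_hitting] stat_eq_hitting stationary_iff_stat[OF \<eta>(1,2)] \<eta>(3) by metis
  fix A assume "A \<in> sets \<eta>"
  then have A: "A \<in> sets borel" "A \<inter> bdry = A" using \<eta>(2) by (auto simp: sets_bb)
  show "emeasure \<eta> A = emeasure hitting A"
    using emeasure_inclusion[OF \<eta>(2) A(1)] emeasure_inclusion[OF sh A(1)] eq A(2) by simp
qed

text \<open>A measure without point masses gives small mass to small balls, so every set of positive measure
  meets some ball of a countable cover in a smaller set of positive measure.\<close>

lemma nonatomic_hitting: "nonatomic hitting"
  unfolding nonatomic_def
proof (intro ballI impI)
  fix A assume A: "A \<in> sets hitting" "0 < emeasure hitting A"
  interpret h: prob_space hitting by (rule prob_space_hitting)
  have sh: "sets hitting = sets bb" by (simp add: hitting_def)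
  let ?L = "distr hitting borel (\<lambda>b. b)"
  have pos: "0 < measure hitting A / 2" using A(2) by (simp add: h.emeasure_eq_measure)
  obtain \<delta> where \<delta>: "0 < \<delta>" "\<And>y. measure ?L {x. d x y < \<delta>} \<le> measure hitting A / 2"
    by (rule uniformly_small_balls[OF _ _ stat_no_atoms[OF stat_hitting] pos])
      (use stat_hitting in \<open>auto simp: stat_def\<close>)
  obtain D :: "'b set" where D: "countable D" "\<And>x r. 0 < r \<Longrightarrow> \<exists>z\<in>D. d z x < r"
    using countable_dense_subset by blast
  let ?B = "\<lambda>y. {x. d x y < \<delta>} \<inter> bdry"
  have B: "?B y \<in> sets hitting" "measure hitting (?B y) \<le> measure hitting A / 2" for y
  proof -
    have b: "{x. d x y < \<delta>} \<in> sets borel" using open_ball_d[of y \<delta>] by simp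
    then show "?B y \<in> sets hitting" using bdry_borel by (auto simp: sh sets_bb)
    show "measure hitting (?B y) \<le> measure hitting A / 2"
      using \<delta>(2)[of y] emeasure_inclusion[OF sh b] by (simp add: measure_def)
  qed
  have "\<exists>y\<in>D. emeasure hitting (A \<inter> ?B y) \<noteq> 0"
  proof (rule ccontr)
    assume "\<not> (\<exists>y\<in>D. emeasure hitting (A \<inter> ?B y) \<noteq> 0)"
    then have "(\<Union>y\<in>D. A \<inter> ?B y) \<in> null_sets hitting"
      using A(1) B(1) D(1) by (intro null_sets_UN') auto
    moreover have "A \<subseteq> (\<Union>y\<in>D. A \<inter> ?B y)"
    proof
      fix x assume x: "x \<in> A"
      obtain z where "z \<in> D" "d z x < \<delta>" using D(2)[OF \<delta>(1)] by blast
      moreover have "x \<in> bdry" using A(1) x by (auto simp: sh sets_bb)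
      ultimately show "x \<in> (\<Union>y\<in>D. A \<inter> ?B y)" using x by (auto simp: d_commute)
    qed
    ultimately have "emeasure hitting A = 0" by (meson emeasure_eq_0 null_setsD1 null_setsD2)
    then show False using A(2) by simp
  qed
  then obtain y where y: "emeasure hitting (A \<inter> ?B y) \<noteq> 0" by blast
  have m: "A \<inter> ?B y \<in> sets hitting" using A(1) B(1) by blast
  have "measure hitting (A \<inter> ?B y) \<le> measure hitting (?B y)"
    by (rule h.finite_measure_mono[OF _ B(1)]) auto
  then have "measure hitting (A \<inter> ?B y) < measure hitting A" using B(2)[of y] pos by linarith
  then have "emeasure hitting (A \<inter> ?B y) < emeasure hitting A"
    by (simp add: h.emeasure_eq_measure ennreal_less_iff)
  moreover have "0 < emeasure hitting (A \<inter> ?B y)" using y by (simp add: zero_less_iff_neq_zero)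
  ultimately show "\<exists>C\<in>sets hitting. C \<subseteq> A \<and> 0 < emeasure hitting C \<and> emeasure hitting C < emeasure hitting A"
    using m by (intro bexI[of _ "A \<inter> ?B y"] conjI) auto
qed


lemma sets_limit: "{x \<in> space (path_space G). (\<lambda>n. \<iota> (x n)) \<longlonglongrightarrow> path_limit x} \<in> sets (path_space G)"
proof -
  have "(\<lambda>n. \<iota> (x n)) \<longlonglongrightarrow> path_limit x \<longleftrightarrow>
      (\<forall>k. \<exists>N. \<forall>n\<ge>N. d (\<iota> (x n)) (path_limit x) < 1 / real (Suc k))" for x
    by (rule tendsto_iff_d_inverse)
  then have "{x \<in> space (path_space G). (\<lambda>n. \<iota> (x n)) \<longlonglongrightarrow> path_limit x} =
      {x \<in> space (path_space G). \<forall>k. \<exists>N. \<forall>n\<ge>N. d (\<iota> (x n)) (path_limit x) < 1 / real (Suc k)}"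
    by simp
  also have "\<dots> \<in> sets (path_space G)"
  proof -
    have [measurable]: "(\<lambda>x. \<iota> (x n)) \<in> borel_measurable (path_space G)" for n
      unfolding path_space_def
      by (rule measurable_compose[of "\<lambda>x. x n" _ "count_space (carrier G)"]) auto
    note [measurable] = measurable_path_limit
    show ?thesis by measurable
  qed
  finally show ?thesis .
qed

lemma path_limit_shift: "path_limit (\<lambda>n. x (Suc n)) = path_limit x"
proof (cases "\<exists>z\<in>bdry. (\<lambda>n. \<iota> (x n)) \<longlonglongrightarrow> z")
  case True
  then obtain z where z: "z \<in> bdry" "(\<lambda>n. \<iota> (x n)) \<longlonglongrightarrow> z" by auto
  then have "path_limit (\<lambda>n. x (Suc n)) = z" by (intro path_limit_eq LIMSEQ_Suc)
  then show ?thesis using path_limit_eq[OF z(2,1)] by simp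
next
  case False
  then have "\<not> (\<exists>z\<in>bdry. (\<lambda>n. \<iota> (x (Suc n))) \<longlonglongrightarrow> z)"
    using filterlim_sequentially_Suc[of "\<lambda>n. \<iota> (x n)"] by simp
  then show ?thesis using False unfolding path_limit_def by (simp only: if_False)
qed

lemma space_path_space: "x \<in> space (path_space G) \<longleftrightarrow> (\<forall>n. x n \<in> carrier G)"
  by (simp add: path_space_def space_PiM PiE_iff)

lemma invariant_path_limit:
  assumes "A \<in> sets borel"
  shows "{x \<in> space (path_space G). path_limit x \<in> A} \<in> invariant_sets G"
proof -
  have "path_limit -` A \<inter> space (path_space G) \<in> sets (path_space G)"
    by (rule measurable_sets[OF measurable_path_limit assms])
  moreover have "path_limit -` A \<inter> space (path_space G) = {x \<in> space (path_space G). path_limit x \<in> A}"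
    by auto
  ultimately show ?thesis
    by (auto simp: invariant_sets_def path_limit_shift space_path_space)
qed

text \<open>The limit of a path is invariant under the shift, so the sets of paths with limit in a basic open
  set come from the Poisson boundary, and their traces there determine the limit through its code.\<close>

lemma path_limit_factors:
  assumes pb: "poisson_boundary G \<mu> \<Gamma> \<beta> bnd"
  obtains f where "f \<in> borel_measurable \<Gamma>" "\<And>p. f p \<in> bdry"
    "\<And>y. y \<in> carrier G \<Longrightarrow> AE h in increments. f (bnd (walk G y h)) = path_limit (walk G y h)"
proof -
  let ?A = "\<lambda>j. {x \<in> space (path_space G). path_limit x \<in> basis j}"
  have "\<forall>j. \<exists>C. C \<in> sets \<Gamma> \<and> (AE x in counting_path_measure G \<mu>. x \<in> ?A j \<longleftrightarrow> bnd x \<in> C)"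
  proof
    fix j
    have "basis j \<in> sets borel" using open_basis by auto
    then have "?A j \<in> invariant_sets G" by (rule invariant_path_limit)
    then show "\<exists>C. C \<in> sets \<Gamma> \<and> (AE x in counting_path_measure G \<mu>. x \<in> ?A j \<longleftrightarrow> bnd x \<in> C)"
      using pb unfolding poisson_boundary_def by blast
  qed
  then obtain C where C: "\<forall>j. C j \<in> sets \<Gamma> \<and>
      (AE x in counting_path_measure G \<mu>. x \<in> ?A j \<longleftrightarrow> bnd x \<in> C j)"
    by (rule choice[THEN exE])
  obtain b0 where b0: "b0 \<in> bdry" using bdry_nonempty by auto
  define f0 where "f0 p = decode (ternary (\<lambda>j. p \<in> C j))" for p
  define f where "f p = (if f0 p \<in> bdry then f0 p else b0)" for p
  show thesis
  proof (rule that[of f])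
    have "Measurable.pred \<Gamma> (\<lambda>p. p \<in> C j)" for j
    proof -
      have "C j \<in> sets \<Gamma>" using C by blast
      moreover from sets.sets_into_space[OF this] have "{p \<in> space \<Gamma>. p \<in> C j} = C j" by blast
      ultimately show ?thesis by (simp add: pred_def)
    qed
    then have "(\<lambda>p. ternary (\<lambda>j. p \<in> C j)) \<in> borel_measurable \<Gamma>" by (rule measurable_ternary)
    then have [measurable]: "f0 \<in> borel_measurable \<Gamma>"
      unfolding f0_def by (rule measurable_compose[OF _ measurable_decode])
    show "f \<in> borel_measurable \<Gamma>" unfolding f_def by measurable
    show "f p \<in> bdry" for p using b0 by (simp add: f_def)
    fix y assume y: "y \<in> carrier G"
    have "AE h in increments. \<forall>j. walk G y h \<in> ?A j \<longleftrightarrow> bnd (walk G y h) \<in> C j"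
      unfolding AE_all_countable
    proof
      fix j
      have "AE x in counting_path_measure G \<mu>. x \<in> ?A j \<longleftrightarrow> bnd x \<in> C j" using C by blast
      from AE_counting_path_measure[OF this y]
      show "AE h in increments. walk G y h \<in> ?A j \<longleftrightarrow> bnd (walk G y h) \<in> C j" .
    qed
    with AE_space show "AE h in increments. f (bnd (walk G y h)) = path_limit (walk G y h)"
    proof eventually_elim
      case (elim h)
      have "walk G y h \<in> space (path_space G)" using walk_closed[OF y elim(1)] by (simp add: space_path_space)
      then have "(bnd (walk G y h) \<in> C j) = (path_limit (walk G y h) \<in> basis j)" for j using elim(2) by blast
      then have "f0 (bnd (walk G y h)) = path_limit (walk G y h)"
        unfolding f0_def by (simp flip: code_def)
      then show ?case using path_limit_in_bdry[OF bdry_nonempty] by (simp add: f_def)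
    qed
  qed
qed

theorem mu_boundary_hitting:
  assumes pb: "poisson_boundary G \<mu> \<Gamma> \<beta> bnd"
  shows "mu_boundary G \<mu> \<Gamma> \<beta> bnd hitting \<alpha>"
proof -
  have sb: "standard_borel_space \<Gamma>" and act: "group_action G (space \<Gamma>) \<beta>"
    and act_meas: "\<And>g. g \<in> carrier G \<Longrightarrow> \<beta> g \<in> measurable \<Gamma> \<Gamma>"
    and bnd: "bnd \<in> measurable (path_space G) \<Gamma>"
    and bnd_equiv: "\<And>g. g \<in> carrier G \<Longrightarrow>
      AE x in counting_path_measure G \<mu>. bnd (\<lambda>n. g \<otimes> x n) = \<beta> g (bnd x)"
    using pb by (auto simp: poisson_boundary_def)
  obtain f where f: "f \<in> borel_measurable \<Gamma>" "\<And>p. f p \<in> bdry"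
    "\<And>y. y \<in> carrier G \<Longrightarrow> AE h in increments. f (bnd (walk G y h)) = path_limit (walk G y h)"
    using path_limit_factors[OF pb] by blast
  have m: "(\<lambda>h. bnd (walk G \<one> h)) \<in> measurable increments \<Gamma>"
    by (rule measurable_compose[OF measurable_walk_path bnd]) simp
  let ?\<nu> = "harmonic_measure G \<mu> \<Gamma> bnd"
  have \<nu>: "?\<nu> = distr increments \<Gamma> (\<lambda>h. bnd (walk G \<one> h))"
    unfolding harmonic_measure_def path_measure_eq
    by (subst distr_distr[OF bnd]) (auto simp: comp_def)
  have prob: "prob_space ?\<nu>" unfolding \<nu> by (rule inc.P.prob_space_distr[OF m])
  obtain L where L: "stat L" using stat_exists by blast
  have equiv: "AE p in ?\<nu>. f (\<beta> g p) = \<alpha> g (f p)" if g: "g \<in> carrier G" for g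
  proof -
    have [measurable]: "(\<lambda>p. f (\<beta> g p)) \<in> borel_measurable \<Gamma>"
      by (rule measurable_compose[OF act_meas[OF g] f(1)])
    have [measurable]: "(\<lambda>p. \<alpha> g (f p)) \<in> borel_measurable \<Gamma>"
      by (rule measurable_compose[OF f(1) measurable_\<alpha>[OF g]])
    have "{p \<in> space \<Gamma>. d (f (\<beta> g p)) (\<alpha> g (f p)) = 0} \<in> sets \<Gamma>" by measurable
    then have s: "{p \<in> space \<Gamma>. f (\<beta> g p) = \<alpha> g (f p)} \<in> sets \<Gamma>" by simp
    have "AE h in increments. f (\<beta> g (bnd (walk G \<one> h))) = \<alpha> g (f (bnd (walk G \<one> h)))"
      using AE_space f(3)[OF one_closed] f(3)[OF g] AE_path_limit[OF L]
        AE_counting_path_measure[OF bnd_equiv[OF g] one_closed]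
    proof eventually_elim
      case (elim h)
      have eq: "walk G g h = (\<lambda>n. g \<otimes> walk G \<one> h n)"
        using walk_left[OF g one_closed elim(1)] g by (simp add: fun_eq_iff)
      have "(\<lambda>n. \<alpha> g (\<iota> (walk G \<one> h n))) \<longlonglongrightarrow> \<alpha> g (path_limit (walk G \<one> h))"
        by (rule tendsto_\<alpha>[OF g elim(4)])
      then have "(\<lambda>n. \<iota> (walk G g h n)) \<longlonglongrightarrow> \<alpha> g (path_limit (walk G \<one> h))"
        unfolding eq using \<alpha>_\<iota>[OF g walk_closed[OF one_closed elim(1)]] by simp
      then have "path_limit (walk G g h) = \<alpha> g (path_limit (walk G \<one> h))"
        using path_limit_in_bdry[OF bdry_nonempty] g by (intro path_limit_eq) auto
      then show ?case using elim(2,3,5) by (simp add: eq)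
    qed
    then show ?thesis unfolding \<nu> by (subst AE_distr_iff[OF m s])
  qed
  have f_bb: "f \<in> measurable \<Gamma> bb"
    unfolding boundary_borel_def using f(1,2) by (intro measurable_restrict_space2) auto
  have "distr ?\<nu> bb f = distr increments bb (\<lambda>h. f (bnd (walk G \<one> h)))"
    unfolding \<nu> by (subst distr_distr[OF f_bb m]) (simp add: comp_def)
  also have "\<dots> = hitting"
    unfolding hitting_eq
    by (rule distr_cong_AE[OF refl refl f(3)[OF one_closed] measurable_compose[OF m f_bb] measurable_limit_of_walk_bb])
  finally have lam: "distr ?\<nu> bb f = hitting" .
  show ?thesis
    unfolding mu_boundary_def lam[symmetric]
    by (rule equivariant_map_quotient[OF sb prob _ act act_meas f(1,2) equiv]) (simp add: harmonic_measure_def)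
qed

end

section \<open>Compactifications as boundary actions\<close>

text \<open>The topology of a compactification isolates the points of the group: a neighbourhood of such a point
  is the closure of its trace on the dense set \<open>G\<close>.\<close>

lemma compactification_open:
  assumes "compactification G \<iota>" and g: "g \<in> carrier G"
  shows "open {\<iota> g}"
proof -
  have emb: "homeomorphic_map (discrete_topology (carrier G)) (top_of_set (\<iota> ` carrier G)) \<iota>"
    and dense: "closure (\<iota> ` carrier G) = UNIV"
    using assms by (auto simp: compactification_def embedding_map_def)
  have "openin (top_of_set (\<iota> ` carrier G)) (\<iota> ` {g})"
    using homeomorphic_imp_open_map[OF emb] g unfolding open_map_def by (metis empty_subsetI insert_subset openin_discrete_topology)
  then obtain U where U: "open U" "{\<iota> g} = \<iota> ` carrier G \<inter> U" by (auto simp: openin_open)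
  have "U \<subseteq> closure (U \<inter> \<iota> ` carrier G)"
    using open_Int_closure_subset[OF U(1), of "\<iota> ` carrier G"] dense by simp
  also have "U \<inter> \<iota> ` carrier G = {\<iota> g}" using U(2) by auto
  finally have "U \<subseteq> {\<iota> g}" by simp
  then have "U = {\<iota> g}" using U(2) by blast
  then show ?thesis using U(1) by simp
qed

lemma elementary_if_support_fixes:
  assumes "group G" and act: "group_action G UNIV \<alpha>"
    and F: "finite F" "F \<noteq> {}" "F \<subseteq> boundary G \<iota>"
    and supp: "\<And>g. g \<in> carrier G \<Longrightarrow> emeasure \<mu> {g} \<noteq> 0 \<Longrightarrow> \<alpha> g ` F = F"
  shows "elementary G \<iota> \<alpha> (gr G \<mu>)"
proof -
  interpret group G by fact
  interpret A: group_action G UNIV \<alpha> by fact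
  let ?H = "{g \<in> carrier G. emeasure \<mu> {g} \<noteq> 0}"
  have mult: "\<alpha> (g \<otimes>\<^bsub>G\<^esub> h) ` F = \<alpha> g ` \<alpha> h ` F" if "g \<in> carrier G" "h \<in> carrier G" for g h
    using A.composition_rule[OF UNIV_I that] by (simp add: image_image)
  have one: "\<alpha> \<one>\<^bsub>G\<^esub> b = b" for b using A.id_eq_one by (metis UNIV_I restrict_apply')
  have "g \<in> carrier G \<and> \<alpha> g ` F = F" if "g \<in> generate G ?H" for g
    using that
  proof (induction rule: generate.induct)
    case one
    then show ?case using \<open>\<And>b. \<alpha> \<one>\<^bsub>G\<^esub> b = b\<close> by simp
  next
    case (incl h)
    then show ?case using supp by simp
  next
    case (inv h)
    then have h: "h \<in> carrier G" "\<alpha> h ` F = F" using supp by auto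
    have "\<alpha> (inv\<^bsub>G\<^esub> h) ` F = \<alpha> (inv\<^bsub>G\<^esub> h) ` \<alpha> h ` F" using h by simp
    also have "\<dots> = F" using mult[of "inv\<^bsub>G\<^esub> h" h] h one by simp
    finally show ?case using h by simp
  next
    case (eng h1 h2)
    then show ?case using mult by simp
  qed
  then have "\<forall>g\<in>gr G \<mu>. \<alpha> g ` F = F" by (simp add: gr_def)
  then show ?thesis unfolding elementary_def using F by blast
qed

lemma boundary_walk_exists:
  fixes \<iota> :: "'a \<Rightarrow> 'b::{second_countable_topology, t2_space}"
  assumes "group G" and countable: "countable (carrier G)"
    and comp: "compactification G \<iota>" and act: "compatible_action G \<iota> \<alpha>"
    and CP: "condition_CP G \<iota>" and CS: "condition_CS G \<iota> \<alpha>"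
    and \<mu>: "probability_on_group G \<mu>" and ne: "\<not> elementary G \<iota> \<alpha> (gr G \<mu>)"
  shows "\<exists>d S. boundary_walk G \<mu> d \<iota> \<alpha> S"
proof -
  interpret group G by fact
  have "compact (UNIV :: 'b set)" using comp by (simp add: compactification_def)
  from compact_metrizable_exists[OF this] obtain d :: "'b \<Rightarrow> 'b \<Rightarrow> real" where d: "compact_metrizable d"
    by (rule exE)
  interpret compact_metrizable d by (rule d)
  let ?B = "boundary G \<iota>"
  note CS' = CS[unfolded condition_CS_def]
  from conjunct1[OF CS'] obtain F where F: "F \<subseteq> ?B" "card F = 3" by (elim exE conjE)
  from conjunct2[OF CS'] obtain S where
    S1: "\<forall>b1\<in>?B. \<forall>b2\<in>?B. b1 \<noteq> b2 \<longrightarrow> S b1 b2 \<noteq> {} \<and> S b1 b2 \<subseteq> carrier G \<and>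
      (\<forall>g\<in>carrier G. S (\<alpha> g b1) (\<alpha> g b2) = (\<lambda>s. g \<otimes>\<^bsub>G\<^esub> s) ` S b1 b2)"
    and S2: "\<forall>g\<in>carrier G.
      Measurable.pred (restrict_space borel {(b1, b2). b1 \<in> ?B \<and> b2 \<in> ?B \<and> b1 \<noteq> b2}) (\<lambda>(b1, b2). g \<in> S b1 b2)"
    and S3: "\<forall>c0\<in>?B. \<forall>c1\<in>?B. \<forall>c2\<in>?B. c0 \<noteq> c1 \<longrightarrow> c0 \<noteq> c2 \<longrightarrow> c1 \<noteq> c2 \<longrightarrow>
      (\<exists>O0 O1 O2. open O0 \<and> c0 \<in> O0 \<and> openin (top_of_set ?B) O1 \<and> c1 \<in> O1 \<and>
        openin (top_of_set ?B) O2 \<and> c2 \<in> O2 \<and> (\<forall>b1\<in>O1. \<forall>b2\<in>O2. b1 \<noteq> b2 \<longrightarrow> \<iota> ` S b1 b2 \<inter> O0 = {}))"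
    by (elim exE conjE)
  have ga: "group_action G UNIV \<alpha>"
    and hom: "\<And>g. g \<in> carrier G \<Longrightarrow> homeomorphic_map euclidean euclidean (\<alpha> g)"
    and \<alpha>_\<iota>: "\<And>g x. g \<in> carrier G \<Longrightarrow> x \<in> carrier G \<Longrightarrow> \<alpha> g (\<iota> x) = \<iota> (g \<otimes>\<^bsub>G\<^esub> x)"
    using act by (auto simp: compatible_action_def)
  interpret A: group_action G UNIV \<alpha> by (rule ga)
  note op = compactification_open[OF comp]
  have "open (\<Union>g\<in>carrier G. {\<iota> g})" using op by (intro open_UN) auto
  then have B_borel: "?B \<in> sets borel"
    unfolding boundary_def by (simp add: UNION_singleton_eq_range)
  have diag: "{(b1, b2). b1 \<in> ?B \<and> b2 \<in> ?B \<and> b1 \<noteq> b2} \<in> sets (borel \<Otimes>\<^sub>M borel)"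
  proof -
    note [measurable] = B_borel
    have "{p \<in> space (borel \<Otimes>\<^sub>M borel). fst p \<in> ?B \<and> snd p \<in> ?B \<and> d (fst p) (snd p) \<noteq> 0} \<in> sets (borel \<Otimes>\<^sub>M borel)"
      by measurable
    also have "{p \<in> space (borel \<Otimes>\<^sub>M borel). fst p \<in> ?B \<and> snd p \<in> ?B \<and> d (fst p) (snd p) \<noteq> 0} =
        {(b1, b2). b1 \<in> ?B \<and> b2 \<in> ?B \<and> b1 \<noteq> b2}"
      by (auto simp: space_pair_measure)
    finally show ?thesis .
  qed
  have "boundary_walk G \<mu> d \<iota> \<alpha> S"
  proof (intro boundary_walk.intro random_walk.intro random_walk_axioms.intro boundary_action.intro
      boundary_action_axioms.intro boundary_walk_axioms.intro)
    show "group G" "group G" by (rule group_axioms)+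
    show "compact_metrizable d" by (rule d)
    show "countable (carrier G)" "countable (carrier G)" by (rule countable)+
    show "prob_space \<mu>" "sets \<mu> = Pow (carrier G)" using \<mu> by (auto simp: probability_on_group_def)
    show "\<alpha> (g \<otimes>\<^bsub>G\<^esub> h) b = \<alpha> g (\<alpha> h b)" if "g \<in> carrier G" "h \<in> carrier G" for g h b
      by (rule A.composition_rule[OF UNIV_I that])
    show "\<alpha> \<one>\<^bsub>G\<^esub> b = b" for b using A.id_eq_one by (metis UNIV_I restrict_apply')
    show "continuous_on UNIV (\<alpha> g)" if "g \<in> carrier G" for g
      using homeomorphic_imp_continuous_map[OF hom[OF that]] by simp
    show "\<alpha> g (\<iota> x) = \<iota> (g \<otimes>\<^bsub>G\<^esub> x)" if "g \<in> carrier G" "x \<in> carrier G" for g x by (rule \<alpha>_\<iota>[OF that])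
    show "inj_on \<iota> (carrier G)"
      using comp homeomorphic_imp_injective_map[of "discrete_topology (carrier G)" _ \<iota>]
      unfolding compactification_def embedding_map_def topspace_discrete_topology by blast
    show "open {\<iota> g}" if "g \<in> carrier G" for g by (rule op[OF that])
    show "(\<lambda>n. \<iota> (u n \<otimes>\<^bsub>G\<^esub> x)) \<longlonglongrightarrow> b"
      if "range u \<subseteq> carrier G" "(\<lambda>n. \<iota> (u n)) \<longlonglongrightarrow> b" "b \<in> ?B" "x \<in> carrier G" for u b x
      using CP that unfolding condition_CP_def by blast
    show "S b1 b2 \<noteq> {}" "S b1 b2 \<subseteq> carrier G" if "b1 \<in> ?B" "b2 \<in> ?B" "b1 \<noteq> b2" for b1 b2
      using S1[rule_format, OF that] by auto
    show "S (\<alpha> g b1) (\<alpha> g b2) = (\<lambda>s. g \<otimes>\<^bsub>G\<^esub> s) ` S b1 b2"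
      if "b1 \<in> ?B" "b2 \<in> ?B" "b1 \<noteq> b2" "g \<in> carrier G" for b1 b2 g
      using S1[rule_format, OF that(1-3)] that(4) by auto
    show "{(b1, b2). b1 \<in> ?B \<and> b2 \<in> ?B \<and> b1 \<noteq> b2 \<and> s \<in> S b1 b2} \<in> sets (borel \<Otimes>\<^sub>M borel)"
      if s: "s \<in> carrier G" for s
    proof -
      let ?D = "{(b1, b2). b1 \<in> ?B \<and> b2 \<in> ?B \<and> b1 \<noteq> b2}"
      have D: "?D \<in> sets borel" using diag unfolding borel_prod .
      have "{p \<in> space (restrict_space borel ?D). case p of (b1, b2) \<Rightarrow> s \<in> S b1 b2} \<in> sets (restrict_space borel ?D)"
        using S2[rule_format, OF s] by (rule predE)
      then have "{p \<in> space (restrict_space borel ?D). case p of (b1, b2) \<Rightarrow> s \<in> S b1 b2} \<in> sets borel"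
        using sets_restrict_space_iff[of ?D borel] D by simp
      also have "{p \<in> space (restrict_space borel ?D). case p of (b1, b2) \<Rightarrow> s \<in> S b1 b2} =
          {(b1, b2). b1 \<in> ?B \<and> b2 \<in> ?B \<and> b1 \<noteq> b2 \<and> s \<in> S b1 b2}"
        by (auto simp: space_restrict_space)
      finally show ?thesis unfolding borel_prod .
    qed
    show "\<exists>O0 O1 O2. open O0 \<and> c0 \<in> O0 \<and> open O1 \<and> c1 \<in> O1 \<and> open O2 \<and> c2 \<in> O2 \<and>
        (\<forall>b1\<in>O1 \<inter> ?B. \<forall>b2\<in>O2 \<inter> ?B. b1 \<noteq> b2 \<longrightarrow> \<iota> ` S b1 b2 \<inter> O0 = {})"
      if c: "c0 \<in> ?B" "c1 \<in> ?B" "c2 \<in> ?B" "c0 \<noteq> c1" "c0 \<noteq> c2" "c1 \<noteq> c2" for c0 c1 c2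
    proof -
      obtain O0 O1 O2 where O: "open O0" "c0 \<in> O0" "openin (top_of_set ?B) O1" "c1 \<in> O1"
        "openin (top_of_set ?B) O2" "c2 \<in> O2" "\<forall>b1\<in>O1. \<forall>b2\<in>O2. b1 \<noteq> b2 \<longrightarrow> \<iota> ` S b1 b2 \<inter> O0 = {}"
        using S3[rule_format, OF c] by (elim exE conjE)
      obtain T1 where T1: "open T1" "O1 = ?B \<inter> T1" using O(3) unfolding openin_open by auto
      obtain T2 where T2: "open T2" "O2 = ?B \<inter> T2" using O(5) unfolding openin_open by auto
      show ?thesis
        using O(1,2,4,6,7) T1 T2 by (intro exI[of _ O0] exI[of _ T1] exI[of _ T2] conjI) auto
    qed
    show "?B \<noteq> {}" using F by auto
    show "\<exists>g\<in>carrier G. emeasure \<mu> {g} \<noteq> 0 \<and> \<alpha> g ` F \<noteq> F" if "finite F" "F \<noteq> {}" "F \<subseteq> ?B" for F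
      using elementary_if_support_fixes[OF group_axioms ga that, of \<mu>] ne by blast
  qed
  then show ?thesis by (intro exI)
qed

theorem theorem2p4:
  fixes G :: "('a, 'm) monoid_scheme"
    and \<mu> :: "'a measure"
    and \<iota> :: "'a \<Rightarrow> 'b::{second_countable_topology, t2_space}"
    and \<alpha> :: "'a \<Rightarrow> 'b \<Rightarrow> 'b"
  assumes "group G" and "countable (carrier G)"
    and "compactification G \<iota>" and "compatible_action G \<iota> \<alpha>"
    and "condition_CP G \<iota>" and "condition_CS G \<iota> \<alpha>"
    and "probability_on_group G \<mu>"
    and "\<not> elementary G \<iota> \<alpha> (gr G \<mu>)"
  shows "\<exists>lm\<in>measurable (path_space G) (boundary_borel G \<iota>).
    (AE x in path_measure G \<mu>. (\<lambda>n. \<iota> (x n)) \<longlonglongrightarrow> lm x) \<and>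
    (let lam = distr (path_measure G \<mu>) (boundary_borel G \<iota>) lm in
       nonatomic lam \<and>
       (\<forall>(\<Gamma> :: 'c measure) \<beta> bnd. poisson_boundary G \<mu> \<Gamma> \<beta> bnd \<longrightarrow>
          mu_boundary G \<mu> \<Gamma> \<beta> bnd lam \<alpha>) \<and>
       stationary G \<mu> \<alpha> lam \<and>
       (\<forall>\<eta>. prob_space \<eta> \<longrightarrow> sets \<eta> = sets (boundary_borel G \<iota>) \<longrightarrow>
          stationary G \<mu> \<alpha> \<eta> \<longrightarrow> \<eta> = lam))"
proof -
  obtain d S where bw: "boundary_walk G \<mu> d \<iota> \<alpha> S"
    using boundary_walk_exists[OF assms] by (elim exE)
  interpret boundary_walk G \<mu> d \<iota> \<alpha> S by (rule bw)
  obtain L where "stat L" using stat_exists by blast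
  note lim = AE_path_limit[OF this]
  have conv: "AE x in path_measure G \<mu>. (\<lambda>n. \<iota> (x n)) \<longlonglongrightarrow> path_limit x"
    unfolding path_measure_eq
    by (subst AE_distr_iff[OF measurable_walk_path[OF one_closed] sets_limit]) (rule lim)
  show ?thesis
    unfolding Let_def
  proof (intro bexI[OF _ measurable_path_limit_bb] conjI allI impI)
    show "AE x in path_measure G \<mu>. (\<lambda>n. \<iota> (x n)) \<longlonglongrightarrow> path_limit x" by (rule conv)
    show "nonatomic (distr (path_measure G \<mu>) bb path_limit)"
      by (rule nonatomic_hitting[unfolded hitting_def])
    show "stationary G \<mu> \<alpha> (distr (path_measure G \<mu>) bb path_limit)"
      by (rule stationary_hitting[unfolded hitting_def])
    show "mu_boundary G \<mu> \<Gamma> \<beta> bnd (distr (path_measure G \<mu>) bb path_limit) \<alpha>"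
      if "poisson_boundary G \<mu> \<Gamma> \<beta> bnd" for \<Gamma> :: "'c measure" and \<beta> bnd
      by (rule mu_boundary_hitting[OF that, unfolded hitting_def])
    show "\<eta> = distr (path_measure G \<mu>) bb path_limit"
      if "prob_space \<eta>" "sets \<eta> = sets bb" "stationary G \<mu> \<alpha> \<eta>" for \<eta>
      by (rule stationary_unique[OF that, unfolded hitting_def])
  qed
qed

end
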